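(* For every compact set $E \subset \hat{\mathbb{C}}$ there exists a compact set $E' \subset E$ such that $E'$ is conformally removable and $\dim_H E' = \dim_H E$.
   Context: $\hat{\mathbb{C}}$ denotes the Riemann sphere, and $\dim_H$ denotes Hausdorff dimension. A map is called conformal on an open set if it is holomorphic there and invertible (onto its image); for maps of $\hat{\mathbb{C}}$, holomorphic is understood as maps into the Riemann sphere. A compact set $E \subset \hat{\mathbb{C}}$ is conformally removable if for every homeomorphism $f: \hat{\mathbb{C}} \to \hat{\mathbb{C}}$, if $f$ is conformal on $\hat{\mathbb{C}} \setminus E$, then $f$ is conformal on $\hat{\mathbb{C}}$ (equivalently, $f$ is a Möbius transformation). *)

theory Defs
  imports "HOL-Complex_Analysis.Complex_Analysis"
begin

section \<open>The Riemann sphere\<close>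

datatype riemann_sphere = Fin complex | Infty

text \<open>Stereographic projection onto the unit sphere of \<open>\<complex> \<times> \<real>\<close>, the point at
  infinity being sent to the north pole. The sphere carries the induced chordal metric.\<close>

fun stereo :: "riemann_sphere \<Rightarrow> complex \<times> real" where
  "stereo (Fin z) =
     ((2 / ((cmod z)\<^sup>2 + 1)) *\<^sub>R z, ((cmod z)\<^sup>2 - 1) / ((cmod z)\<^sup>2 + 1))"
| "stereo Infty = (0, 1)"

lemma stereo_Fin_snd: "snd (stereo (Fin z)) = 1 - 2 / ((cmod z)\<^sup>2 + 1)"
proof -
  have "(cmod z)\<^sup>2 + 1 \<noteq> 0"
    using zero_le_power2[of "cmod z"] by linarith
  then show ?thesis by (simp add: field_simps)
qed

lemma inj_stereo: "inj stereo"
proof (rule injI)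
  fix p q assume eq: "stereo p = stereo q"
  have pos: "(cmod z)\<^sup>2 + 1 > 0" for z
    using zero_le_power2[of "cmod z"] by linarith
  have ne: "snd (stereo (Fin z)) \<noteq> 1" for z
    using pos[of z] by (simp add: stereo_Fin_snd del: stereo.simps)
  show "p = q"
  proof (cases p; cases q)
    fix z w assume p: "p = Fin z" and q: "q = Fin w"
    have "snd (stereo (Fin z)) = snd (stereo (Fin w))"
      using eq p q by simp
    then have "2 / ((cmod z)\<^sup>2 + 1) = 2 / ((cmod w)\<^sup>2 + 1)"
      unfolding stereo_Fin_snd by simp
    moreover have "(2 / ((cmod z)\<^sup>2 + 1)) *\<^sub>R z = (2 / ((cmod w)\<^sup>2 + 1)) *\<^sub>R w"
      using eq p q by simp
    moreover have "2 / ((cmod w)\<^sup>2 + 1) \<noteq> 0"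
      using pos[of w] by simp
    ultimately have "z = w" by (metis scaleR_left_imp_eq)
    then show "p = q" using p q by simp
  next
    fix z assume "p = Fin z" "q = Infty"
    then show "p = q" using eq ne[of z] by (metis snd_conv stereo.simps(2))
  next
    fix z assume "p = Infty" "q = Fin z"
    then show "p = q" using eq ne[of z] by (metis snd_conv stereo.simps(2))
  qed auto
qed

instantiation riemann_sphere :: metric_space
begin

definition dist_riemann_sphere :: "riemann_sphere \<Rightarrow> riemann_sphere \<Rightarrow> real" where
  "dist_riemann_sphere p q = dist (stereo p) (stereo q)"

definition uniformity_riemann_sphere :: "(riemann_sphere \<times> riemann_sphere) filter" where
  "uniformity_riemann_sphere = (INF e\<in>{0<..}. principal {(p :: riemann_sphere, q). dist p q < e})"

definition open_riemann_sphere :: "riemann_sphere set \<Rightarrow> bool" where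
  "open_riemann_sphere U = (\<forall>p\<in>U. \<forall>\<^sub>F (p', q) in uniformity. p' = p \<longrightarrow> q \<in> U)"

instance
proof
  fix p q r :: riemann_sphere
  show "dist p q = 0 \<longleftrightarrow> p = q"
    by (simp add: dist_riemann_sphere_def inj_eq[OF inj_stereo])
  show "dist p q \<le> dist p r + dist q r"
    by (simp add: dist_riemann_sphere_def dist_triangle2)
qed (simp_all add: uniformity_riemann_sphere_def open_riemann_sphere_def)

end

lemma range_stereo: "range stereo = sphere 0 1"
proof (intro equalityI subsetI)
  fix x assume "x \<in> range stereo"
  then obtain p where x: "x = stereo p" by blast
  show "x \<in> sphere 0 1"
  proof (cases p)
    case (Fin z)
    define a where "a = (cmod z)\<^sup>2"
    have a: "a + 1 > 0" using zero_le_power2[of "cmod z"] a_def by linarith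
    have "(norm x)\<^sup>2 = (2 / (a + 1))\<^sup>2 * a + ((a - 1) / (a + 1))\<^sup>2"
      using x Fin by (simp add: norm_prod_def a_def power_mult_distrib power_divide)
    also have "\<dots> = (4 * a + (a - 1)\<^sup>2) / (a + 1)\<^sup>2"
      by (simp add: power_divide add_divide_distrib)
    also have "4 * a + (a - 1)\<^sup>2 = (a + 1)\<^sup>2"
      by (simp add: power2_eq_square algebra_simps)
    finally have "(norm x)\<^sup>2 = 1" using a by simp
    then show ?thesis using norm_ge_zero[of x] by (auto simp: power2_eq_1_iff simp del: norm_ge_zero)
  qed (simp add: x norm_prod_def)
next
  fix x :: "complex \<times> real" assume x: "x \<in> sphere 0 1"
  obtain \<zeta> t where xt: "x = (\<zeta>, t)" by (cases x)
  have n: "(cmod \<zeta>)\<^sup>2 + t\<^sup>2 = 1" using x xt by (simp add: norm_prod_def)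
  show "x \<in> range stereo"
  proof (cases "t = 1")
    case True
    then have "x = stereo Infty" using n xt by simp
    then show ?thesis by blast
  next
    case False
    define z where "z = (1 / (1 - t)) *\<^sub>R \<zeta>"
    have "(cmod z)\<^sup>2 = (1 - t\<^sup>2) / (1 - t)\<^sup>2"
      using n by (simp add: z_def power_divide power2_abs field_simps)
    also have "\<dots> = (1 + t) / (1 - t)"
    proof -
      have "1 - t\<^sup>2 = (1 - t) * (1 + t)"
        by (simp add: power2_eq_square algebra_simps)
      then show ?thesis using False by (simp add: power2_eq_square)
    qed
    finally have c: "(cmod z)\<^sup>2 = (1 + t) / (1 - t)" .
    have "(cmod z)\<^sup>2 + 1 = 2 / (1 - t)" "(cmod z)\<^sup>2 - 1 = 2 * t / (1 - t)"
      using False by (simp_all add: c field_simps)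
    then have "stereo (Fin z) = x"
      using False by (simp add: xt) (simp add: z_def)
    then show ?thesis by blast
  qed
qed

lemma compact_UNIV_riemann_sphere: "compact (UNIV :: riemann_sphere set)"
proof -
  define g where "g = inv stereo"
  have g: "g (stereo p) = p" for p by (simp add: g_def inj_stereo)
  have "continuous_on (range stereo) g"
    unfolding continuous_on_iff
    by (auto simp: g dist_riemann_sphere_def)
  then have "compact (g ` range stereo)"
    by (rule compact_continuous_image) (unfold range_stereo, rule compact_sphere)
  moreover have "g ` range stereo = UNIV" by (auto simp: g image_image)
  ultimately show ?thesis by simp
qed


section \<open>Holomorphic and conformal maps of the sphere\<close>

text \<open>The inversion \<open>z \<mapsto> 1/z\<close> of the sphere. The two standard charts are the inverses of
  \<open>Fin\<close> and \<open>rs_inv \<circ> Fin\<close>, with images \<open>UNIV - {Infty}\<close> and \<open>UNIV - {Fin 0}\<close>.\<close>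

fun rs_inv :: "riemann_sphere \<Rightarrow> riemann_sphere" where
  "rs_inv (Fin z) = (if z = 0 then Infty else Fin (1 / z))"
| "rs_inv Infty = Fin 0"

text \<open>The value at \<open>Infty\<close> is a dummy: the definition below never uses it.\<close>

fun rs_coord :: "riemann_sphere \<Rightarrow> complex" where
  "rs_coord (Fin z) = z"
| "rs_coord Infty = 0"

text \<open>Holomorphy on an open set \<open>U\<close> as a map of Riemann surfaces: continuity, together with
  holomorphy of all coordinate expressions, where \<open>\<alpha>\<close> selects the chart in the source and
  \<open>\<beta>\<close> the chart in the target.\<close>

definition rs_holomorphic_on ::
    "(riemann_sphere \<Rightarrow> riemann_sphere) \<Rightarrow> riemann_sphere set \<Rightarrow> bool" where
  "rs_holomorphic_on f U \<longleftrightarrow>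
     continuous_on U f \<and>
     (\<forall>\<alpha>\<in>{id, rs_inv}. \<forall>\<beta>\<in>{id, rs_inv}.
        (\<lambda>z. rs_coord (\<beta> (f (\<alpha> (Fin z))))) holomorphic_on
          {z. \<alpha> (Fin z) \<in> U \<and> \<beta> (f (\<alpha> (Fin z))) \<noteq> Infty})"

definition rs_conformal_on ::
    "(riemann_sphere \<Rightarrow> riemann_sphere) \<Rightarrow> riemann_sphere set \<Rightarrow> bool" where
  "rs_conformal_on f U \<longleftrightarrow> rs_holomorphic_on f U \<and> inj_on f U"

text \<open>Intended for compact \<open>E\<close>, so that the complement is open.\<close>

definition conformally_removable :: "riemann_sphere set \<Rightarrow> bool" where
  "conformally_removable E \<longleftrightarrow>
     (\<forall>f g. homeomorphism UNIV UNIV f g \<longrightarrow>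
        rs_conformal_on f (- E) \<longrightarrow> rs_conformal_on f UNIV)"


section \<open>Hausdorff dimension\<close>

text \<open>The summand \<open>(diam U)\<^sup>s\<close>, with \<open>0\<^sup>0 = 1\<close> for nonempty sets and the empty set
  contributing nothing (recall that \<open>0 powr 0 = 0\<close>).\<close>

definition hausdorff_gauge :: "real \<Rightarrow> 'a::metric_space set \<Rightarrow> real" where
  "hausdorff_gauge s U =
     (if U = {} then 0 else if s = 0 then 1 else diameter U powr s)"

text \<open>Boundedness is required since \<open>diameter\<close> is meaningless on unbounded sets.\<close>

definition hausdorff_covers ::
    "real \<Rightarrow> 'a::metric_space set \<Rightarrow> (nat \<Rightarrow> 'a set) set" where
  "hausdorff_covers \<delta> E =
     {U. E \<subseteq> (\<Union>i. U i) \<and> (\<forall>i. bounded (U i) \<and> diameter (U i) \<le> \<delta>)}"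

definition hausdorff_premeasure :: "real \<Rightarrow> real \<Rightarrow> 'a::metric_space set \<Rightarrow> ennreal" where
  "hausdorff_premeasure s \<delta> E =
     (INF U\<in>hausdorff_covers \<delta> E. \<Sum>i. ennreal (hausdorff_gauge s (U i)))"

definition hausdorff_measure :: "real \<Rightarrow> 'a::metric_space set \<Rightarrow> ennreal" where
  "hausdorff_measure s E = (SUP \<delta>\<in>{0<..}. hausdorff_premeasure s \<delta> E)"

definition hausdorff_dim :: "'a::metric_space set \<Rightarrow> ennreal" where
  "hausdorff_dim E = Inf {ennreal s | s. 0 \<le> s \<and> hausdorff_measure s E = 0}"

end

theory Submission
  imports Defs
begin

text \<open>
  A set is removable as soon as it can be enclosed, at arbitrarily small
  scales, in few squares that are separated by empty strips which are not too thin. Such a set can be carved out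
  of any compact set at an arbitrarily small cost in dimension, because deleting a thin strip costs little
  content if the position of the strip is chosen well.

  Let \<open>K\<close> be a closed subset of the plane that misses the open
  \<open>\<epsilon> * L\<close>-neighbourhoods of the lines of a square grid of mesh \<open>L\<close>, and let \<open>f\<close> be continuous and
  injective, and holomorphic off \<open>K\<close>. By Morera's theorem it suffices that the integral of \<open>f\<close> around every rectangle
  vanishes. The grid cuts the rectangle into cells. Cells that miss \<open>K\<close> contribute nothing; the cells that meet
  the boundary number \<open>O(1 / L)\<close>, and uniform continuity makes their total contribution small. A cell that
  meets \<open>K\<close> contributes at most \<open>8 * L\<^sup>2 * \<bar>f' c\<bar>\<close> for some point \<open>c\<close> of its boundary. The disc of radius \<open>\<epsilon> * L\<close>
  around \<open>c\<close> misses \<open>K\<close>, so by Bloch's theorem its image contains a disc of radius comparable to \<open>\<epsilon> * L * \<bar>f' c\<bar>\<close>.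
  Since \<open>f\<close> is injective, these image discs have bounded overlap, and they stay in a bounded set. Hence
  the sum of \<open>(\<epsilon> * L * \<bar>f' c\<bar>)\<^sup>2\<close> is bounded, and by the Cauchy--Schwarz inequality the cells
  contribute at most a constant times the square root of \<open>N * L\<^sup>2 / \<epsilon>\<^sup>2\<close>, where \<open>N\<close> counts the cells that meet \<open>K\<close>. This
  is lemma \<open>rect_integral_grid_bound\<close>; \<open>loc_removable_if_grid_thin\<close> lets \<open>L\<close> tend to \<open>0\<close>.

  Let \<open>E\<close> be compact of area zero. Then \<open>N * L\<^sup>2\<close> tends to \<open>0\<close> with \<open>L\<close>, uniformly in the
  position of the grid. So one may first fix a summable sequence of strip widths \<open>\<epsilon>\<close>, and then choose the scales \<open>L\<close> so small that
  \<open>N * L\<^sup>2 / \<epsilon>\<^sup>2\<close> tends to \<open>0\<close>. At each scale there are about \<open>1 / \<epsilon>\<close> shifted strip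
  systems that are essentially disjoint. What is needed is a size on sets for which some system carries only a proportion
  \<open>O(\<epsilon>)\<close>. Hausdorff content is not additive enough for that, but the weighted content,
  in which covers may have fractional multiplicity, is: the average of covers of the remainders is a cover of the whole up to a factor
  (\<open>weighted_content_average\<close>). Weighted content is continuous along decreasing compact sets
  (\<open>weighted_content_outer_regular\<close>), and it vanishes on the same sets as Hausdorff measure, up to an arbitrarily small loss in
  the exponent. So the intersection of all the remainders is thin and has content (\<open>grid_thin_subset_of_null_set\<close>).

  If \<open>E\<close> has positive area, an intersection of \<open>E\<close> with a translate of a self-similar
  null set of dimension close to \<open>2\<close> takes its place; Fubini's theorem provides translations for which the finite stages of this
  set meet \<open>E\<close> in sets of content bounded below, and a limit of these translations works for the null set itself (\<open>null_subset_of_positive_content\<close>).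

  The construction loses an arbitrarily small amount of dimension. To lose nothing,
  it is applied in a sequence of discs that shrink to a point near which \<open>E\<close> has its full
  dimension; the union of the resulting sets and this point is compact and still removable, removability being a local property here
  (\<open>planar_removable_subset_of_full_dimension\<close>). Finally the sphere is the union of the image of the closed
  unit disc under \<open>Fin\<close>, which is bi-Lipschitz on this disc, and of the image of that set under the isometry \<open>rs_inv\<close>.
\<close>

section \<open>Integrals around rectangles and Morera's theorem\<close>

definition hor_integral :: "(complex \<Rightarrow> complex) \<Rightarrow> real \<Rightarrow> real \<Rightarrow> real \<Rightarrow> complex" where
  "hor_integral f y x1 x2 = contour_integral (linepath (Complex x1 y) (Complex x2 y)) f"

definition ver_integral :: "(complex \<Rightarrow> complex) \<Rightarrow> real \<Rightarrow> real \<Rightarrow> real \<Rightarrow> complex" where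
  "ver_integral f x y1 y2 = contour_integral (linepath (Complex x y1) (Complex x y2)) f"

text \<open>The integral along the boundary, counterclockwise if \<open>x1 \<le> x2\<close> and
  \<open>y1 \<le> y2\<close>. Unlike a closed path, the four terms make additivity under subdivision
  a matter of cancellation.\<close>

definition rect_integral :: "(complex \<Rightarrow> complex) \<Rightarrow> real \<Rightarrow> real \<Rightarrow> real \<Rightarrow> real \<Rightarrow> complex" where
  "rect_integral f x1 x2 y1 y2 = hor_integral f y1 x1 x2 + ver_integral f x2 y1 y2 - hor_integral f y2 x1 x2 - ver_integral f x1 y1 y2"

lemma closed_segment_horizontal:
  "closed_segment (Complex x1 y) (Complex x2 y) = (\<lambda>t. Complex t y) ` closed_segment x1 x2"
  by (auto simp: closed_segment_def image_iff complex_eq_iff algebra_simps)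

lemma closed_segment_vertical:
  "closed_segment (Complex x y1) (Complex x y2) = (\<lambda>t. Complex x t) ` closed_segment y1 y2"
  by (auto simp: closed_segment_def image_iff complex_eq_iff algebra_simps)

lemma mem_horizontal_segment [simp]:
  "Complex t y \<in> closed_segment (Complex a y) (Complex b y) \<longleftrightarrow> t \<in> closed_segment a b"
  by (auto simp: closed_segment_horizontal)

lemma mem_vertical_segment [simp]:
  "Complex x t \<in> closed_segment (Complex x a) (Complex x b) \<longleftrightarrow> t \<in> closed_segment a b"
  by (auto simp: closed_segment_vertical)

lemma linepath_integral_concat:
  assumes f: "continuous_on B f" and B: "convex B" and m: "a \<in> B" "b \<in> B" "c \<in> B"
    and col: "b \<in> closed_segment a c \<or> a \<in> closed_segment b c \<or> c \<in> closed_segment a b"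
  shows "contour_integral (linepath a c) f =
    contour_integral (linepath a b) f + contour_integral (linepath b c) f"
proof -
  have *: "continuous_on (closed_segment u v) f" if "u \<in> {a,b,c}" "v \<in> {a,b,c}" for u v
    using m B that by (intro continuous_on_subset[OF f] closed_segment_subset) auto
  have rev: "contour_integral (linepath u v) f = - contour_integral (linepath v u) f"
    if "u \<in> {a,b,c}" "v \<in> {a,b,c}" for u v
    using contour_integral_reverse_linepath[OF *[OF that]] .
  from col show ?thesis
  proof (elim disjE)
    assume "b \<in> closed_segment a c"
    then show ?thesis using contour_integral_split_linepath[OF *[of a c]] by simp
  next
    assume "a \<in> closed_segment b c"
    then show ?thesis using contour_integral_split_linepath[OF *[of b c]] rev[of a b] by simp
  next
    assume "c \<in> closed_segment a b"
    then show ?thesis using contour_integral_split_linepath[OF *[of a b]] rev[of b c] by simp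
  qed
qed

lemma hor_integral_concat:
  assumes "continuous_on B f" "convex B" "Complex a y \<in> B" "Complex b y \<in> B" "Complex c y \<in> B"
  shows "hor_integral f y a c = hor_integral f y a b + hor_integral f y b c"
  unfolding hor_integral_def
  by (rule linepath_integral_concat[OF assms])
    (auto simp: closed_segment_eq_real_ivl)

lemma ver_integral_concat:
  assumes "continuous_on B f" "convex B" "Complex x a \<in> B" "Complex x b \<in> B" "Complex x c \<in> B"
  shows "ver_integral f x a c = ver_integral f x a b + ver_integral f x b c"
  unfolding ver_integral_def
  by (rule linepath_integral_concat[OF assms])
    (auto simp: closed_segment_eq_real_ivl)

lemma hor_integral_self [simp]: "hor_integral f y a a = 0" and ver_integral_self [simp]: "ver_integral f y a a = 0"
  by (simp_all add: hor_integral_def ver_integral_def)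

lemma hor_integral_swap:
  assumes "continuous_on (closed_segment (Complex a y) (Complex b y)) f"
  shows "hor_integral f y a b = - hor_integral f y b a"
  unfolding hor_integral_def using contour_integral_reverse_linepath[OF assms] .

lemma ver_integral_swap:
  assumes "continuous_on (closed_segment (Complex x a) (Complex x b)) f"
  shows "ver_integral f x a b = - ver_integral f x b a"
  unfolding ver_integral_def using contour_integral_reverse_linepath[OF assms] .

lemma rect_integral_degenerate [simp]: "rect_integral f a a c d = 0" "rect_integral f a b c c = 0"
  by (simp_all add: rect_integral_def)

lemma linepath_integral_approx:
  assumes f: "continuous_on (closed_segment a b) f" and B: "0 \<le> B"
    and bd: "\<And>z. z \<in> closed_segment a b \<Longrightarrow> cmod (f z - c) \<le> B"
  shows "cmod (contour_integral (linepath a b) f - c * (b - a)) \<le> B * cmod (b - a)"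
proof -
  have "(f has_contour_integral contour_integral (linepath a b) f) (linepath a b)"
    using f by (simp add: contour_integrable_continuous_linepath has_contour_integral_integral)
  then have "((\<lambda>x. f x - c) has_contour_integral
       (contour_integral (linepath a b) f - c * (b - a))) (linepath a b)"
    by (intro has_contour_integral_diff has_contour_integral_const_linepath)
  then show ?thesis
    by (rule has_contour_integral_bound_linepath) (use B bd in auto)
qed

text \<open>Near a point, integrating first horizontally and then vertically gives a function whose
  increments do not depend on the base point, because the integral around rectangles vanishes. It is
  therefore a primitive of \<open>f\<close>, and the derivative of a holomorphic function is
  holomorphic.\<close>

lemma Morera_rectangle:
  assumes U: "open U" and f: "continuous_on U f"
    and rect: "\<And>x1 x2 y1 y2. x1 \<le> x2 \<Longrightarrow> y1 \<le> y2 \<Longrightarrow>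
      cbox (Complex x1 y1) (Complex x2 y2) \<subseteq> U \<Longrightarrow> rect_integral f x1 x2 y1 y2 = 0"
  shows "f holomorphic_on U"
proof -
  have "f field_differentiable at z0" if "z0 \<in> U" for z0
  proof -
    obtain e0 where e0: "e0 > 0" "ball z0 e0 \<subseteq> U"
      using U \<open>z0 \<in> U\<close> openE by blast
    define e where "e = e0 / 2"
    define B where "B = {w. \<bar>Re w - Re z0\<bar> < e \<and> \<bar>Im w - Im z0\<bar> < e}"
    have e: "e > 0" using e0 by (simp add: e_def)
    have BU: "B \<subseteq> U"
    proof
      fix w assume w: "w \<in> B"
      have "cmod (w - z0) \<le> \<bar>Re (w - z0)\<bar> + \<bar>Im (w - z0)\<bar>" by (rule cmod_le)
      also have "\<dots> < e0" using w by (simp add: B_def e_def)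
      finally show "w \<in> U" using e0 by (auto simp: dist_norm norm_minus_commute)
    qed
    have Bb: "B = box (z0 - Complex e e) (z0 + Complex e e)"
      by (auto simp: B_def in_box_complex_iff abs_less_iff)
    have oB: "open B" unfolding Bb by (rule open_box)
    have convB: "convex B" unfolding Bb by (rule convex_box)
    have fB: "continuous_on B f" using f BU continuous_on_subset by blast
    have segB: "continuous_on (closed_segment a b) f" if "a \<in> B" "b \<in> B" for a b
      using continuous_on_subset[OF fB closed_segment_subset[OF that convB]] .
    have r1: "rect_integral f x1 x2 y1 y2 = 0"
      if "x1 \<le> x2" "y1 \<le> y2" "Complex x1 y1 \<in> B" "Complex x2 y2 \<in> B" for x1 x2 y1 y2
    proof (rule rect)
      show "cbox (Complex x1 y1) (Complex x2 y2) \<subseteq> U"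
      proof
        fix t assume "t \<in> cbox (Complex x1 y1) (Complex x2 y2)"
        then have "t \<in> B" using that by (simp add: B_def in_cbox_complex_iff) linarith
        then show "t \<in> U" using BU by blast
      qed
    qed (use that in auto)
    have r2: "rect_integral f x1 x2 y1 y2 = 0"
      if "y1 \<le> y2" "Complex x1 y1 \<in> B" "Complex x2 y2 \<in> B" for x1 x2 y1 y2
    proof (cases "x1 \<le> x2")
      case False
      have 0: "Complex x2 y1 \<in> B" "Complex x1 y2 \<in> B" using that by (auto simp: B_def)
      then have "rect_integral f x2 x1 y1 y2 = 0" using False that r1 by auto
      moreover have "hor_integral f y1 x1 x2 = - hor_integral f y1 x2 x1" "hor_integral f y2 x1 x2 = - hor_integral f y2 x2 x1"
        using that 0 by (auto intro!: hor_integral_swap segB)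
      ultimately show ?thesis by (simp add: rect_integral_def algebra_simps)
    qed (use r1 that in auto)
    have r3: "rect_integral f x1 x2 y1 y2 = 0"
      if "Complex x1 y1 \<in> B" "Complex x2 y2 \<in> B" for x1 x2 y1 y2
    proof (cases "y1 \<le> y2")
      case False
      have 0: "Complex x2 y1 \<in> B" "Complex x1 y2 \<in> B" using that by (auto simp: B_def)
      then have "rect_integral f x1 x2 y2 y1 = 0" using False that r2 by auto
      moreover have "ver_integral f x1 y1 y2 = - ver_integral f x1 y2 y1" "ver_integral f x2 y1 y2 = - ver_integral f x2 y2 y1"
        using that 0 by (auto intro!: ver_integral_swap segB)
      ultimately show ?thesis by (simp add: rect_integral_def algebra_simps)
    qed (use r2 that in auto)
    \<comment> \<open>The primitive: from \<open>z0\<close> first horizontally, then vertically.\<close>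
    define F where "F w = hor_integral f (Im z0) (Re z0) (Re w) + ver_integral f (Re w) (Im z0) (Im w)" for w
    have z0B: "z0 \<in> B" using e by (simp add: B_def)
    \<comment> \<open>The path to \<open>w\<close> may be rerouted through \<open>z\<close>, since all rectangles in \<open>B\<close> have integral zero.\<close>
    have dF: "F w - F z = hor_integral f (Im z) (Re z) (Re w) + ver_integral f (Re w) (Im z) (Im w)"
      if "z \<in> B" "w \<in> B" for z w
    proof -
      have m: "Complex a b \<in> B" if "\<exists>u\<in>{z0,z,w}. a = Re u" "\<exists>u\<in>{z0,z,w}. b = Im u" for a b
        using that \<open>z \<in> B\<close> \<open>w \<in> B\<close> z0B by (auto simp: B_def)
      have "rect_integral f (Re z) (Re w) (Im z0) (Im z) = 0"
        by (rule r3; rule m; simp)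
      moreover have "hor_integral f (Im z0) (Re z0) (Re w) = hor_integral f (Im z0) (Re z0) (Re z) + hor_integral f (Im z0) (Re z) (Re w)"
        by (rule hor_integral_concat[OF fB convB]; rule m; simp)
      moreover have "ver_integral f (Re w) (Im z0) (Im w) = ver_integral f (Re w) (Im z0) (Im z) + ver_integral f (Re w) (Im z) (Im w)"
        by (rule ver_integral_concat[OF fB convB]; rule m; simp)
      ultimately show ?thesis by (simp add: F_def rect_integral_def algebra_simps)
    qed
    have "(F has_field_derivative f z) (at z)" if z: "z \<in> B" for z
      unfolding has_field_derivative_iff LIM_def
    proof (intro allI impI)
      fix r :: real assume r: "r > 0"
      obtain d1 where d1: "d1 > 0" "ball z d1 \<subseteq> B" using oB z openE by blast
      obtain d2 where d2: "d2 > 0" "\<And>w. w \<in> B \<Longrightarrow> dist w z < d2 \<Longrightarrow> dist (f w) (f z) < r / 4"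
        using fB z r unfolding continuous_on_iff by (metis divide_pos_pos zero_less_numeral)
      show "\<exists>s>0. \<forall>w. w \<noteq> z \<and> dist w z < s \<longrightarrow> dist ((F w - F z) / (w - z)) (f z) < r"
      proof (intro exI[of _ "min d1 d2"] conjI allI impI)
        fix w assume w: "w \<noteq> z \<and> dist w z < min d1 d2"
        have bd: "ball z (min d1 d2) \<subseteq> B" using d1 by auto
        define c where "c = Complex (Re w) (Im z)"
        have cz: "cmod (c - z) \<le> cmod (w - z)" "cmod (w - c) \<le> cmod (w - z)"
          unfolding c_def cmod_def by simp_all
        have mem: "z \<in> ball z (min d1 d2)" "c \<in> ball z (min d1 d2)" "w \<in> ball z (min d1 d2)"
          using w cz d1 d2 by (auto simp: dist_norm norm_minus_commute)
        have est: "cmod (contour_integral (linepath a b) f - f z * (b - a)) \<le> r / 4 * cmod (b - a)"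
          if ab: "a \<in> ball z (min d1 d2)" "b \<in> ball z (min d1 d2)" for a b
        proof -
          have sub: "closed_segment a b \<subseteq> ball z (min d1 d2)"
            using ab by (simp add: closed_segment_subset)
          have "continuous_on (closed_segment a b) f"
            using fB continuous_on_subset sub bd by (meson order_trans)
          then show ?thesis
          proof (rule linepath_integral_approx)
            fix x assume "x \<in> closed_segment a b"
            then have "x \<in> B" "dist x z < d2" using sub bd by (auto simp: dist_commute)
            then show "cmod (f x - f z) \<le> r / 4" using d2(2) by (force simp: dist_norm)
          qed (use r in auto)
        qed
        have "F w - F z = contour_integral (linepath z c) f + contour_integral (linepath c w) f"
          using dF[OF subsetD[OF bd mem(1)] subsetD[OF bd mem(3)]] by (simp add: hor_integral_def ver_integral_def c_def)
        then have "F w - F z - f z * (w - z) =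
            (contour_integral (linepath z c) f - f z * (c - z)) + (contour_integral (linepath c w) f - f z * (w - c))"
          by (simp add: algebra_simps)
        also have "cmod \<dots> \<le> r / 4 * cmod (c - z) + r / 4 * cmod (w - c)"
          using est[OF mem(1,2)] est[OF mem(2,3)] norm_triangle_le add_mono by blast
        also have "\<dots> \<le> r / 4 * cmod (w - z) + r / 4 * cmod (w - z)"
          using cz r by (intro add_mono mult_left_mono) auto
        finally have *: "cmod (F w - F z - f z * (w - z)) \<le> r / 2 * cmod (w - z)" by simp
        have "(F w - F z) / (w - z) - f z = (F w - F z - f z * (w - z)) / (w - z)"
          using w by (simp add: field_simps)
        then have "dist ((F w - F z) / (w - z)) (f z) = cmod (F w - F z - f z * (w - z)) / cmod (w - z)"
          by (simp add: dist_norm norm_divide)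
        also have "\<dots> \<le> r / 2"
          using * w by (simp add: pos_divide_le_eq)
        finally show "dist ((F w - F z) / (w - z)) (f z) < r" using r by simp
      qed (use d1 d2 in auto)
    qed
    then have "f holomorphic_on B"
      using oB by (intro derivative_is_holomorphic[of B F f]) auto
    then show ?thesis
      using oB z0B holomorphic_on_imp_differentiable_at by blast
  qed
  then show ?thesis
    using U by (simp add: holomorphic_on_open field_differentiable_def)
qed

lemma rect_integral_split_h:
  assumes f: "continuous_on (cbox (Complex a p) (Complex c q)) f" and "a \<le> b" "b \<le> c" "p \<le> q"
  shows "rect_integral f a c p q = rect_integral f a b p q + rect_integral f b c p q"
proof -
  have "hor_integral f y a c = hor_integral f y a b + hor_integral f y b c" if "y \<in> {p, q}" for y
    by (rule hor_integral_concat[OF f convex_box(1)]) (use assms that in \<open>auto simp: in_cbox_complex_iff\<close>)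
  then show ?thesis by (simp add: rect_integral_def)
qed

lemma rect_integral_split_v:
  assumes f: "continuous_on (cbox (Complex p a) (Complex q c)) f" and "a \<le> b" "b \<le> c" "p \<le> q"
  shows "rect_integral f p q a c = rect_integral f p q a b + rect_integral f p q b c"
proof -
  have "ver_integral f x a c = ver_integral f x a b + ver_integral f x b c" if "x \<in> {p, q}" for x
    by (rule ver_integral_concat[OF f convex_box(1)]) (use assms that in \<open>auto simp: in_cbox_complex_iff\<close>)
  then show ?thesis by (simp add: rect_integral_def)
qed

lemma rect_integral_grid:
  assumes X: "mono X" and Y: "mono Y"
    and f: "continuous_on (cbox (Complex (X 0) (Y 0)) (Complex (X M) (Y N))) f"
  shows "rect_integral f (X 0) (X M) (Y 0) (Y N) =
    (\<Sum>k<M. \<Sum>l<N. rect_integral f (X k) (X (Suc k)) (Y l) (Y (Suc l)))"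
proof -
  have le: "X i \<le> X j" "Y i \<le> Y j" if "i \<le> j" for i j using X Y that by (auto dest: monoD)
  have sub: "continuous_on (cbox (Complex (X i) (Y j)) (Complex (X k) (Y l))) f"
    if "k \<le> M" "l \<le> N" for i j k l
  proof (rule continuous_on_subset[OF f])
    show "cbox (Complex (X i) (Y j)) (Complex (X k) (Y l)) \<subseteq> cbox (Complex (X 0) (Y 0)) (Complex (X M) (Y N))"
      using le(1)[of 0 i] le(2)[of 0 j] le(1)[of k M] le(2)[of l N] that
      by (auto simp: in_cbox_complex_iff)
  qed
  have col: "rect_integral f (X k) (X (Suc k)) (Y 0) (Y n) = (\<Sum>l<n. rect_integral f (X k) (X (Suc k)) (Y l) (Y (Suc l)))"
    if "k < M" "n \<le> N" for k n
    using that(2)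
  proof (induction n)
    case (Suc n)
    have "rect_integral f (X k) (X (Suc k)) (Y 0) (Y (Suc n)) =
      rect_integral f (X k) (X (Suc k)) (Y 0) (Y n) + rect_integral f (X k) (X (Suc k)) (Y n) (Y (Suc n))"
      by (rule rect_integral_split_v[OF sub]) (use that Suc le in auto)
    with Suc show ?case by simp
  qed simp
  have "rect_integral f (X 0) (X m) (Y 0) (Y N) = (\<Sum>k<m. rect_integral f (X k) (X (Suc k)) (Y 0) (Y N))" if "m \<le> M" for m
    using that
  proof (induction m)
    case (Suc m)
    have "rect_integral f (X 0) (X (Suc m)) (Y 0) (Y N) =
      rect_integral f (X 0) (X m) (Y 0) (Y N) + rect_integral f (X m) (X (Suc m)) (Y 0) (Y N)"
      by (rule rect_integral_split_h[OF sub]) (use Suc le in auto)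
    with Suc show ?case by simp
  qed simp
  then show ?thesis using col by simp
qed

text \<open>Subtracting the constant \<open>c\<close> does not change the integral around the
  rectangle.\<close>

lemma rect_integral_oscillation:
  assumes f: "continuous_on (cbox (Complex x1 y1) (Complex x2 y2)) f" and le: "x1 \<le> x2" "y1 \<le> y2"
    and B: "0 \<le> B"
    and bd: "\<And>z. z \<in> cbox (Complex x1 y1) (Complex x2 y2) \<Longrightarrow> Re z \<in> {x1, x2} \<or> Im z \<in> {y1, y2} \<Longrightarrow>
      cmod (f z - c) \<le> B"
  shows "cmod (rect_integral f x1 x2 y1 y2) \<le> 2 * B * ((x2 - x1) + (y2 - y1))"
proof -
  have h: "cmod (hor_integral f y x1 x2 - c * (x2 - x1)) \<le> B * (x2 - x1)" if "y \<in> {y1, y2}" for y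
  proof -
    have "closed_segment (Complex x1 y) (Complex x2 y) \<subseteq> cbox (Complex x1 y1) (Complex x2 y2)"
      using le that by (auto simp: closed_segment_horizontal in_cbox_complex_iff closed_segment_eq_real_ivl)
    then have "cmod (hor_integral f y x1 x2 - c * (Complex x2 y - Complex x1 y)) \<le> B * cmod (Complex x2 y - Complex x1 y)"
      unfolding hor_integral_def using le that B
      by (intro linepath_integral_approx continuous_on_subset[OF f] bd)
         (auto simp: closed_segment_horizontal)
    moreover have "Complex x2 y - Complex x1 y = of_real (x2 - x1)" by (simp add: complex_eq_iff)
    ultimately show ?thesis using le by (simp add: norm_of_real del: of_real_diff) 
  qed
  have v: "cmod (ver_integral f x y1 y2 - c * (\<i> * (y2 - y1))) \<le> B * (y2 - y1)" if "x \<in> {x1, x2}" for x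
  proof -
    have "closed_segment (Complex x y1) (Complex x y2) \<subseteq> cbox (Complex x1 y1) (Complex x2 y2)"
      using le that by (auto simp: closed_segment_vertical in_cbox_complex_iff closed_segment_eq_real_ivl)
    then have "cmod (ver_integral f x y1 y2 - c * (Complex x y2 - Complex x y1)) \<le> B * cmod (Complex x y2 - Complex x y1)"
      unfolding ver_integral_def using le that B
      by (intro linepath_integral_approx continuous_on_subset[OF f] bd)
         (auto simp: closed_segment_vertical)
    moreover have "Complex x y2 - Complex x y1 = \<i> * of_real (y2 - y1)" by (simp add: complex_eq_iff)
    ultimately show ?thesis using le by (simp add: norm_mult norm_of_real del: of_real_diff)
  qed
  have "rect_integral f x1 x2 y1 y2 =
      ((hor_integral f y1 x1 x2 - c * (x2 - x1)) + (ver_integral f x2 y1 y2 - c * (\<i> * (y2 - y1))))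
    - ((hor_integral f y2 x1 x2 - c * (x2 - x1)) + (ver_integral f x1 y1 y2 - c * (\<i> * (y2 - y1))))"
    by (simp add: rect_integral_def)
  also have "cmod \<dots> \<le> (B * (x2 - x1) + B * (y2 - y1)) + (B * (x2 - x1) + B * (y2 - y1))"
    by (intro order_trans[OF norm_triangle_ineq4] order_trans[OF norm_triangle_ineq] add_mono h v) auto
  finally show ?thesis by (simp add: algebra_simps)
qed

lemma rect_integral_holomorphic:
  assumes f: "f holomorphic_on cbox (Complex x1 y1) (Complex x2 y2)" and le: "x1 \<le> x2" "y1 \<le> y2"
  shows "rect_integral f x1 x2 y1 y2 = 0"
proof -
  define Q where "Q = cbox (Complex x1 y1) (Complex x2 y2)"
  have "continuous_on Q f" using f holomorphic_on_imp_continuous_on by (auto simp: Q_def)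
  moreover have "\<And>x. x \<in> interior Q - {} \<Longrightarrow> f field_differentiable at x"
    using f unfolding Q_def
    by (metis Diff_empty holomorphic_on_imp_differentiable_at holomorphic_on_subset interior_subset open_interior)
  ultimately obtain g where g: "\<And>x. x \<in> Q \<Longrightarrow> (g has_field_derivative f x) (at x within Q)"
    using holomorphic_convex_primitive[of Q "{}" f] by (auto simp: Q_def)
  have p: "contour_integral (linepath a b) f = g b - g a" if "closed_segment a b \<subseteq> Q" for a b
    using contour_integral_primitive[of Q g f "linepath a b"] g that contour_integral_unique by auto
  have h: "hor_integral f y x1 x2 = g (Complex x2 y) - g (Complex x1 y)" if "y \<in> {y1,y2}" for y
    unfolding hor_integral_def using le that
    by (intro p) (auto simp: Q_def closed_segment_horizontal in_cbox_complex_iff closed_segment_eq_real_ivl)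
  have v: "ver_integral f x y1 y2 = g (Complex x y2) - g (Complex x y1)" if "x \<in> {x1,x2}" for x
    unfolding ver_integral_def using le that
    by (intro p) (auto simp: Q_def closed_segment_vertical in_cbox_complex_iff closed_segment_eq_real_ivl)
  show ?thesis by (simp add: rect_integral_def h v)
qed

text \<open>Along the boundary of a square of side \<open>L\<close> each point is joined to the
  corner \<open>(x, y)\<close> by at most two sides, so \<open>f\<close> varies there by at most
  \<open>2 * L * M\<close>. Only derivatives on the boundary enter, because singularities may be
  inside.\<close>

lemma rect_integral_derivative_bound:
  assumes V: "open V" "f holomorphic_on V" and L: "0 < L"
    and f: "continuous_on (cbox (Complex x y) (Complex (x + L) (y + L))) f"
    and bdV: "\<And>z. z \<in> cbox (Complex x y) (Complex (x + L) (y + L)) \<Longrightarrow>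
      Re z \<in> {x, x + L} \<or> Im z \<in> {y, y + L} \<Longrightarrow> z \<in> V \<and> cmod (deriv f z) \<le> M"
  shows "cmod (rect_integral f x (x + L) y (y + L)) \<le> 8 * L\<^sup>2 * M"
proof -
  have M: "M \<ge> 0"
    using bdV[of "Complex x y"] L norm_ge_zero[of "deriv f (Complex x y)"]
    by (auto simp: in_cbox_complex_iff simp del: norm_ge_zero)
  define E where "E = {z \<in> cbox (Complex x y) (Complex (x + L) (y + L)). Re z \<in> {x, x + L} \<or> Im z \<in> {y, y + L}}"
  have lip: "cmod (f b - f a) \<le> M * cmod (b - a)" if "closed_segment a b \<subseteq> E" for a b
  proof (rule field_differentiable_bound[of "closed_segment a b" f "deriv f"])
    fix z assume "z \<in> closed_segment a b"
    then have z: "z \<in> V" "cmod (deriv f z) \<le> M" using that bdV by (auto simp: E_def)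
    show "(f has_field_derivative deriv f z) (at z within closed_segment a b)"
      using V z by (meson has_field_derivative_at_within holomorphic_derivI)
    show "cmod (deriv f z) \<le> M" by (fact z(2))
  qed auto
  have lh: "cmod (f (Complex b t) - f (Complex a t)) \<le> M * L"
    if "a \<in> {x..x+L}" "b \<in> {x..x+L}" "t \<in> {y, y+L}" for a b t
  proof -
    have "cmod (Complex b t - Complex a t) \<le> L" using that by (auto simp: cmod_def abs_le_iff)
    moreover have "cmod (f (Complex b t) - f (Complex a t)) \<le> M * cmod (Complex b t - Complex a t)"
      using that L
      by (intro lip) (auto simp: E_def closed_segment_horizontal closed_segment_eq_real_ivl in_cbox_complex_iff split: if_splits)
    ultimately show ?thesis using M by (meson mult_left_mono order_trans)
  qed
  have lv: "cmod (f (Complex t b) - f (Complex t a)) \<le> M * L"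
    if "a \<in> {y..y+L}" "b \<in> {y..y+L}" "t \<in> {x, x+L}" for a b t
  proof -
    have "cmod (Complex t b - Complex t a) \<le> L" using that by (auto simp: cmod_def abs_le_iff)
    moreover have "cmod (f (Complex t b) - f (Complex t a)) \<le> M * cmod (Complex t b - Complex t a)"
      using that L
      by (intro lip) (auto simp: E_def closed_segment_vertical closed_segment_eq_real_ivl in_cbox_complex_iff split: if_splits)
    ultimately show ?thesis using M by (meson mult_left_mono order_trans)
  qed
  have "cmod (rect_integral f x (x + L) y (y + L)) \<le> 2 * (2 * (M * L)) * ((x + L - x) + (y + L - y))"
  proof (rule rect_integral_oscillation[OF f])
    fix z assume z: "z \<in> cbox (Complex x y) (Complex (x + L) (y + L))"
      "Re z \<in> {x, x + L} \<or> Im z \<in> {y, y + L}"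
    have r: "Re z \<in> {x..x+L}" "Im z \<in> {y..y+L}" using z by (auto simp: in_cbox_complex_iff)
    from z(2) have "cmod (f (Complex (Re z) (Im z)) - f (Complex x y)) \<le> M * L + M * L"
    proof
      assume "Re z \<in> {x, x + L}"
      then have "cmod (f (Complex (Re z) (Im z)) - f (Complex (Re z) y)) \<le> M * L"
         "cmod (f (Complex (Re z) y) - f (Complex x y)) \<le> M * L"
        using r L lv[of y "Im z" "Re z"] lh[of x "Re z" y] by auto
      then show ?thesis using norm_triangle_mono by fastforce
    next
      assume "Im z \<in> {y, y + L}"
      then have "cmod (f (Complex (Re z) (Im z)) - f (Complex x (Im z))) \<le> M * L"
         "cmod (f (Complex x (Im z)) - f (Complex x y)) \<le> M * L"
        using r L lh[of x "Re z" "Im z"] lv[of y "Im z" x] by auto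
      then show ?thesis using norm_triangle_mono by fastforce
    qed
    then show "cmod (f z - f (Complex x y)) \<le> 2 * (M * L)" by (simp add: mult.commute)
  qed (use L M in auto)
  then show ?thesis by (simp add: power2_eq_square algebra_simps)
qed

section \<open>Injective holomorphic functions on the cells of a grid\<close>

lemma emeasure_sum_bounded_overlap:
  fixes B :: "'i \<Rightarrow> 'a set"
  assumes J: "finite J" and B: "\<And>q. q \<in> J \<Longrightarrow> B q \<in> sets M" "\<And>q. q \<in> J \<Longrightarrow> B q \<subseteq> A"
    and A: "A \<in> sets M" and ov: "\<And>w. w \<in> A \<Longrightarrow> card {q \<in> J. w \<in> B q} \<le> n"
  shows "(\<Sum>q\<in>J. emeasure M (B q)) \<le> of_nat n * emeasure M A"
proof -
  have "(\<Sum>q\<in>J. emeasure M (B q)) = (\<Sum>q\<in>J. \<integral>\<^sup>+w. indicator (B q) w \<partial>M)"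
    using B by simp
  also have "\<dots> = (\<integral>\<^sup>+w. (\<Sum>q\<in>J. indicator (B q) w) \<partial>M)"
    using B by (intro nn_integral_sum[symmetric]) auto
  also have "\<dots> \<le> (\<integral>\<^sup>+w. of_nat n * indicator A w \<partial>M)"
  proof (rule nn_integral_mono)
    fix w
    have "(\<Sum>q\<in>J. indicator (B q) w :: ennreal) = of_nat (card {q \<in> J. w \<in> B q})"
      using J by (simp add: indicator_def sum.If_cases Int_def conj_commute)
    also have "\<dots> \<le> of_nat n * indicator A w"
    proof (cases "w \<in> A")
      case False
      then have "{q \<in> J. w \<in> B q} = {}" using B by auto
      then show ?thesis by (simp only: card.empty) simp
    qed (use ov in simp)
    finally show "(\<Sum>q\<in>J. indicator (B q) w :: ennreal) \<le> of_nat n * indicator A w" .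
  qed
  also have "\<dots> = of_nat n * emeasure M A" using A by (simp add: nn_integral_cmult_indicator)
  finally show ?thesis .
qed

text \<open>The grid has mesh \<open>L\<close> and passes through the point with both coordinates
  equal to \<open>a\<close>; the cells are closed, so that neighbours share their boundary.\<close>

definition grid_cell :: "real \<Rightarrow> real \<Rightarrow> int \<times> int \<Rightarrow> complex set" where
  "grid_cell a L q = cbox (Complex (a + of_int (fst q) * L) (a + of_int (snd q) * L))
     (Complex (a + of_int (fst q + 1) * L) (a + of_int (snd q + 1) * L))"

lemma grid_cell_iff: "z \<in> grid_cell a L q \<longleftrightarrow>
   a + of_int (fst q) * L \<le> Re z \<and> Re z \<le> a + of_int (fst q + 1) * L \<and>
   a + of_int (snd q) * L \<le> Im z \<and> Im z \<le> a + of_int (snd q + 1) * L"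
  by (auto simp: grid_cell_def in_cbox_complex_iff)

text \<open>A point at distance less than \<open>L / 2\<close> from a cell lies in this cell or in
  one of its eight neighbours.\<close>

lemma card_grid_cell_near:
  assumes L: "0 < L" and c: "\<And>q. q \<in> J \<Longrightarrow> c q \<in> grid_cell a L q" and e: "e \<le> L / 2"
  shows "card {q \<in> J. dist z (c q) < e} \<le> 9"
proof -
  define i where "i = \<lfloor>(Re z - a) / L\<rfloor>"
  define j where "j = \<lfloor>(Im z - a) / L\<rfloor>"
  have near: "k \<in> {\<lfloor>(x - a) / L\<rfloor> - 1..\<lfloor>(x - a) / L\<rfloor> + 1}"
    if "a + of_int k * L - L / 2 < x" "x < a + of_int (k + 1) * L + L / 2" for k x
  proof -
    have "of_int k < (x - a) / L + 1 / 2" "(x - a) / L < of_int k + 3 / 2"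
      using that L by (simp_all add: field_simps)
    then show ?thesis by (simp, linarith)
  qed
  have "{q \<in> J. dist z (c q) < e} \<subseteq> {i - 1..i + 1} \<times> {j - 1..j + 1}"
  proof
    fix q assume q: "q \<in> {q \<in> J. dist z (c q) < e}"
    then have "cmod (z - c q) < L / 2" using e by (simp add: dist_norm)
    then have "\<bar>Re z - Re (c q)\<bar> < L / 2" "\<bar>Im z - Im (c q)\<bar> < L / 2"
      using abs_Re_le_cmod[of "z - c q"] abs_Im_le_cmod[of "z - c q"] by auto
    moreover have "c q \<in> grid_cell a L q" using q c by auto
    ultimately have "a + of_int (fst q) * L - L / 2 < Re z" "Re z < a + of_int (fst q + 1) * L + L / 2"
      "a + of_int (snd q) * L - L / 2 < Im z" "Im z < a + of_int (snd q + 1) * L + L / 2"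
      unfolding grid_cell_iff by linarith+
    then show "q \<in> {i - 1..i + 1} \<times> {j - 1..j + 1}"
      using near[of "fst q" "Re z"] near[of "snd q" "Im z"]
      unfolding i_def j_def mem_Times_iff by blast
  qed
  then have "card {q \<in> J. dist z (c q) < e} \<le> card ({i - 1..i + 1} \<times> {j - 1..j + 1})"
    by (rule card_mono[rotated]) simp
  then show ?thesis by (simp add: card_cartesian_product)
qed

text \<open>By Bloch's theorem the image of \<open>ball (c q) e\<close> contains a disc of radius
  \<open>e * \<bar>f' (c q)\<bar> / 12\<close>. Since \<open>f\<close> is injective, these discs
  overlap at most nine times, and they lie in the disc of radius \<open>\<rho>\<close>. Comparing
  areas bounds the sum of the squares of the derivatives, and the Cauchy--Schwarz inequality turns
  this into a bound of their sum; the factor is \<open>36 = 12 * sqrt 9\<close>.\<close>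

lemma sum_derivatives_at_cells:
  assumes L: "0 < L" and e: "0 < e" "e \<le> L / 2" and J: "finite J"
    and c: "\<And>q. q \<in> J \<Longrightarrow> c q \<in> grid_cell a L q"
    and f: "\<And>q. q \<in> J \<Longrightarrow> f holomorphic_on ball (c q) e"
    and inj: "inj_on f (\<Union>q\<in>J. ball (c q) e)"
    and bd: "f ` (\<Union>q\<in>J. ball (c q) e) \<subseteq> ball 0 \<rho>"
  shows "(\<Sum>q\<in>J. cmod (deriv f (c q))) \<le> 36 * \<bar>\<rho>\<bar> * sqrt (real (card J)) / e"
proof -
  define r where "r q = e * cmod (deriv f (c q)) / 12" for q
  have "\<exists>b. ball b (r q) \<subseteq> f ` ball (c q) e" if "q \<in> J" for q
    using Bloch[OF f[OF that] e(1) order_refl] unfolding r_def by metis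
  then obtain b where b: "\<And>q. q \<in> J \<Longrightarrow> ball (b q) (r q) \<subseteq> f ` ball (c q) e" by metis
  define v where "v = unit_ball_vol 2"
  have v: "v > 0" unfolding v_def by (rule unit_ball_vol_pos) simp
  have "(\<Sum>q\<in>J. emeasure lborel (ball (b q) (r q))) \<le> of_nat 9 * emeasure lborel (ball (0::complex) \<bar>\<rho>\<bar>)"
  proof (rule emeasure_sum_bounded_overlap[OF J])
    fix q assume q: "q \<in> J"
    show "ball (b q) (r q) \<subseteq> ball 0 \<bar>\<rho>\<bar>"
      using b[OF q] bd q by (fastforce simp: subset_iff)
  next
    fix w :: complex
    show "card {q \<in> J. w \<in> ball (b q) (r q)} \<le> 9"
    proof (cases "w \<in> f ` (\<Union>q\<in>J. ball (c q) e)")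
      case True
      then obtain z where z: "z \<in> (\<Union>q\<in>J. ball (c q) e)" "w = f z" by blast
      have "{q \<in> J. w \<in> ball (b q) (r q)} \<subseteq> {q \<in> J. dist z (c q) < e}"
      proof
        fix q assume q: "q \<in> {q \<in> J. w \<in> ball (b q) (r q)}"
        then obtain z' where z': "z' \<in> ball (c q) e" "f z' = w" using b by blast
        then have "z' = z" using inj z q by (auto dest!: inj_onD)
        then show "q \<in> {q \<in> J. dist z (c q) < e}" using q z' by (simp add: dist_commute)
      qed
      then have "card {q \<in> J. w \<in> ball (b q) (r q)} \<le> card {q \<in> J. dist z (c q) < e}"
        using J by (intro card_mono) auto
      then show ?thesis using card_grid_cell_near[OF L c e(2), of J z] by simp
    next
      case False
      then have "{q \<in> J. w \<in> ball (b q) (r q)} = {}" using b by blast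
      then show ?thesis by (metis card.empty zero_le)
    qed
  qed auto
  moreover have "emeasure lborel (ball x s) = ennreal (v * s\<^sup>2)" if "s \<ge> 0" for s and x :: complex
    using that by (simp add: emeasure_ball v_def)
  moreover have "r q \<ge> 0" for q using e by (simp add: r_def)
  ultimately have "(\<Sum>q\<in>J. ennreal (v * (r q)\<^sup>2)) \<le> of_nat 9 * ennreal (v * \<bar>\<rho>\<bar>\<^sup>2)" by simp
  also have "of_nat 9 * ennreal (v * \<bar>\<rho>\<bar>\<^sup>2) = ennreal (9 * (v * \<rho>\<^sup>2))"
    using v by (simp add: ennreal_mult')
  also have "(\<Sum>q\<in>J. ennreal (v * (r q)\<^sup>2)) = ennreal (\<Sum>q\<in>J. v * (r q)\<^sup>2)"
    using v by (intro sum_ennreal) auto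
  finally have "(\<Sum>q\<in>J. v * (r q)\<^sup>2) \<le> 9 * (v * \<rho>\<^sup>2)"
    using v by (subst (asm) ennreal_le_iff) auto
  then have "v * (\<Sum>q\<in>J. (r q)\<^sup>2) \<le> v * (9 * \<rho>\<^sup>2)"
    by (simp add: sum_distrib_left algebra_simps)
  then have "(\<Sum>q\<in>J. (r q)\<^sup>2) \<le> 9 * \<rho>\<^sup>2" using v by simp
  then have sq: "(\<Sum>q\<in>J. (cmod (deriv f (c q)))\<^sup>2) \<le> (36 * \<bar>\<rho>\<bar> / e)\<^sup>2"
    using e by (simp add: r_def power_mult_distrib power_divide sum_divide_distrib[symmetric] sum_distrib_left[symmetric] field_simps)
  have "(\<Sum>q\<in>J. 1 * cmod (deriv f (c q)))\<^sup>2 \<le> (\<Sum>q\<in>J. 1\<^sup>2) * (\<Sum>q\<in>J. (cmod (deriv f (c q)))\<^sup>2)"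
    by (rule Cauchy_Schwarz_ineq_sum)
  also have "\<dots> \<le> real (card J) * (36 * \<bar>\<rho>\<bar> / e)\<^sup>2"
    using sq by (simp add: mult_left_mono)
  also have "\<dots> = (36 * \<bar>\<rho>\<bar> * sqrt (real (card J)) / e)\<^sup>2"
    by (simp add: power_mult_distrib power_divide)
  finally have "(\<Sum>q\<in>J. cmod (deriv f (c q)))\<^sup>2 \<le> (36 * \<bar>\<rho>\<bar> * sqrt (real (card J)) / e)\<^sup>2" by simp
  then show ?thesis by (rule power2_le_imp_le) (use e in auto)
qed

text \<open>The domain \<open>U\<close> is arbitrary, not the whole plane or a neighbourhood of
  \<open>K\<close>. In this local form removability passes to locally finite unions and to the
  coordinate expressions of a map of the sphere, which are defined only where the map avoids the
  pole of the target chart.\<close>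

definition loc_removable :: "complex set \<Rightarrow> bool" where
  "loc_removable K \<longleftrightarrow> (\<forall>U f. open U \<longrightarrow> continuous_on U f \<longrightarrow> inj_on f U \<longrightarrow>
     f holomorphic_on (U - K) \<longrightarrow> f holomorphic_on U)"

definition avoids_grid :: "complex set \<Rightarrow> real \<Rightarrow> real \<Rightarrow> real \<Rightarrow> bool" where
  "avoids_grid K a L e \<longleftrightarrow> (\<forall>z\<in>K. \<forall>i::int. e \<le> \<bar>Re z - (a + of_int i * L)\<bar> \<and> e \<le> \<bar>Im z - (a + of_int i * L)\<bar>)"

text \<open>The boundary of a cell has distance at least \<open>e\<close> from \<open>K\<close>, so
  \<open>f\<close> is holomorphic near it even if the cell meets \<open>K\<close>. The point
  \<open>c\<close> is where \<open>\<bar>f'\<bar>\<close> is largest on the boundary.\<close>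

lemma grid_cell_integral_bound:
  assumes U: "open U" and K: "closed K" and f: "continuous_on U f" "f holomorphic_on (U - K)"
    and L: "0 < L" and e: "0 < e" and av: "avoids_grid K a L e"
    and q: "grid_cell a L q \<subseteq> U" "\<And>z. z \<in> grid_cell a L q \<Longrightarrow> ball z e \<subseteq> U"
  shows "\<exists>c\<in>grid_cell a L q. ball c e \<subseteq> U - K \<and>
    cmod (rect_integral f (a + of_int (fst q) * L) (a + of_int (fst q + 1) * L)
                 (a + of_int (snd q) * L) (a + of_int (snd q + 1) * L)) \<le> 8 * L\<^sup>2 * cmod (deriv f c)"
proof -
  define x y where "x = a + of_int (fst q) * L" and "y = a + of_int (snd q) * L"
  have xy: "a + of_int (fst q + 1) * L = x + L" "a + of_int (snd q + 1) * L = y + L"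
    by (simp_all add: x_def y_def algebra_simps)
  have cell: "grid_cell a L q = cbox (Complex x y) (Complex (x + L) (y + L))"
    unfolding grid_cell_def xy by (simp add: x_def y_def)
  define E where "E = grid_cell a L q \<inter> ({z. Re z = x} \<union> {z. Re z = x + L} \<union> {z. Im z = y} \<union> {z. Im z = y + L})"
  have "compact E"
    unfolding E_def cell
    by (intro compact_Int_closed compact_cbox closed_Un closed_halfspace_Re_eq closed_halfspace_Im_eq)
  have far: "ball z e \<subseteq> U - K" if z: "z \<in> E" for z
  proof -
    have "w \<notin> K" if w: "w \<in> ball z e" for w
    proof
      assume wK: "w \<in> K"
      have "cmod (w - z) < e" using w by (simp add: dist_norm norm_minus_commute)
      then have lt: "\<bar>Re w - Re z\<bar> < e" "\<bar>Im w - Im z\<bar> < e"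
        using abs_Re_le_cmod[of "w - z"] abs_Im_le_cmod[of "w - z"] by auto
      have "e \<le> \<bar>Re w - x\<bar> \<and> e \<le> \<bar>Re w - (x + L)\<bar> \<and> e \<le> \<bar>Im w - y\<bar> \<and> e \<le> \<bar>Im w - (y + L)\<bar>"
        using av wK unfolding avoids_grid_def xy[symmetric] unfolding x_def y_def by blast
      then show False using z lt by (auto simp: E_def)
    qed
    moreover have "ball z e \<subseteq> U" using q z by (auto simp: E_def)
    ultimately show ?thesis by blast
  qed
  have EV: "E \<subseteq> U - K" using far e by (force simp: subset_iff)
  have oV: "open (U - K)" using U K by (simp add: open_Diff)
  have "continuous_on E (\<lambda>z. cmod (deriv f z))"
    using holomorphic_on_imp_continuous_on[OF holomorphic_deriv[OF f(2) oV]] EV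
    by (intro continuous_on_norm) (rule continuous_on_subset)
  moreover have "Complex x y \<in> E" using L by (auto simp: E_def cell in_cbox_complex_iff)
  ultimately obtain c where c: "c \<in> E" "\<And>z. z \<in> E \<Longrightarrow> cmod (deriv f z) \<le> cmod (deriv f c)"
    using continuous_attains_sup[OF \<open>compact E\<close>] by blast
  have "cmod (rect_integral f x (x + L) y (y + L)) \<le> 8 * L\<^sup>2 * cmod (deriv f c)"
  proof (rule rect_integral_derivative_bound[OF oV f(2) L])
    show "continuous_on (cbox (Complex x y) (Complex (x + L) (y + L))) f"
      using f(1) q(1) continuous_on_subset unfolding cell by blast
    show "z \<in> U - K \<and> cmod (deriv f z) \<le> cmod (deriv f c)"
      if "z \<in> cbox (Complex x y) (Complex (x + L) (y + L))" "Re z \<in> {x, x + L} \<or> Im z \<in> {y, y + L}" for z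
    proof -
      have "z \<in> E" using that unfolding E_def cell by blast
      then show ?thesis using EV c by blast
    qed
  qed
  then show ?thesis
    using c(1) far unfolding xy unfolding x_def[symmetric] y_def[symmetric] by (auto simp: E_def)
qed

text \<open>Clamping the points of a grid to \<open>[x1, x2]\<close> turns it into a subdivision of
  this interval in which all but at most two of the nondegenerate intervals are full intervals of
  the grid: only those that contain an endpoint in their interior are shortened.\<close>

lemma clamped_grid:
  fixes x1 x2 a L :: real
  assumes L: "0 < L" and x: "x1 \<le> x2" and M: "x2 - x1 + L \<le> real M * L"
  defines "i0 \<equiv> \<lfloor>(x1 - a) / L\<rfloor>"
  defines "g \<equiv> \<lambda>k::nat. a + of_int (i0 + int k) * L"
  defines "X \<equiv> \<lambda>k. max x1 (min x2 (g k))"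
  shows "mono X" "X 0 = x1" "X M = x2" "\<And>k. x1 \<le> X k \<and> X k \<le> x2" "\<And>k. X (Suc k) - X k \<le> L"
    "card {k. X k < X (Suc k) \<and> \<not> (X k = g k \<and> X (Suc k) = g (Suc k))} \<le> 2"
    "finite {k. X k < X (Suc k) \<and> \<not> (X k = g k \<and> X (Suc k) = g (Suc k))}"
proof -
  have gS: "g (Suc k) = g k + L" for k by (simp add: g_def algebra_simps)
  have i0: "of_int i0 \<le> (x1 - a) / L" "(x1 - a) / L < of_int i0 + 1"
    unfolding i0_def by linarith+
  have g0: "g 0 \<le> x1" "x1 < g 0 + L"
    using i0 L by (simp_all add: g_def field_simps)
  have g_eq: "g k = g 0 + real k * L" for k by (simp add: g_def algebra_simps)
  have gmono: "g k \<le> g l" if "k \<le> l" for k l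
    using that L by (simp add: g_eq[of k] g_eq[of l])
  show "mono X" by (auto intro!: monoI max.mono min.mono gmono simp: X_def)
  show "X 0 = x1" using g0 x by (simp add: X_def)
  show "X M = x2" using g0 x M by (simp add: X_def g_eq[of M])
  show "x1 \<le> X k \<and> X k \<le> x2" for k using x by (auto simp: X_def)
  show "X (Suc k) - X k \<le> L" for k using L by (auto simp: X_def gS max_def min_def)
  define B where "B = {k. X k < X (Suc k) \<and> \<not> (X k = g k \<and> X (Suc k) = g (Suc k))}"
  have sub: "B \<subseteq> {0, nat (\<lfloor>(x2 - a) / L\<rfloor> - i0)}"
  proof
    fix k assume "k \<in> B"
    then have k: "g k < x2" "x1 < g (Suc k)" "g k < x1 \<or> x2 < g (Suc k)"
      using x L by (auto simp: B_def X_def gS max_def min_def split: if_splits)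
    show "k \<in> {0, nat (\<lfloor>(x2 - a) / L\<rfloor> - i0)}"
    proof (cases "k = 0")
      case False
      then have "g 1 \<le> g k" by (intro gmono) simp
      then have "x1 < g k" using g0 gS[of 0] by simp
      with k have "g k < x2" "x2 < g k + L" by (auto simp: gS)
      then have "of_int (i0 + int k) \<le> (x2 - a) / L" "(x2 - a) / L < of_int (i0 + int k) + 1"
        using L by (simp_all add: g_def field_simps)
      then have "\<lfloor>(x2 - a) / L\<rfloor> = i0 + int k" by linarith
      then show ?thesis by simp
    qed simp
  qed
  show "finite B" using sub finite_subset by blast
  have "card B \<le> card {0, nat (\<lfloor>(x2 - a) / L\<rfloor> - i0)}" by (rule card_mono[OF _ sub]) simp
  also have "\<dots> \<le> 2" by (simp add: card_insert_if)
  finally show "card B \<le> 2" .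
qed

text \<open>The first summand comes from the full cells that meet \<open>K\<close>, the second from
  the cells that are cut by the boundary of the rectangle; all other cells contribute nothing.\<close>

lemma rect_integral_grid_bound:
  assumes U: "open U" and K: "closed K" and f: "continuous_on U f" "inj_on f U" "f holomorphic_on (U - K)"
    and x: "x1 \<le> x2" "x2 - x1 \<le> D" and y: "y1 \<le> y2" "y2 - y1 \<le> D"
    and R: "R = cbox (Complex x1 y1) (Complex x2 y2)"
    and L: "0 < L" and e: "0 < e" "e \<le> L / 2" and av: "avoids_grid K a L e"
    and fin: "finite {q. grid_cell a L q \<inter> K \<noteq> {}}"
    and nbd: "\<And>z. z \<in> R \<Longrightarrow> ball z e \<subseteq> U \<and> f ` ball z e \<subseteq> ball 0 \<rho>"
    and osc: "\<And>z w. z \<in> R \<Longrightarrow> w \<in> R \<Longrightarrow> dist z w \<le> 2 * L \<Longrightarrow> dist (f z) (f w) \<le> \<omega>"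
  shows "cmod (rect_integral f x1 x2 y1 y2) \<le>
    288 * \<bar>\<rho>\<bar> * sqrt (real (card {q. grid_cell a L q \<inter> K \<noteq> {}})) * L\<^sup>2 / e + 16 * (D + 2 * L) * \<omega>"
proof -
  \<comment> \<open>Enough grid intervals to cover the sides even if the first one starts up to \<open>L\<close> too early.\<close>
  define M where "M = Suc (nat \<lceil>D / L\<rceil>)"
  have D: "D \<ge> 0" using x by linarith
  have M: "D + L \<le> real M * L" "real M * L \<le> D + 2 * L"
  proof -
    have "D / L \<ge> 0" using D L by simp
    then have "D / L + 1 \<le> real M" "real M \<le> D / L + 2" unfolding M_def by linarith+
    then have "(D / L + 1) * L \<le> real M * L" "real M * L \<le> (D / L + 2) * L"
      using L by (auto intro: mult_right_mono)
    then show "D + L \<le> real M * L" "real M * L \<le> D + 2 * L"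
      using L by (simp_all add: distrib_right)
  qed
  define i0 where "i0 = \<lfloor>(x1 - a) / L\<rfloor>"
  define j0 where "j0 = \<lfloor>(y1 - a) / L\<rfloor>"
  define g where "g k = a + of_int (i0 + int k) * L" for k
  define h where "h k = a + of_int (j0 + int k) * L" for k
  define X where "X k = max x1 (min x2 (g k))" for k
  define Y where "Y k = max y1 (min y2 (h k))" for k
  define BX where "BX = {k. X k < X (Suc k) \<and> \<not> (X k = g k \<and> X (Suc k) = g (Suc k))}"
  define BY where "BY = {k. Y k < Y (Suc k) \<and> \<not> (Y k = h k \<and> Y (Suc k) = h (Suc k))}"
  have Mx: "x2 - x1 + L \<le> real M * L" and My: "y2 - y1 + L \<le> real M * L"
    using M x y by linarith+
  note cx = clamped_grid[OF L x(1) Mx, of a, folded i0_def, folded g_def, folded X_def, folded BX_def]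
  note cy = clamped_grid[OF L y(1) My, of a, folded j0_def, folded h_def, folded Y_def, folded BY_def]
  define T where "T = {..<M} \<times> {..<M}"
  define c where "c = (\<lambda>(k,l). rect_integral f (X k) (X (Suc k)) (Y l) (Y (Suc l)))"
  define q where "q = (\<lambda>(k,l). (i0 + int k, j0 + int l))"
  have RU: "R \<subseteq> U" using nbd e by (force simp: subset_iff)
  have sub: "cbox (Complex (X k) (Y l)) (Complex (X k') (Y l')) \<subseteq> R" for k l k' l'
    using cx(4)[of k] cx(4)[of k'] cy(4)[of l] cy(4)[of l'] by (auto simp: R in_cbox_complex_iff)
  have fsub: "continuous_on (cbox (Complex (X k) (Y l)) (Complex (X k') (Y l'))) f" for k l k' l'
    using sub RU f(1) by (meson continuous_on_subset)
  have "rect_integral f x1 x2 y1 y2 = rect_integral f (X 0) (X M) (Y 0) (Y M)" using cx cy by simp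
  also have "\<dots> = (\<Sum>t\<in>T. c t)"
    unfolding T_def c_def by (subst rect_integral_grid[OF cx(1) cy(1) fsub]) (simp add: sum.cartesian_product)
  finally have sum: "cmod (rect_integral f x1 x2 y1 y2) \<le> (\<Sum>t\<in>T. cmod (c t))" by (simp add: norm_sum)
  \<comment> \<open>\<open>BX\<close> and \<open>BY\<close> have at most two elements, so there are at most \<open>4 * M\<close> shortened cells.\<close>
  define Bad where "Bad = {(k,l). (k,l) \<in> T \<and> (k \<in> BX \<or> l \<in> BY)}"
  define Good where "Good = {(k,l). (k,l) \<in> T \<and> X k = g k \<and> X (Suc k) = g (Suc k) \<and> Y l = h l \<and> Y (Suc l) = h (Suc l)
     \<and> grid_cell a L (q (k,l)) \<inter> K \<noteq> {}}"
  have gcellq: "grid_cell a L (q (k,l)) = cbox (Complex (g k) (h l)) (Complex (g (Suc k)) (h (Suc l)))" for k l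
    by (simp add: grid_cell_def q_def g_def h_def algebra_simps)
  have finT: "finite T" by (simp add: T_def)
  have GB: "Good \<subseteq> T" "Bad \<subseteq> T" by (auto simp: Good_def Bad_def)
  have zero: "c t = 0" if tT: "t \<in> T - (Good \<union> Bad)" for t
  proof -
    obtain k l where t: "t = (k,l)" by (cases t)
    have le: "X k \<le> X (Suc k)" "Y l \<le> Y (Suc l)" using incseq_SucD[OF cx(1)] incseq_SucD[OF cy(1)] by auto
    consider "X k = X (Suc k)" | "Y l = Y (Suc l)" |
      "X k = g k" "X (Suc k) = g (Suc k)" "Y l = h l" "Y (Suc l) = h (Suc l)"
      using tT le unfolding t Good_def Bad_def BX_def BY_def by fastforce
    then show ?thesis
    proof cases
      case 3
      then have "grid_cell a L (q (k,l)) \<inter> K = {}" using that unfolding t Good_def by blast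
      then have "cbox (Complex (X k) (Y l)) (Complex (X (Suc k)) (Y (Suc l))) \<subseteq> U - K"
        using sub[of k l "Suc k" "Suc l"] RU unfolding gcellq 3 by blast
      then have "f holomorphic_on cbox (Complex (X k) (Y l)) (Complex (X (Suc k)) (Y (Suc l)))"
        using f(3) holomorphic_on_subset by blast
      then show ?thesis unfolding t c_def using le by (simp add: rect_integral_holomorphic)
    qed (simp_all add: t c_def)
  qed
  have bad: "cmod (c t) \<le> 4 * L * \<omega>" if "t \<in> Bad" for t
  proof -
    obtain k l where t: "t = (k,l)" by (cases t)
    have le: "X k \<le> X (Suc k)" "Y l \<le> Y (Suc l)" using incseq_SucD[OF cx(1)] incseq_SucD[OF cy(1)] by auto
    have len: "X (Suc k) - X k \<le> L" "Y (Suc l) - Y l \<le> L" using cx cy by auto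
    have v: "Complex (X k) (Y l) \<in> R" using sub[of k l k l] by auto
    have om: "\<omega> \<ge> 0" using osc[OF v v] L by simp
    have "cmod (c t) \<le> 2 * \<omega> * ((X (Suc k) - X k) + (Y (Suc l) - Y l))"
      unfolding t c_def prod.case
    proof (rule rect_integral_oscillation[OF fsub le om])
      fix z assume z: "z \<in> cbox (Complex (X k) (Y l)) (Complex (X (Suc k)) (Y (Suc l)))"
      have "cmod (z - Complex (X k) (Y l)) \<le> \<bar>Re (z - Complex (X k) (Y l))\<bar> + \<bar>Im (z - Complex (X k) (Y l))\<bar>"
        by (rule cmod_le)
      also have "\<dots> \<le> 2 * L" using z len by (auto simp: in_cbox_complex_iff)
      finally have "dist z (Complex (X k) (Y l)) \<le> 2 * L" by (simp add: dist_norm)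
      then show "cmod (f z - f (Complex (X k) (Y l))) \<le> \<omega>"
        using osc[of z "Complex (X k) (Y l)"] subsetD[OF sub z] v by (simp add: dist_norm)
    qed
    also have "\<dots> \<le> 2 * \<omega> * (L + L)" using om len by (intro mult_left_mono add_mono) auto
    finally show ?thesis by (simp add: algebra_simps)
  qed
  have cardBad: "card Bad \<le> 4 * M"
  proof -
    have "Bad \<subseteq> BX \<times> {..<M} \<union> {..<M} \<times> BY" by (auto simp: Bad_def T_def)
    then have "card Bad \<le> card (BX \<times> {..<M} \<union> {..<M} \<times> BY)"
      using cx(7) cy(7) by (intro card_mono) auto
    also have "\<dots> \<le> card BX * M + M * card BY"
      by (rule order_trans[OF card_Un_le]) (simp add: card_cartesian_product)
    also have "\<dots> \<le> 2 * M + M * 2"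
      using cx(6) cy(6) by (intro add_mono mult_mono) auto
    finally show ?thesis by simp
  qed
  have om: "\<omega> \<ge> 0"
    using osc[of "Complex x1 y1" "Complex x1 y1"] x y L by (auto simp: R in_cbox_complex_iff)
  have "(\<Sum>t\<in>Bad. cmod (c t)) \<le> real (card Bad) * (4 * L * \<omega>)"
    using sum_bounded_above[of Bad "\<lambda>t. cmod (c t)" "4 * L * \<omega>"] bad by simp
  also have "\<dots> \<le> real (4 * M) * (4 * L * \<omega>)"
    using cardBad L om by (intro mult_right_mono) auto
  also have "\<dots> = 16 * (real M * L) * \<omega>" by simp
  also have "\<dots> \<le> 16 * (D + 2 * L) * \<omega>" using M(2) om by (intro mult_right_mono) auto
  finally have badsum: "(\<Sum>t\<in>Bad. cmod (c t)) \<le> 16 * (D + 2 * L) * \<omega>" .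
  define J where "J = {q. grid_cell a L q \<inter> K \<noteq> {}}"
  have injq: "inj_on q Good" by (auto simp: inj_on_def q_def)
  have qJ: "q ` Good \<subseteq> J" by (auto simp: J_def Good_def)
  have "\<forall>t\<in>Good. \<exists>w\<in>grid_cell a L (q t). ball w e \<subseteq> U - K \<and> cmod (c t) \<le> 8 * L\<^sup>2 * cmod (deriv f w)"
  proof
    fix t assume tG: "t \<in> Good"
    obtain k l where t: "t = (k,l)" by (cases t)
    have XY: "X k = g k" "X (Suc k) = g (Suc k)" "Y l = h l" "Y (Suc l) = h (Suc l)"
      using tG by (auto simp: Good_def t)
    have inR: "grid_cell a L (q t) \<subseteq> R" using sub[of k l "Suc k" "Suc l"] unfolding t gcellq XY .
    have ct: "c t = rect_integral f (a + of_int (fst (q t)) * L) (a + of_int (fst (q t) + 1) * L)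
                 (a + of_int (snd (q t)) * L) (a + of_int (snd (q t) + 1) * L)"
      unfolding t c_def prod.case XY by (simp add: q_def g_def h_def algebra_simps)
    show "\<exists>w\<in>grid_cell a L (q t). ball w e \<subseteq> U - K \<and> cmod (c t) \<le> 8 * L\<^sup>2 * cmod (deriv f w)"
      unfolding ct
      by (rule grid_cell_integral_bound[OF U K f(1,3) L e(1) av]) (use inR RU nbd in blast)+
  qed
  then obtain w where w: "\<And>t. t \<in> Good \<Longrightarrow> w t \<in> grid_cell a L (q t)"
      "\<And>t. t \<in> Good \<Longrightarrow> ball (w t) e \<subseteq> U - K"
      "\<And>t. t \<in> Good \<Longrightarrow> cmod (c t) \<le> 8 * L\<^sup>2 * cmod (deriv f (w t))" by metis
  have wR: "w t \<in> R" if "t \<in> Good" for t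
  proof -
    obtain k l where t: "t = (k,l)" by (cases t)
    have XY: "X k = g k" "X (Suc k) = g (Suc k)" "Y l = h l" "Y (Suc l) = h (Suc l)"
      using that by (auto simp: Good_def t)
    show ?thesis using w(1)[OF that] sub[of k l "Suc k" "Suc l"] unfolding t gcellq XY by blast
  qed
  define p where "p = the_inv_into Good q"
  have p: "p (q t) = t" if "t \<in> Good" for t using injq that by (simp add: p_def the_inv_into_f_f)
  have "(\<Sum>t\<in>Good. cmod (c t)) \<le> (\<Sum>t\<in>Good. 8 * L\<^sup>2 * cmod (deriv f (w t)))"
    by (rule sum_mono) (rule w(3))
  also have "\<dots> = 8 * L\<^sup>2 * (\<Sum>t\<in>Good. cmod (deriv f (w (p (q t)))))"
    by (simp add: sum_distrib_left p)
  also have "(\<Sum>t\<in>Good. cmod (deriv f (w (p (q t))))) = (\<Sum>s\<in>q ` Good. cmod (deriv f (w (p s))))"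
    using injq by (simp add: sum.reindex)
  also have "\<dots> \<le> 36 * \<bar>\<rho>\<bar> * sqrt (real (card (q ` Good))) / e"
  proof (rule sum_derivatives_at_cells[OF L e])
    show "finite (q ` Good)" using qJ fin finite_subset unfolding J_def by blast
    show "w (p s) \<in> grid_cell a L s" if "s \<in> q ` Good" for s using that p w by auto
    show "f holomorphic_on ball (w (p s)) e" if "s \<in> q ` Good" for s
      using that p w(2) f(3) holomorphic_on_subset by fastforce
    show "inj_on f (\<Union>s\<in>q ` Good. ball (w (p s)) e)"
      by (rule inj_on_subset[OF f(2)]) (use p w(2) in fastforce)
    show "f ` (\<Union>s\<in>q ` Good. ball (w (p s)) e) \<subseteq> ball 0 \<rho>"
    proof -
      have "f ` ball (w t) e \<subseteq> ball 0 \<rho>" if "t \<in> Good" for t using nbd[OF wR[OF that]] by blast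
      then show ?thesis using p by (fastforce simp: image_UN)
    qed
  qed
  also have "\<dots> \<le> 36 * \<bar>\<rho>\<bar> * sqrt (real (card J)) / e"
  proof -
    have "card (q ` Good) \<le> card J" using qJ fin by (intro card_mono) (auto simp: J_def)
    then show ?thesis using e by (intro divide_right_mono mult_left_mono) auto
  qed
  finally have goodsum: "(\<Sum>t\<in>Good. cmod (c t)) \<le> 288 * \<bar>\<rho>\<bar> * sqrt (real (card J)) * L\<^sup>2 / e"
    using L by (simp add: mult_left_mono field_simps)
  have "(\<Sum>t\<in>T. cmod (c t)) = (\<Sum>t\<in>Good \<union> Bad. cmod (c t))"
    using zero GB finT by (intro sum.mono_neutral_right) auto
  also have "\<dots> \<le> (\<Sum>t\<in>Good. cmod (c t)) + (\<Sum>t\<in>Bad. cmod (c t))"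
  proof -
    have "finite Good" "finite Bad" using GB finT finite_subset by blast+
    then have "(\<Sum>t\<in>Good. cmod (c t)) + (\<Sum>t\<in>Bad. cmod (c t)) =
       (\<Sum>t\<in>Good \<union> Bad. cmod (c t)) + (\<Sum>t\<in>Good \<inter> Bad. cmod (c t))"
      by (simp add: sum.union_inter)
    then show ?thesis by (simp add: sum_nonneg)
  qed
  finally show ?thesis using sum goodsum badsum unfolding J_def by linarith
qed

text \<open>The bound on the number of cells involves \<open>\<epsilon>\<^sup>2\<close> because the
  separating strips have relative width \<open>\<epsilon>\<close>: it says that the cells that meet
  \<open>K\<close> have small total area, even compared with \<open>\<epsilon>\<^sup>2\<close>.\<close>

definition grid_thin :: "complex set \<Rightarrow> bool" where
  "grid_thin K \<longleftrightarrow> (\<forall>\<eta>>0. \<forall>\<delta>>0. \<exists>L \<epsilon> a. 0 < L \<and> L < \<delta> \<and> 0 < \<epsilon> \<and> \<epsilon> \<le> 1 / 2 \<and> avoids_grid K a L (\<epsilon> * L) \<and>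
     finite {q. grid_cell a L q \<inter> K \<noteq> {}} \<and>
     real (card {q. grid_cell a L q \<inter> K \<noteq> {}}) * L\<^sup>2 \<le> \<eta> * \<epsilon>\<^sup>2)"

lemma loc_removable_if_grid_thin:
  assumes K: "closed K" and thin: "grid_thin K"
  shows "loc_removable K"
  unfolding loc_removable_def
proof (intro allI impI)
  fix U f assume U: "open U" and f: "continuous_on U f" "inj_on f U" "f holomorphic_on U - K"
  show "f holomorphic_on U"
  proof (rule Morera_rectangle[OF U f(1)])
    fix x1 x2 y1 y2 :: real assume x: "x1 \<le> x2" and y: "y1 \<le> y2"
      and RU: "cbox (Complex x1 y1) (Complex x2 y2) \<subseteq> U"
    define R where "R = cbox (Complex x1 y1) (Complex x2 y2)"
    have R: "compact R" "R \<noteq> {}" using x y by (auto simp: R_def box_ne_empty Basis_complex_def inner_complex_def)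
    obtain d where d: "d > 0" "(\<Union>x\<in>R. ball x d) \<subseteq> U"
      using compact_subset_open_imp_ball_epsilon_subset[OF R(1) U] RU by (auto simp: R_def)
    \<comment> \<open>A compact neighbourhood of \<open>R\<close> in \<open>U\<close>, on which \<open>f\<close> is bounded by \<open>\<rho>\<close>.\<close>
    define N where "N = {z. infdist z R \<le> d / 2}"
    have N: "compact N" unfolding N_def using R d by (intro compact_infdist_le) auto
    have NU: "N \<subseteq> U"
    proof
      fix z assume "z \<in> N"
      moreover obtain r where "r \<in> R" "infdist z R = dist z r"
        using infdist_attains_inf[OF compact_imp_closed[OF R(1)] R(2)] by blast
      ultimately have "r \<in> R" "dist z r < d" using d by (simp_all add: N_def)
      then have "z \<in> (\<Union>x\<in>R. ball x d)" by (auto simp: dist_commute)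
      then show "z \<in> U" using d by blast
    qed
    have "bounded (f ` N)"
      using N NU f(1) by (meson compact_continuous_image compact_imp_bounded continuous_on_subset)
    then obtain \<rho> where \<rho>: "\<rho> > 0" "f ` N \<subseteq> ball 0 \<rho>"
      by (metis bounded_subset_ballD)
    have ballN: "ball z r \<subseteq> N" if "z \<in> R" "r \<le> d / 2" for z r
    proof
      fix w assume "w \<in> ball z r"
      then have "infdist w R \<le> dist w z" "dist w z < r" using that by (auto simp: infdist_le dist_commute)
      then show "w \<in> N" using that by (simp add: N_def)
    qed
    define D where "D = max (x2 - x1) (y2 - y1)"
    have D: "D \<ge> 0" using x by (simp add: D_def)
    have ucont: "uniformly_continuous_on R f"
      by (rule compact_uniformly_continuous[OF continuous_on_subset[OF f(1) RU, folded R_def] R(1)])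
    have "cmod (rect_integral f x1 x2 y1 y2) \<le> 0 + s" if s: "s > 0" for s
    proof -
      \<comment> \<open>\<open>\<omega>\<close> and \<open>\<eta>\<close> are chosen such that each summand of the grid bound is at most \<open>s / 2\<close>.\<close>
      define \<omega> where "\<omega> = s / (32 * (D + 2))"
      have \<omega>: "\<omega> > 0" using s D by (simp add: \<omega>_def)
      obtain d' where d': "d' > 0" "\<And>z w. z \<in> R \<Longrightarrow> w \<in> R \<Longrightarrow> dist w z < d' \<Longrightarrow> dist (f w) (f z) < \<omega>"
        using ucont \<omega> unfolding uniformly_continuous_on_def by metis
      define \<eta> where "\<eta> = (s / (576 * \<rho>))\<^sup>2"
      have \<eta>: "\<eta> > 0" using s \<rho> by (simp add: \<eta>_def)
      define \<delta> where "\<delta> = min 1 (min (d' / 2) d)"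
      have \<delta>: "\<delta> > 0" using d' d by (simp add: \<delta>_def)
      obtain L \<epsilon> a where L: "0 < L" "L < \<delta>" and \<epsilon>: "0 < \<epsilon>" "\<epsilon> \<le> 1 / 2" and av: "avoids_grid K a L (\<epsilon> * L)"
        and fin: "finite {q. grid_cell a L q \<inter> K \<noteq> {}}"
        and card: "real (card {q. grid_cell a L q \<inter> K \<noteq> {}}) * L\<^sup>2 \<le> \<eta> * \<epsilon>\<^sup>2"
        using thin \<eta> \<delta> unfolding grid_thin_def by blast
      have e: "0 < \<epsilon> * L" "\<epsilon> * L \<le> L / 2" using L \<epsilon> by auto
      have "L < d" using L by (simp add: \<delta>_def)
      then have ed: "\<epsilon> * L \<le> d / 2" using e by linarith
      define k where "k = real (card {q. grid_cell a L q \<inter> K \<noteq> {}})"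
      have "cmod (rect_integral f x1 x2 y1 y2) \<le> 288 * \<bar>\<rho>\<bar> * sqrt k * L\<^sup>2 / (\<epsilon> * L) + 16 * (D + 2 * L) * \<omega>"
        unfolding k_def
      proof (rule rect_integral_grid_bound[OF U K f x _ y _ R_def L(1) e av fin])
        show "ball z (\<epsilon> * L) \<subseteq> U \<and> f ` ball z (\<epsilon> * L) \<subseteq> ball 0 \<rho>" if "z \<in> R" for z
          using ballN[OF that ed] NU \<rho> by blast
        show "dist (f z) (f w) \<le> \<omega>" if "z \<in> R" "w \<in> R" "dist z w \<le> 2 * L" for z w
          using d'(2)[of w z] that L by (auto simp: \<delta>_def)
      qed (auto simp: D_def)
      moreover have "16 * (D + 2 * L) * \<omega> \<le> 16 * (D + 2) * \<omega>"
        using L \<omega> by (intro mult_right_mono mult_left_mono) (auto simp: \<delta>_def)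
      moreover have "16 * (D + 2) * \<omega> = s / 2" using D by (simp add: \<omega>_def field_simps)
      moreover have "288 * \<bar>\<rho>\<bar> * sqrt k * L\<^sup>2 / (\<epsilon> * L) \<le> s / 2"
      proof -
        have "sqrt (k * L\<^sup>2) \<le> sqrt (\<eta> * \<epsilon>\<^sup>2)" using card by (simp add: k_def)
        then have "sqrt k * L \<le> s / (576 * \<rho>) * \<epsilon>"
          using L \<epsilon> s \<rho> by (simp add: real_sqrt_mult \<eta>_def)
        then have "sqrt k * L / \<epsilon> \<le> s / (576 * \<rho>)" using \<epsilon> by (simp add: pos_divide_le_eq)
        then have "288 * \<rho> * (sqrt k * L / \<epsilon>) \<le> 288 * \<rho> * (s / (576 * \<rho>))"
          using \<rho> by (intro mult_left_mono) auto
        then show ?thesis using \<rho> L \<epsilon> by (simp add: power2_eq_square field_simps)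
      qed
      ultimately show ?thesis by simp
    qed
    then have "cmod (rect_integral f x1 x2 y1 y2) \<le> 0" by (rule field_le_epsilon)
    then show "rect_integral f x1 x2 y1 y2 = 0" by simp
  qed
qed

section \<open>Sets of Hausdorff measure zero\<close>

lemma hausdorff_gauge_pos: "0 < s \<Longrightarrow> hausdorff_gauge s U = diameter U powr s"
  by (simp add: hausdorff_gauge_def diameter_def)

text \<open>For null sets the restriction to small diameters is automatic: if the sum of the
  \<open>s\<close>-th powers is small, every single diameter is small.\<close>

lemma hausdorff_null_iff:
  assumes s: "0 < s"
  shows "hausdorff_measure s A = 0 \<longleftrightarrow> (\<forall>\<eta>>0. \<exists>U. A \<subseteq> (\<Union>i::nat. U i) \<and> (\<forall>i. bounded (U i)) \<and>
    (\<Sum>i. ennreal (diameter (U i) powr s)) < ennreal \<eta>)" (is "?L \<longleftrightarrow> ?R")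
proof
  assume ?L
  show ?R
  proof (intro allI impI)
    fix \<eta> :: real assume \<eta>: "\<eta> > 0"
    have "hausdorff_premeasure s 1 A \<le> hausdorff_measure s A"
      unfolding hausdorff_measure_def by (rule SUP_upper) simp
    then have "hausdorff_premeasure s 1 A < ennreal \<eta>" using \<open>?L\<close> \<eta> by simp
    then show "\<exists>U. A \<subseteq> (\<Union>i::nat. U i) \<and> (\<forall>i. bounded (U i)) \<and>
        (\<Sum>i. ennreal (diameter (U i) powr s)) < ennreal \<eta>"
      unfolding hausdorff_premeasure_def INF_less_iff
      by (auto simp: hausdorff_covers_def hausdorff_gauge_pos[OF s])
  qed
next
  assume R: ?R
  have "hausdorff_premeasure s \<delta> A \<le> 0" if \<delta>: "\<delta> > 0" for \<delta>
  proof (rule ennreal_le_epsilon)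
    fix e :: real assume e: "0 < e"
    define \<eta> where "\<eta> = min e (\<delta> powr s)"
    have \<eta>: "\<eta> > 0" using e \<delta> by (simp add: \<eta>_def)
    then obtain U :: "nat \<Rightarrow> 'a set" where U: "A \<subseteq> (\<Union>i. U i)" "\<And>i. bounded (U i)"
      "(\<Sum>i. ennreal (diameter (U i) powr s)) < ennreal \<eta>" using R by blast
    have "diameter (U i) \<le> \<delta>" for i
    proof (rule ccontr)
      assume "\<not> diameter (U i) \<le> \<delta>"
      then have "\<delta> powr s \<le> diameter (U i) powr s" using \<delta> s by (intro powr_mono2) auto
      then have "ennreal \<eta> \<le> ennreal (diameter (U i) powr s)" by (intro ennreal_leI) (simp add: \<eta>_def)
      also have "\<dots> = (\<Sum>i\<in>{i}. ennreal (diameter (U i) powr s))" by simp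
      also have "\<dots> \<le> (\<Sum>i. ennreal (diameter (U i) powr s))" by (intro sum_le_suminf) auto
      finally show False using U(3) by simp
    qed
    then have "U \<in> hausdorff_covers \<delta> A" using U by (auto simp: hausdorff_covers_def)
    then have "hausdorff_premeasure s \<delta> A \<le> (\<Sum>i. ennreal (hausdorff_gauge s (U i)))"
      unfolding hausdorff_premeasure_def by (rule INF_lower)
    also have "\<dots> \<le> ennreal \<eta>" using U(3) s by (simp add: hausdorff_gauge_pos)
    also have "\<dots> \<le> ennreal e" by (intro ennreal_leI) (simp add: \<eta>_def)
    finally show "hausdorff_premeasure s \<delta> A \<le> 0 + ennreal e" by simp
  qed
  then show ?L unfolding hausdorff_measure_def
    by (metis (no_types, lifting) SUP_least greaterThan_iff le_zero_eq)
qed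

lemma hausdorff_null_subset:
  assumes "0 < s" "hausdorff_measure s B = 0" "A \<subseteq> B"
  shows "hausdorff_measure s A = 0"
  using assms(2) assms(3) unfolding hausdorff_null_iff[OF assms(1)] by (meson subset_trans)

text \<open>A cover for which the sum of the powers is at most \<open>1\<close> consists of sets of
  diameter at most \<open>1\<close>, whose powers decrease when the exponent grows.\<close>

lemma hausdorff_null_exponent:
  assumes s: "0 < s" "s \<le> t" and A: "hausdorff_measure s A = 0"
  shows "hausdorff_measure t A = 0"
proof -
  have t: "0 < t" using s by simp
  show ?thesis unfolding hausdorff_null_iff[OF t]
  proof (intro allI impI)
    fix \<eta> :: real assume "\<eta> > 0"
    then obtain U :: "nat \<Rightarrow> 'a set" where U: "A \<subseteq> (\<Union>i. U i)" "\<And>i. bounded (U i)"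
      "(\<Sum>i. ennreal (diameter (U i) powr s)) < ennreal (min \<eta> 1)"
      using A unfolding hausdorff_null_iff[OF s(1)] by (metis min_less_iff_conj zero_less_one)
    have "diameter (U i) powr t \<le> diameter (U i) powr s" for i
    proof -
      have "ennreal (diameter (U i) powr s) = (\<Sum>i\<in>{i}. ennreal (diameter (U i) powr s))" by simp
      also have "\<dots> \<le> (\<Sum>i. ennreal (diameter (U i) powr s))" by (intro sum_le_suminf) auto
      also have "\<dots> \<le> ennreal 1" using U(3) by (meson ennreal_leI less_imp_le min.cobounded2 order_trans)
      finally have *: "diameter (U i) powr s \<le> 1" by (simp del: ennreal_1)
      have d0: "diameter (U i) \<ge> 0" using U(2) by (rule diameter_ge_0)
      have "diameter (U i) \<le> 1"
      proof (rule ccontr)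
        assume "\<not> diameter (U i) \<le> 1"
        then have "1 < diameter (U i) powr s" using s by (intro gr_one_powr) auto
        then show False using * by simp
      qed
      then show ?thesis using s d0 by (intro powr_mono') auto
    qed
    then have "(\<Sum>i. ennreal (diameter (U i) powr t)) \<le> (\<Sum>i. ennreal (diameter (U i) powr s))"
      by (intro suminf_le ennreal_leI) auto
    also have "\<dots> < ennreal \<eta>" using U(3) by (meson ennreal_leI min.cobounded1 order_less_le_trans)
    finally show "\<exists>U. A \<subseteq> (\<Union>i::nat. U i) \<and> (\<forall>i. bounded (U i)) \<and>
      (\<Sum>i. ennreal (diameter (U i) powr t)) < ennreal \<eta>" using U by blast
  qed
qed

lemma hausdorff_null_UN:
  assumes s: "0 < s" and A: "\<And>n::nat. hausdorff_measure s (A n) = 0"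
  shows "hausdorff_measure s (\<Union>n. A n) = 0"
  unfolding hausdorff_null_iff[OF s]
proof (intro allI impI)
  fix \<eta> :: real assume \<eta>: "\<eta> > 0"
  have "\<exists>U. A n \<subseteq> (\<Union>i::nat. U i) \<and> (\<forall>i. bounded (U i)) \<and>
      (\<Sum>i. ennreal (diameter (U i) powr s)) < ennreal (\<eta> / 2 * (1/2) ^ Suc n)" for n
    using A[of n] \<eta> unfolding hausdorff_null_iff[OF s] by (auto simp del: power_Suc)
  then obtain U where U: "\<And>n. A n \<subseteq> (\<Union>i::nat. U n i)" "\<And>n i. bounded (U n i)"
    "\<And>n. (\<Sum>i. ennreal (diameter (U n i) powr s)) < ennreal (\<eta> / 2 * (1/2) ^ Suc n)" by metis
  define V where "V k = (case prod_decode k of (n, i) \<Rightarrow> U n i)" for k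
  define h where "h p = ennreal (diameter (U (fst p) (snd p)) powr s)" for p
  have "(\<Sum>k. ennreal (diameter (V k) powr s)) = (\<Sum>k. h (prod_decode k))"
    by (simp add: V_def h_def case_prod_unfold)
  also have "\<dots> = (\<Sum>n. \<Sum>i. ennreal (diameter (U n i) powr s))"
    by (rule suminf_ennreal_2dimen[unfolded o_def]) (simp add: h_def)
  also have "\<dots> \<le> (\<Sum>n. ennreal (\<eta> / 2 * (1/2) ^ Suc n))"
    using U(3) by (intro suminf_le less_imp_le) auto
  also have "\<dots> = ennreal (\<eta> / 2 * 1)"
    using \<eta> by (intro suminf_ennreal_eq sums_mult power_half_series) auto
  also have "\<dots> < ennreal \<eta>" using \<eta> by (simp add: ennreal_less_iff)
  finally have "(\<Sum>k. ennreal (diameter (V k) powr s)) < ennreal \<eta>" .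
  moreover have "(\<Union>n. A n) \<subseteq> (\<Union>k. V k)"
  proof
    fix x assume "x \<in> (\<Union>n. A n)"
    then obtain n i where "x \<in> U n i" using U(1) by blast
    then have "x \<in> V (prod_encode (n, i))" by (simp add: V_def)
    then show "x \<in> (\<Union>k. V k)" by blast
  qed
  moreover have "bounded (V k)" for k by (simp add: V_def U split: prod.split)
  ultimately show "\<exists>U. (\<Union>n. A n) \<subseteq> (\<Union>i::nat. U i) \<and> (\<forall>i. bounded (U i)) \<and>
      (\<Sum>i. ennreal (diameter (U i) powr s)) < ennreal \<eta>" by blast
qed

lemma hausdorff_null_empty [simp]: "0 < s \<Longrightarrow> hausdorff_measure s {} = 0"
  unfolding hausdorff_null_iff by (auto intro!: exI[of _ "\<lambda>_. {}"])

lemma hausdorff_null_countable_Union: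
  assumes s: "0 < s" and C: "countable C" and A: "\<And>B. B \<in> C \<Longrightarrow> hausdorff_measure s B = 0"
  shows "hausdorff_measure s (\<Union>C) = 0"
proof (cases "C = {}")
  case False
  then have "\<Union>C = (\<Union>n. from_nat_into C n)" using C by (simp add: range_from_nat_into)
  then show ?thesis
    using hausdorff_null_UN[OF s, of "from_nat_into C"] A False by (simp add: from_nat_into)
qed (use s in simp)

lemma hausdorff_null_Un:
  assumes "0 < s" "hausdorff_measure s A = 0" "hausdorff_measure s B = 0"
  shows "hausdorff_measure s (A \<union> B) = 0"
  using hausdorff_null_countable_Union[of s "{A, B}"] assms by auto

lemma hausdorff_null_lipschitz_image:
  fixes g :: "'a::metric_space \<Rightarrow> 'b::metric_space"
  assumes s: "0 < s" and C: "0 < C" and g: "\<And>x y. x \<in> A \<Longrightarrow> y \<in> A \<Longrightarrow> dist (g x) (g y) \<le> C * dist x y"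
    and A: "hausdorff_measure s A = 0"
  shows "hausdorff_measure s (g ` A) = 0"
  unfolding hausdorff_null_iff[OF s]
proof (intro allI impI)
  fix \<eta> :: real assume \<eta>: "\<eta> > 0"
  define \<eta>' where "\<eta>' = \<eta> / C powr s"
  have "\<eta>' > 0" using \<eta> C by (simp add: \<eta>'_def)
  then obtain U :: "nat \<Rightarrow> 'a set" where U: "A \<subseteq> (\<Union>i. U i)" "\<And>i. bounded (U i)"
      "(\<Sum>i. ennreal (diameter (U i) powr s)) < ennreal \<eta>'"
    using A unfolding hausdorff_null_iff[OF s] by blast
  define V where "V i = g ` (U i \<inter> A)" for i
  have VV: "dist x y \<le> C * diameter (U i)" if xy: "x \<in> V i" "y \<in> V i" for x y i
  proof -
    obtain a b where ab: "a \<in> U i \<inter> A" "x = g a" "b \<in> U i \<inter> A" "y = g b" using xy by (auto simp: V_def)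
    have "dist x y \<le> C * dist a b" using ab g by auto
    also have "\<dots> \<le> C * diameter (U i)" using ab C U(2) by (intro mult_left_mono diameter_bounded_bound) auto
    finally show ?thesis .
  qed
  have bV: "bounded (V i)" for i
    unfolding bounded_two_points using VV by blast
  have dV: "diameter (V i) \<le> C * diameter (U i)" for i
  proof (cases "V i = {}")
    case True
    then show ?thesis using C diameter_ge_0[OF U(2)] by (simp add: diameter_def)
  next
    case False
    then show ?thesis unfolding diameter_def[of "V i"] using VV by (auto intro!: cSUP_least)
  qed
  have "(\<Sum>i. ennreal (diameter (V i) powr s)) \<le> (\<Sum>i. ennreal (C powr s) * ennreal (diameter (U i) powr s))"
  proof (rule suminf_le)
    fix i
    have "diameter (V i) powr s \<le> (C * diameter (U i)) powr s"
      using dV s diameter_ge_0[OF bV] by (intro powr_mono2) auto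
    also have "\<dots> = C powr s * diameter (U i) powr s"
      using C diameter_ge_0[OF U(2)] by (simp add: powr_mult)
    finally show "ennreal (diameter (V i) powr s) \<le> ennreal (C powr s) * ennreal (diameter (U i) powr s)"
      by (simp add: ennreal_mult'[symmetric] ennreal_leI)
  qed auto
  also have "\<dots> = ennreal (C powr s) * (\<Sum>i. ennreal (diameter (U i) powr s))" by simp
  also have "\<dots> < ennreal (C powr s) * ennreal \<eta>'"
    using U(3) C by (intro ennreal_mult_strict_left_mono) auto
  also have "\<dots> = ennreal \<eta>" using C \<eta> by (simp add: ennreal_mult'[symmetric] \<eta>'_def)
  finally have "(\<Sum>i. ennreal (diameter (V i) powr s)) < ennreal \<eta>" .
  moreover have "g ` A \<subseteq> (\<Union>i. V i)" unfolding V_def using U(1) by blast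
  ultimately show "\<exists>U. g ` A \<subseteq> (\<Union>i::nat. U i) \<and> (\<forall>i. bounded (U i)) \<and>
      (\<Sum>i. ennreal (diameter (U i) powr s)) < ennreal \<eta>" using bV by blast
qed

lemma hausdorff_measure_0_null_iff: "hausdorff_measure 0 A = 0 \<longleftrightarrow> A = {}"
proof
  assume "hausdorff_measure 0 A = 0"
  moreover have "hausdorff_premeasure 0 1 A \<le> hausdorff_measure 0 A"
    unfolding hausdorff_measure_def by (rule SUP_upper) simp
  ultimately have "hausdorff_premeasure 0 1 A < 1" by simp
  then obtain U :: "nat \<Rightarrow> 'a set" where U: "A \<subseteq> (\<Union>i. U i)" "(\<Sum>i. ennreal (hausdorff_gauge 0 (U i))) < 1"
    unfolding hausdorff_premeasure_def INF_less_iff by (auto simp: hausdorff_covers_def)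
  have "U i = {}" for i
  proof (rule ccontr)
    assume "U i \<noteq> {}"
    then have "1 = (\<Sum>i\<in>{i}. ennreal (hausdorff_gauge 0 (U i)))" by (simp add: hausdorff_gauge_def)
    also have "\<dots> \<le> (\<Sum>i. ennreal (hausdorff_gauge 0 (U i)))" by (intro sum_le_suminf) auto
    finally show False using U(2) by simp
  qed
  then show "A = {}" using U(1) by auto
next
  assume "A = {}"
  have "hausdorff_premeasure 0 \<delta> A \<le> 0" if "\<delta> > 0" for \<delta>
  proof -
    have "(\<lambda>i. {}) \<in> hausdorff_covers \<delta> A" using that \<open>A = {}\<close> by (simp add: hausdorff_covers_def)
    then have "hausdorff_premeasure 0 \<delta> A \<le> (\<Sum>i::nat. ennreal (hausdorff_gauge 0 ({}::'a set)))"
      unfolding hausdorff_premeasure_def by (rule INF_lower)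
    then show ?thesis by (simp add: hausdorff_gauge_def)
  qed
  then show "hausdorff_measure 0 A = 0" unfolding hausdorff_measure_def
    by (metis (no_types, lifting) SUP_least greaterThan_iff le_zero_eq)
qed

lemma hausdorff_null_mono:
  assumes "0 \<le> s" "s \<le> t" "hausdorff_measure s A = 0" "B \<subseteq> A"
  shows "hausdorff_measure t B = 0"
proof (cases "s = 0")
  case True
  then have "B = {}" using assms hausdorff_measure_0_null_iff by auto
  then show ?thesis using assms True by (cases "t = 0") (auto simp: hausdorff_measure_0_null_iff)
next
  case False
  then show ?thesis
    using assms hausdorff_null_exponent[of s t A] hausdorff_null_subset[of t A B] by auto
qed

lemma hausdorff_dim_mono: "A \<subseteq> B \<Longrightarrow> hausdorff_dim A \<le> hausdorff_dim B"
  unfolding hausdorff_dim_def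
  by (rule Inf_superset_mono) (auto intro: hausdorff_null_mono)

text \<open>Comparing nullity is enough even with a loss in the exponent, as long as the loss can be
  made arbitrarily small.\<close>

lemma hausdorff_dim_le_if_nonnull:
  assumes "\<And>s t. 0 < t \<Longrightarrow> t < s \<Longrightarrow> hausdorff_measure s A \<noteq> 0 \<Longrightarrow> hausdorff_measure t B \<noteq> 0"
  shows "hausdorff_dim A \<le> hausdorff_dim B"
proof (unfold hausdorff_dim_def, rule Inf_greatest, clarify)
  fix t :: real assume t: "0 \<le> t" "hausdorff_measure t B = 0"
  show "Inf {ennreal s |s. 0 \<le> s \<and> hausdorff_measure s A = 0} \<le> ennreal t"
  proof (rule ennreal_le_epsilon)
    fix e :: real assume e: "0 < e"
    have "hausdorff_measure (t + e / 2) B = 0" using hausdorff_null_mono[of t "t + e / 2" B B] t e by simp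
    then have "hausdorff_measure (t + e) A = 0" using assms[of "t + e / 2" "t + e"] t e by auto
    then have "Inf {ennreal s |s. 0 \<le> s \<and> hausdorff_measure s A = 0} \<le> ennreal (t + e)"
      using t e by (intro Inf_lower CollectI exI[of _ "t + e"]) (auto simp del: ennreal_plus)
    then show "Inf {ennreal s |s. 0 \<le> s \<and> hausdorff_measure s A = 0} \<le> ennreal t + ennreal e"
      using t e by simp
  qed
qed

section \<open>Weighted dyadic content\<close>

text \<open>The generation of a dyadic square and the integer coordinates of its centre.\<close>

type_synonym dindex = "nat \<times> int \<times> int"

text \<open>The open square with centre at a point of the lattice of mesh \<open>1 / 2 ^ j\<close>
  and with side \<open>2 / 2 ^ j\<close>. The squares of a generation overlap: every set of diameter
  less than \<open>1 / 2 ^ (j + 1)\<close> is contained in one of them, while each point lies in at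
  most four. Openness makes the coverage below lower semicontinuous.\<close>

definition dyadic_square :: "dindex \<Rightarrow> complex set" where
  "dyadic_square q = {z. \<bar>Re z * 2 ^ fst q - of_int (fst (snd q))\<bar> < 1 \<and> \<bar>Im z * 2 ^ fst q - of_int (snd (snd q))\<bar> < 1}"

definition dyadic_weight :: "real \<Rightarrow> dindex \<Rightarrow> ennreal" where
  "dyadic_weight t q = ennreal ((1 / 2 ^ fst q) powr t)"

definition coverage :: "(dindex \<Rightarrow> ennreal) \<Rightarrow> complex \<Rightarrow> ennreal" where
  "coverage c z = (\<integral>\<^sup>+q. c q * indicator (dyadic_square q) z \<partial>count_space UNIV)"

definition cover_cost :: "real \<Rightarrow> (dindex \<Rightarrow> ennreal) \<Rightarrow> ennreal" where
  "cover_cost t c = (\<integral>\<^sup>+q. c q * dyadic_weight t q \<partial>count_space UNIV)"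

text \<open>The fractional relaxation of dyadic Hausdorff content: a cover assigns a nonnegative
  weight to every dyadic square so that each point of \<open>A\<close> receives total weight at
  least \<open>1\<close>.\<close>

definition weighted_content :: "real \<Rightarrow> complex set \<Rightarrow> ennreal" where
  "weighted_content t A = (INF c\<in>{c. \<forall>z\<in>A. 1 \<le> coverage c z}. cover_cost t c)"

lemma open_dyadic_square: "open (dyadic_square q)"
  unfolding dyadic_square_def by (intro open_Collect_conj open_Collect_less continuous_intros)

lemma weighted_content_le: "(\<And>z. z \<in> A \<Longrightarrow> 1 \<le> coverage c z) \<Longrightarrow> weighted_content t A \<le> cover_cost t c"
  unfolding weighted_content_def by (rule INF_lower) auto

lemma weighted_content_mono: "A \<subseteq> B \<Longrightarrow> weighted_content t A \<le> weighted_content t B"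
  unfolding weighted_content_def by (rule INF_superset_mono) auto

lemma weighted_content_less_iff:
  "weighted_content t A < x \<longleftrightarrow> (\<exists>c. (\<forall>z\<in>A. 1 \<le> coverage c z) \<and> cover_cost t c < x)"
  unfolding weighted_content_def INF_less_iff by auto

lemma coverage_cmult: "coverage (\<lambda>q. a * c q) z = a * coverage c z"
  unfolding coverage_def by (simp add: nn_integral_cmult[symmetric] mult.assoc)

lemma cover_cost_cmult: "cover_cost t (\<lambda>q. a * c q) = a * cover_cost t c"
  unfolding cover_cost_def by (simp add: nn_integral_cmult[symmetric] mult.assoc)

lemma coverage_sum: "coverage (\<lambda>q. \<Sum>i\<in>I. c i q) z = (\<Sum>i\<in>I. coverage (c i) z)"
  unfolding coverage_def by (simp add: nn_integral_sum[symmetric] sum_distrib_right)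

lemma cover_cost_sum: "cover_cost t (\<lambda>q. \<Sum>i\<in>I. c i q) = (\<Sum>i\<in>I. cover_cost t (c i))"
  unfolding cover_cost_def by (simp add: nn_integral_sum[symmetric] sum_distrib_right)

text \<open>If every remainder \<open>A - S k\<close> had a cheap cover, then the sum of these
  covers would cover each point of \<open>A\<close> at least \<open>m - 2\<close> times, since a
  point is missing from at most two remainders. Dividing by \<open>m - 2\<close> gives a cover of
  \<open>A\<close> that costs less than \<open>v\<close>. Fractional weights are what makes this
  division possible.\<close>

lemma weighted_content_average:
  fixes S :: "nat \<Rightarrow> complex set"
  assumes m: "4 < m" and v: "0 < v" "ennreal v \<le> weighted_content t A"
    and S: "\<And>z. z \<in> A \<Longrightarrow> card {k. k < m \<and> z \<in> S k} \<le> 2"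
  shows "\<exists>k<m. ennreal ((1 - 4 / real m) * v) \<le> weighted_content t (A - S k)"
proof (rule ccontr)
  assume "\<not> ?thesis"
  then have "\<forall>k<m. weighted_content t (A - S k) < ennreal ((1 - 4 / real m) * v)" by (simp add: not_le)
  then have "\<forall>k\<in>{..<m}. \<exists>c. (\<forall>z\<in>A - S k. 1 \<le> coverage c z) \<and> cover_cost t c < ennreal ((1 - 4 / real m) * v)"
    unfolding weighted_content_less_iff by blast
  then obtain c where c: "\<And>k z. k < m \<Longrightarrow> z \<in> A - S k \<Longrightarrow> 1 \<le> coverage (c k) z"
    "\<And>k. k < m \<Longrightarrow> cover_cost t (c k) < ennreal ((1 - 4 / real m) * v)" by (metis lessThan_iff)
  define a where "a = ennreal (1 / (real m - 2))"
  define C where "C q = a * (\<Sum>k<m. c k q)" for q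
  have "weighted_content t A \<le> cover_cost t C"
  proof (rule weighted_content_le)
    fix z assume z: "z \<in> A"
    have fin: "finite {k. k < m \<and> P k}" for P by (rule finite_subset[of _ "{..<m}"]) auto
    have "{..<m} = {k. k < m \<and> z \<in> S k} \<union> {k. k < m \<and> z \<notin> S k}" by auto
    then have "m \<le> card {k. k < m \<and> z \<in> S k} + card {k. k < m \<and> z \<notin> S k}"
      by (metis card_Un_le card_lessThan)
    then have cm: "real m - 2 \<le> real (card {k. k < m \<and> z \<notin> S k})" using S[OF z] by linarith
    have "ennreal (real m - 2) \<le> ennreal (real (card {k. k < m \<and> z \<notin> S k}))"
      using cm by (rule ennreal_leI)
    also have "\<dots> = (\<Sum>k\<in>{k. k < m \<and> z \<notin> S k}. 1)" by (simp add: ennreal_of_nat_eq_real_of_nat)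
    also have "\<dots> \<le> (\<Sum>k\<in>{k. k < m \<and> z \<notin> S k}. coverage (c k) z)"
      using c z by (intro sum_mono) auto
    also have "\<dots> \<le> (\<Sum>k<m. coverage (c k) z)" by (intro sum_mono2) auto
    finally have "a * ennreal (real m - 2) \<le> a * (\<Sum>k<m. coverage (c k) z)" by (intro mult_left_mono) auto
    also have "\<dots> = coverage C z" unfolding C_def coverage_cmult coverage_sum ..
    finally show "1 \<le> coverage C z" using m by (simp add: a_def ennreal_mult'[symmetric])
  qed
  also have "\<dots> = a * (\<Sum>k<m. cover_cost t (c k))" unfolding C_def cover_cost_cmult cover_cost_sum ..
  also have "\<dots> \<le> a * (\<Sum>k<m. ennreal ((1 - 4 / real m) * v))"
    by (rule mult_left_mono[OF sum_mono[OF less_imp_le[OF c(2)]]]) auto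
  also have "\<dots> = ennreal (1 / (real m - 2) * (real m * ((1 - 4 / real m) * v)))"
    using m v by (simp add: a_def ennreal_of_nat_eq_real_of_nat ennreal_mult'[symmetric])
  also have "\<dots> < ennreal v"
  proof -
    have "real m * ((1 - 4 / real m) * v) = (real m - 4) * v" using m by (simp add: field_simps)
    also have "\<dots> < (real m - 2) * v" using v by (intro mult_strict_right_mono) auto
    finally have "1 / (real m - 2) * (real m * ((1 - 4 / real m) * v)) < v"
      using m by (simp add: pos_divide_less_eq mult.commute)
    then show ?thesis using v by (intro ennreal_lessI) auto
  qed
  finally show False using v by simp
qed

lemma nn_integral_dindex_eq_suminf:
  fixes f :: "dindex \<Rightarrow> ennreal"
  shows "(\<integral>\<^sup>+q. f q \<partial>count_space UNIV) = (\<Sum>n. f (from_nat_into UNIV n))"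
proof -
  have "infinite (UNIV :: dindex set)" by (simp add: finite_prod)
  then have "bij_betw (from_nat_into (UNIV :: dindex set)) UNIV UNIV"
    by (intro bij_betw_from_nat_into) auto
  then show ?thesis by (simp add: nn_integral_bij_count_space[symmetric] nn_integral_count_space_nat)
qed

text \<open>A sum of nonnegative multiples of indicators of open sets is lower semicontinuous.\<close>

lemma open_coverage_gt: "open {z. x < coverage c z}"
proof (subst open_subopen, clarify)
  fix z0 assume z0: "x < coverage c z0"
  define e where "e = from_nat_into (UNIV :: dindex set)"
  have cov: "coverage c z = (SUP N. \<Sum>n<N. c (e n) * indicator (dyadic_square (e n)) z)" for z
    unfolding coverage_def nn_integral_dindex_eq_suminf e_def by (rule suminf_eq_SUP)
  obtain N where N: "x < (\<Sum>n<N. c (e n) * indicator (dyadic_square (e n)) z0)"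
    using z0 unfolding cov less_SUP_iff by blast
  define T where "T = (\<Inter>n\<in>{n. n < N \<and> z0 \<in> dyadic_square (e n)}. dyadic_square (e n))"
  have "finite {n. n < N \<and> z0 \<in> dyadic_square (e n)}" by (rule finite_subset[of _ "{..<N}"]) auto
  then have "open T" unfolding T_def by (intro open_INT) (auto intro: open_dyadic_square)
  moreover have "z0 \<in> T" by (auto simp: T_def)
  moreover have "T \<subseteq> {z. x < coverage c z}"
  proof
    fix z assume z: "z \<in> T"
    note N
    also have "(\<Sum>n<N. c (e n) * indicator (dyadic_square (e n)) z0) \<le> (\<Sum>n<N. c (e n) * indicator (dyadic_square (e n)) z)"
      using z by (intro sum_mono mult_left_mono) (auto simp: T_def split: split_indicator)
    also have "\<dots> \<le> coverage c z" unfolding cov by (rule SUP_upper) simp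
    finally show "z \<in> {z. x < coverage c z}" by simp
  qed
  ultimately show "\<exists>T. open T \<and> z0 \<in> T \<and> T \<subseteq> {z. x < coverage c z}" by blast
qed

text \<open>A cover of \<open>K\<close> has coverage greater than \<open>1 / l\<close> on an open
  neighbourhood of \<open>K\<close>, for any \<open>l > 1\<close>; multiplied by \<open>l\<close>,
  it covers this neighbourhood at a cost that is larger only by the factor \<open>l\<close>.\<close>

lemma weighted_content_outer_regular:
  assumes "\<And>V. open V \<Longrightarrow> K \<subseteq> V \<Longrightarrow> ennreal v \<le> weighted_content t V"
  shows "ennreal v \<le> weighted_content t K"
  unfolding weighted_content_def
proof (rule INF_greatest, clarify)
  fix c assume c: "\<forall>z\<in>K. 1 \<le> coverage c z"
  have *: "ennreal v \<le> ennreal (1 + 1 / real (Suc n)) * cover_cost t c" for n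
  proof -
    define l where "l = 1 + 1 / real (Suc n)"
    have l: "l > 1" by (simp add: l_def)
    have l1: "ennreal l * ennreal (1 / l) = 1" using l by (simp add: ennreal_mult'[symmetric])
    define V where "V = {z. ennreal (1 / l) < coverage c z}"
    have "open V" unfolding V_def by (rule open_coverage_gt)
    moreover have "K \<subseteq> V"
    proof
      fix z assume "z \<in> K"
      have "ennreal (1 / l) < ennreal 1" using l by (intro ennreal_lessI) auto
      also have "ennreal 1 \<le> coverage c z" using c \<open>z \<in> K\<close> by simp
      finally show "z \<in> V" unfolding V_def by simp
    qed
    ultimately have "ennreal v \<le> weighted_content t V" by (rule assms)
    also have "\<dots> \<le> cover_cost t (\<lambda>q. ennreal l * c q)"
    proof (rule weighted_content_le)
      fix z assume "z \<in> V"
      then have "ennreal l * ennreal (1 / l) \<le> ennreal l * coverage c z"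
        by (intro mult_left_mono) (auto simp: V_def)
      then show "1 \<le> coverage (\<lambda>q. ennreal l * c q) z" by (simp add: coverage_cmult l1)
    qed
    finally show ?thesis by (simp add: cover_cost_cmult l_def)
  qed
  show "ennreal v \<le> cover_cost t c"
  proof (cases "cover_cost t c")
    case (real r)
    have "v \<le> (1 + 1 / real (Suc n)) * r" if "v > 0" for n
    proof -
      have "ennreal v \<le> ennreal ((1 + 1 / real (Suc n)) * r)"
        using *[of n] real by (simp add: ennreal_mult')
      then show ?thesis using real by (subst (asm) ennreal_le_iff) auto
    qed
    moreover have "(\<lambda>n. (1 + 1 / real (Suc n)) * r) \<longlonglongrightarrow> (1 + 0) * r"
      by (intro tendsto_intros LIMSEQ_Suc[OF lim_1_over_n])
    ultimately have "v \<le> r" if "v > 0" using LIMSEQ_le_const that by fastforce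
    then show ?thesis using real by (cases "v > 0") (auto simp: ennreal_neg intro: ennreal_leI)
  qed simp
qed

lemma dyadic_scale:
  assumes x: "0 < (x::real)" "x < 1"
  shows "\<exists>j::nat. x < 1 / 2 ^ j \<and> 1 / 2 ^ j \<le> 2 * x"
proof -
  obtain n where n: "(1 / 2) ^ n < x" using real_arch_pow_inv[of x "1/2"] x by auto
  define N where "N = (LEAST n. (1 / 2) ^ n \<le> x)"
  have N: "(1 / 2) ^ N \<le> x" unfolding N_def by (rule LeastI[of _ n]) (use n in simp)
  have "N \<noteq> 0"
  proof
    assume "N = 0"
    then have "1 \<le> x" using N by simp
    then show False using x by simp
  qed
  then obtain j where j: "N = Suc j" by (cases N) auto
  have "\<not> (1 / 2) ^ j \<le> x" using not_less_Least[of j "\<lambda>n. (1 / 2) ^ n \<le> x"] j N_def by simp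
  then show ?thesis using N j by (intro exI[of _ j]) (simp add: power_divide)
qed

text \<open>The square is centred at a lattice point nearest to a point of \<open>V\<close>, in a
  generation with \<open>2 * x < 1 / 2 ^ j \<le> 4 * x\<close>.\<close>

lemma small_set_in_dyadic_square:
  assumes "bounded V" and x: "diameter V < x" "x < 1 / 2"
  shows "\<exists>q. V \<subseteq> dyadic_square q \<and> 1 / 2 ^ fst q \<le> 4 * x"
proof (cases "V = {}")
  case True
  have "0 < x" using True x by (simp add: diameter_def)
  then obtain j :: nat where "1 / 2 ^ j \<le> 2 * (2 * x)" using dyadic_scale[of "2 * x"] x by auto
  then show ?thesis using True by (intro exI[of _ "(j, 0, 0)"]) auto
next
  case False
  then obtain z where z: "z \<in> V" by blast
  have "0 < x" using diameter_ge_0[OF assms(1)] x by linarith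
  then obtain j :: nat where j: "2 * x < 1 / 2 ^ j" "1 / 2 ^ j \<le> 2 * (2 * x)"
    using dyadic_scale[of "2 * x"] x by auto
  define q where "q = (j, round (Re z * 2 ^ j), round (Im z * 2 ^ j))"
  have near: "\<bar>b * 2 ^ j - of_int (round (a * 2 ^ j))\<bar> < 1" if "\<bar>b - a\<bar> < x" for a b :: real
  proof -
    have "\<bar>b * 2 ^ j - a * 2 ^ j\<bar> = \<bar>b - a\<bar> * 2 ^ j" by (simp add: abs_mult left_diff_distrib[symmetric])
    also have "\<dots> < x * 2 ^ j" using that by simp
    also have "\<dots> < 1 / 2" using j(1) by (simp add: field_simps)
    finally show ?thesis using of_int_round_abs_le[of "a * 2 ^ j"] by linarith
  qed
  have "V \<subseteq> dyadic_square q"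
  proof
    fix w assume w: "w \<in> V"
    have "cmod (w - z) < x"
      using diameter_bounded_bound[OF assms(1) w z] x by (simp add: dist_norm)
    then have "\<bar>Re w - Re z\<bar> < x" "\<bar>Im w - Im z\<bar> < x"
      using abs_Re_le_cmod[of "w - z"] abs_Im_le_cmod[of "w - z"] by auto
    then show "w \<in> dyadic_square q" by (simp add: dyadic_square_def q_def near)
  qed
  then show ?thesis using j by (intro exI[of _ q]) (auto simp: q_def)
qed

text \<open>Each set of an efficient cover lies in a dyadic square of comparable size; using these
  squares with weight \<open>1\<close> is a weighted cover. Sets of diameter zero are first assigned
  a positive size, with a convergent sum of powers.\<close>

lemma weighted_content_zero_if_hausdorff_null:
  assumes t: "0 < t" and A: "hausdorff_measure t A = 0"
  shows "weighted_content t A = 0"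
proof -
  have "weighted_content t A \<le> 0 + ennreal \<epsilon>" if \<epsilon>: "\<epsilon> > 0" for \<epsilon>
  proof -
    define \<eta> where "\<eta> = min (\<epsilon> / (4 powr t)) ((1 / 2) powr t) / 4"
    have \<eta>: "\<eta> > 0" using \<epsilon> by (simp add: \<eta>_def)
    obtain V where V: "A \<subseteq> (\<Union>i::nat. V i)" "\<And>i. bounded (V i)" "(\<Sum>i. ennreal (diameter (V i) powr t)) < ennreal \<eta>"
      using A \<eta> unfolding hausdorff_null_iff[OF t] by blast
    define x where "x i = (diameter (V i) powr t + \<eta> * (1 / 2) ^ Suc i) powr (1 / t)" for i
    have pos: "0 < diameter (V i) powr t + \<eta> * (1 / 2) ^ Suc i" for i
      using \<eta> by (intro add_nonneg_pos) auto
    have xt: "x i powr t = diameter (V i) powr t + \<eta> * (1 / 2) ^ Suc i" for i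
      using t pos[of i] by (simp add: x_def powr_powr)
    have dx: "diameter (V i) < x i" for i
    proof (rule ccontr)
      assume "\<not> diameter (V i) < x i"
      then have "x i powr t \<le> diameter (V i) powr t" using t by (intro powr_mono2) (auto simp: x_def)
      moreover have "\<eta> * (1 / 2) ^ Suc i > 0" using \<eta> by simp
      ultimately show False using xt[of i] by linarith
    qed
    have total: "(\<Sum>i. ennreal (x i powr t)) \<le> ennreal (2 * \<eta>)"
    proof -
      have "(\<Sum>i. ennreal (x i powr t)) = (\<Sum>i. ennreal (diameter (V i) powr t)) + (\<Sum>i. ennreal (\<eta> * (1 / 2) ^ Suc i))"
        using \<eta> by (simp add: xt suminf_add[symmetric] del: power_Suc)
      also have "(\<Sum>i. ennreal (\<eta> * (1 / 2) ^ Suc i)) = ennreal (\<eta> * 1)"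
        using \<eta> by (intro suminf_ennreal_eq sums_mult power_half_series) auto
      also have "(\<Sum>i. ennreal (diameter (V i) powr t)) + ennreal (\<eta> * 1) \<le> ennreal \<eta> + ennreal (\<eta> * 1)"
        using V(3) by (intro add_right_mono less_imp_le)
      finally show ?thesis using \<eta> by (simp add: ennreal_plus[symmetric] del: ennreal_plus)
    qed
    have x2: "x i < 1 / 2" for i
    proof (rule ccontr)
      assume "\<not> x i < 1 / 2"
      then have "(1 / 2) powr t \<le> x i powr t" using t by (intro powr_mono2) auto
      then have "ennreal (4 * \<eta>) \<le> ennreal (x i powr t)" by (intro ennreal_leI) (simp add: \<eta>_def)
      also have "\<dots> = (\<Sum>i\<in>{i}. ennreal (x i powr t))" by simp
      also have "\<dots> \<le> (\<Sum>i. ennreal (x i powr t))" by (intro sum_le_suminf) auto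
      also note total
      finally show False using \<eta> by simp
    qed
    obtain q where q: "\<And>i. V i \<subseteq> dyadic_square (q i)" "\<And>i. 1 / 2 ^ fst (q i) \<le> 4 * x i"
      using small_set_in_dyadic_square[OF V(2) dx x2] by metis
    define c where "c p = (\<Sum>i. indicator {q i} p :: ennreal)" for p
    have swap: "(\<integral>\<^sup>+p. c p * g p \<partial>count_space UNIV) = (\<Sum>i. g (q i))" for g
    proof -
      have "(\<integral>\<^sup>+p. c p * g p \<partial>count_space UNIV) = (\<integral>\<^sup>+p. (\<Sum>i. g p * indicator {q i} p) \<partial>count_space UNIV)"
        by (simp add: c_def mult.commute)
      also have "\<dots> = (\<Sum>i. \<integral>\<^sup>+p. g p * indicator {q i} p \<partial>count_space UNIV)"
        by (rule nn_integral_suminf) simp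
      finally show ?thesis by simp
    qed
    have "weighted_content t A \<le> cover_cost t c"
    proof (rule weighted_content_le)
      fix z assume "z \<in> A"
      then obtain i where "z \<in> V i" using V(1) by blast
      then have "z \<in> dyadic_square (q i)" using q(1) by blast
      then have "1 = (\<Sum>i\<in>{i}. indicator (dyadic_square (q i)) z :: ennreal)" by simp
      also have "\<dots> \<le> (\<Sum>i. indicator (dyadic_square (q i)) z)" by (intro sum_le_suminf) auto
      finally show "1 \<le> coverage c z" unfolding coverage_def swap .
    qed
    also have "\<dots> = (\<Sum>i. dyadic_weight t (q i))" unfolding cover_cost_def swap ..
    also have "\<dots> \<le> (\<Sum>i. ennreal (4 powr t) * ennreal (x i powr t))"
    proof (rule suminf_le)
      fix i
      have "(1 / 2 ^ fst (q i)) powr t \<le> (4 * x i) powr t" using q(2) t by (intro powr_mono2) auto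
      also have "\<dots> = 4 powr t * x i powr t" by (simp add: powr_mult x_def)
      finally show "dyadic_weight t (q i) \<le> ennreal (4 powr t) * ennreal (x i powr t)"
        by (simp add: dyadic_weight_def ennreal_mult'[symmetric] ennreal_leI)
    qed auto
    also have "\<dots> = ennreal (4 powr t) * (\<Sum>i. ennreal (x i powr t))" by simp
    also have "\<dots> \<le> ennreal (4 powr t) * ennreal (2 * \<eta>)" using total by (intro mult_left_mono) auto
    also have "\<dots> = ennreal (4 powr t * (2 * \<eta>))" using \<eta> by (simp add: ennreal_mult'[symmetric])
    also have "\<dots> \<le> ennreal \<epsilon>"
    proof (rule ennreal_leI)
      have "4 * \<eta> \<le> \<epsilon> / (4 powr t)" by (simp add: \<eta>_def)
      then have "2 * \<eta> \<le> \<epsilon> / (4 powr t)" using \<eta> by linarith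
      then show "4 powr t * (2 * \<eta>) \<le> \<epsilon>" by (simp add: field_simps)
    qed
    finally show ?thesis by simp
  qed
  then have "weighted_content t A \<le> 0" by (rule ennreal_le_epsilon)
  then show ?thesis by simp
qed

lemma dyadic_square_bounded: "bounded (dyadic_square q)" and dyadic_square_diameter: "diameter (dyadic_square q) \<le> 4 / 2 ^ fst q"
proof -
  have d: "dist z w \<le> 4 / 2 ^ fst q" if "z \<in> dyadic_square q" "w \<in> dyadic_square q" for z w
  proof -
    have "\<bar>Re z * 2 ^ fst q - Re w * 2 ^ fst q\<bar> < 2" "\<bar>Im z * 2 ^ fst q - Im w * 2 ^ fst q\<bar> < 2"
      using that by (auto simp: dyadic_square_def)
    then have "\<bar>Re (z - w)\<bar> * 2 ^ fst q < 2" "\<bar>Im (z - w)\<bar> * 2 ^ fst q < 2"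
      by (simp_all add: left_diff_distrib[symmetric] abs_mult)
    then have "\<bar>Re (z - w)\<bar> < 2 / 2 ^ fst q" "\<bar>Im (z - w)\<bar> < 2 / 2 ^ fst q"
      by (simp_all add: pos_less_divide_eq)
    then have "\<bar>Re (z - w)\<bar> + \<bar>Im (z - w)\<bar> \<le> 4 / 2 ^ fst q" by linarith
    then show ?thesis using cmod_le[of "z - w"] by (simp add: dist_norm)
  qed
  show "bounded (dyadic_square q)" unfolding bounded_two_points using d by blast
  show "diameter (dyadic_square q) \<le> 4 / 2 ^ fst q"
  proof (cases "dyadic_square q = {}")
    case False
    then show ?thesis unfolding diameter_def[of "dyadic_square q"] using d by (auto intro!: cSUP_least)
  qed (simp add: diameter_def)
qed

text \<open>At most four squares of each generation contain \<open>z\<close>, which leaves a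
  geometric series.\<close>

lemma geometric_coverage:
  assumes \<beta>: "0 < \<beta>" "\<beta> < 1" and \<kappa>: "0 \<le> \<kappa>"
  shows "coverage (\<lambda>q. ennreal (\<kappa> * \<beta> ^ fst q)) z \<le> ennreal (4 * \<kappa> / (1 - \<beta>))"
proof -
  have one: "{a::int. \<bar>x - of_int a\<bar> < 1} \<subseteq> {\<lfloor>x\<rfloor>, \<lfloor>x\<rfloor> + 1}" for x :: real
  proof
    fix a :: int assume "a \<in> {a. \<bar>x - of_int a\<bar> < 1}"
    then have "of_int a - 1 < x" "x < of_int a + 1" by auto
    then have "a = \<lfloor>x\<rfloor> \<or> a = \<lfloor>x\<rfloor> + 1" by linarith
    then show "a \<in> {\<lfloor>x\<rfloor>, \<lfloor>x\<rfloor> + 1}" by simp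
  qed
  have inner: "(\<integral>\<^sup>+p. ennreal (\<kappa> * \<beta> ^ j) * indicator (dyadic_square (j, p)) z \<partial>count_space UNIV) \<le> ennreal (4 * \<kappa> * \<beta> ^ j)" for j
  proof -
    define P where "P = {p. z \<in> dyadic_square (j, p)}"
    define Q where "Q = {\<lfloor>Re z * 2 ^ j\<rfloor>, \<lfloor>Re z * 2 ^ j\<rfloor> + 1} \<times> {\<lfloor>Im z * 2 ^ j\<rfloor>, \<lfloor>Im z * 2 ^ j\<rfloor> + 1}"
    have PQ: "P \<subseteq> Q"
      using one[of "Re z * 2 ^ j"] one[of "Im z * 2 ^ j"] by (auto simp: P_def Q_def dyadic_square_def subset_iff)
    have "card P \<le> card Q" using PQ by (rule card_mono[rotated]) (simp add: Q_def)
    also have "\<dots> = 4" by (simp add: Q_def)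
    finally have P: "card P \<le> 4" .
    have "finite P" using PQ by (rule finite_subset) (simp add: Q_def)
    have "(\<integral>\<^sup>+p. ennreal (\<kappa> * \<beta> ^ j) * indicator (dyadic_square (j, p)) z \<partial>count_space UNIV) =
      (\<integral>\<^sup>+p. ennreal (\<kappa> * \<beta> ^ j) * indicator P p \<partial>count_space UNIV)"
      by (intro nn_integral_cong) (simp add: P_def indicator_def)
    also have "\<dots> = ennreal (\<kappa> * \<beta> ^ j) * of_nat (card P)"
      using \<open>finite P\<close> by (simp add: nn_integral_cmult_indicator)
    also have "\<dots> \<le> ennreal (\<kappa> * \<beta> ^ j) * of_nat 4" using P by (intro mult_left_mono of_nat_mono) auto
    also have "\<dots> = ennreal (\<kappa> * \<beta> ^ j) * ennreal 4" by simp
    also have "\<dots> = ennreal (4 * \<kappa> * \<beta> ^ j)"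
      by (subst ennreal_mult''[symmetric]) (simp_all add: mult_ac)
    finally show ?thesis .
  qed
  have "coverage (\<lambda>q. ennreal (\<kappa> * \<beta> ^ fst q)) z =
     (\<integral>\<^sup>+j. \<integral>\<^sup>+p. ennreal (\<kappa> * \<beta> ^ j) * indicator (dyadic_square (j, p)) z \<partial>count_space UNIV \<partial>count_space UNIV)"
    unfolding coverage_def
    using nn_integral_fst_count_space[of "\<lambda>q. ennreal (\<kappa> * \<beta> ^ fst q) * indicator (dyadic_square q) z"] by simp
  also have "\<dots> \<le> (\<integral>\<^sup>+j. ennreal (4 * \<kappa> * \<beta> ^ j) \<partial>count_space UNIV)"
    by (intro nn_integral_mono inner)
  also have "\<dots> = (\<Sum>j. ennreal (4 * \<kappa> * \<beta> ^ j))" by (rule nn_integral_count_space_nat)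
  also have "\<dots> = ennreal (4 * \<kappa> * (1 / (1 - \<beta>)))"
    using \<beta> \<kappa> by (intro suminf_ennreal_eq sums_mult geometric_sums) auto
  finally show ?thesis by simp
qed

text \<open>Let \<open>\<beta> = 2 powr - (s - t)\<close>. If a point has coverage at least
  \<open>1\<close>, then some square around it, of generation \<open>j\<close> say, has weight at
  least a constant times \<open>\<beta> ^ j\<close>, because otherwise the coverage would be bounded
  by a small geometric series. These heavy squares form an ordinary cover, and for them the factor
  \<open>\<beta> ^ j\<close> by which the \<open>s\<close>-th power of the side is smaller than the
  \<open>t\<close>-th power compensates the missing weight.\<close>

lemma hausdorff_null_if_weighted_content_zero:
  assumes t: "0 < t" "t < s" and A: "weighted_content t A = 0"
  shows "hausdorff_measure s A = 0"
proof -
  have s: "0 < s" using t by simp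
  define \<beta> where "\<beta> = (1 / 2) powr (s - t)"
  have \<beta>: "0 < \<beta>" "\<beta> < 1" using t powr_less_mono2[of "s - t" "1/2" 1] by (auto simp: \<beta>_def)
  \<comment> \<open>With this \<open>\<kappa>\<close> the bound \<open>4 * \<kappa> / (1 - \<beta>)\<close> of the geometric coverage is \<open>1 / 2\<close>.\<close>
  define \<kappa> where "\<kappa> = (1 - \<beta>) / 8"
  have \<kappa>: "0 < \<kappa>" using \<beta> by (simp add: \<kappa>_def)
  show ?thesis unfolding hausdorff_null_iff[OF s]
  proof (intro allI impI)
    fix \<eta> :: real assume \<eta>: "\<eta> > 0"
    \<comment> \<open>A dyadic square has diameter at most \<open>4 / 2 ^ j\<close>; the heavy squares then cost at most \<open>4 powr s / \<kappa>\<close> times the weighted cost.\<close>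
    define \<eta>' where "\<eta>' = \<eta> * \<kappa> / 4 powr s"
    have "\<eta>' > 0" using \<eta> \<kappa> by (simp add: \<eta>'_def)
    then obtain c where c: "\<And>z. z \<in> A \<Longrightarrow> 1 \<le> coverage c z" "cover_cost t c < ennreal \<eta>'"
      using A weighted_content_less_iff[of t A "ennreal \<eta>'"] by auto
    define G where "G = {q. ennreal (\<kappa> * \<beta> ^ fst q) \<le> c q}"
    have AG: "\<exists>q\<in>G. z \<in> dyadic_square q" if z: "z \<in> A" for z
    proof (rule ccontr)
      assume "\<not> ?thesis"
      then have "q \<notin> G" if "z \<in> dyadic_square q" for q using that by blast
      then have "c q * indicator (dyadic_square q) z \<le> ennreal (\<kappa> * \<beta> ^ fst q) * indicator (dyadic_square q) z" for q
        by (cases "z \<in> dyadic_square q") (fastforce simp: G_def not_le less_imp_le)+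
      then have "coverage c z \<le> coverage (\<lambda>q. ennreal (\<kappa> * \<beta> ^ fst q)) z"
        unfolding coverage_def by (intro nn_integral_mono)
      also have "\<dots> \<le> ennreal (4 * \<kappa> / (1 - \<beta>))" using \<beta> \<kappa> by (intro geometric_coverage) auto
      also have "\<dots> < ennreal 1" using \<beta> by (intro ennreal_lessI) (auto simp: \<kappa>_def)
      finally show False using c(1)[OF z] by simp
    qed
    define e where "e = from_nat_into (UNIV :: dindex set)"
    define U where "U n = (if e n \<in> G then dyadic_square (e n) else {})" for n
    have surj: "\<exists>n. e n = q" for q
    proof -
      have "range e = UNIV" unfolding e_def by (intro range_from_nat_into) auto
      then show ?thesis by (metis UNIV_I imageE)
    qed
    have "A \<subseteq> (\<Union>n. U n)"
    proof
      fix z assume "z \<in> A"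
      then obtain q where "q \<in> G" "z \<in> dyadic_square q" using AG by blast
      moreover obtain n where "e n = q" using surj by blast
      ultimately show "z \<in> (\<Union>n. U n)" by (auto simp: U_def)
    qed
    moreover have "bounded (U n)" for n by (simp add: U_def dyadic_square_bounded)
    moreover have "(\<Sum>n. ennreal (diameter (U n) powr s)) < ennreal \<eta>"
    proof -
      have "(\<Sum>n. ennreal (diameter (U n) powr s)) \<le> (\<Sum>n. ennreal (4 powr s / \<kappa>) * (c (e n) * dyadic_weight t (e n)))"
      proof (rule suminf_le)
        fix n
        show "ennreal (diameter (U n) powr s) \<le> ennreal (4 powr s / \<kappa>) * (c (e n) * dyadic_weight t (e n))"
        proof (cases "e n \<in> G")
          case True
          define j where "j = fst (e n)"
          have "(1 / 2 ^ j) powr (s - t) = \<beta> ^ j"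
          proof -
            have "(1 / 2 ^ j :: real) = (1 / 2) powr real j" by (simp add: powr_realpow power_divide)
            then show ?thesis by (simp add: \<beta>_def powr_powr powr_power mult.commute)
          qed
          moreover have "(1 / 2 ^ j :: real) powr s = (1 / 2 ^ j) powr (s - t) * (1 / 2 ^ j) powr t"
            by (simp add: powr_add[symmetric])
          ultimately have sp: "(1 / 2 ^ j :: real) powr s = \<beta> ^ j * (1 / 2 ^ j) powr t" by simp
          have "diameter (U n) powr s \<le> (4 * (1 / 2 ^ j)) powr s"
            using True s dyadic_square_diameter[of "e n"] diameter_ge_0[OF dyadic_square_bounded[of "e n"]]
            by (intro powr_mono2) (auto simp: U_def j_def)
          also have "\<dots> = 4 powr s * (\<beta> ^ j * (1 / 2 ^ j) powr t)" by (simp only: powr_mult sp)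
          also have "\<dots> = (4 powr s / \<kappa>) * ((\<kappa> * \<beta> ^ j) * (1 / 2 ^ j) powr t)" using \<kappa> by simp
          finally have "ennreal (diameter (U n) powr s) \<le> ennreal ((4 powr s / \<kappa>) * ((\<kappa> * \<beta> ^ j) * (1 / 2 ^ j) powr t))"
            by (rule ennreal_leI)
          also have "\<dots> = ennreal (4 powr s / \<kappa>) * (ennreal (\<kappa> * \<beta> ^ j) * dyadic_weight t (e n))"
            using \<kappa> \<beta> by (simp add: ennreal_mult'[symmetric] dyadic_weight_def j_def del: ennreal_mult ennreal_mult')
          also have "\<dots> \<le> ennreal (4 powr s / \<kappa>) * (c (e n) * dyadic_weight t (e n))"
            using True by (intro mult_left_mono mult_right_mono) (auto simp: G_def j_def)
          finally show ?thesis .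
        qed (simp add: U_def diameter_def)
      qed auto
      also have "\<dots> = ennreal (4 powr s / \<kappa>) * cover_cost t c"
        unfolding cover_cost_def nn_integral_dindex_eq_suminf e_def by simp
      also have "\<dots> < ennreal (4 powr s / \<kappa>) * ennreal \<eta>'"
        using c(2) \<kappa> by (intro ennreal_mult_strict_left_mono) auto
      also have "\<dots> = ennreal \<eta>" using \<kappa> \<eta> by (simp add: ennreal_mult'[symmetric] \<eta>'_def)
      finally show ?thesis .
    qed
    ultimately show "\<exists>U. A \<subseteq> (\<Union>i::nat. U i) \<and> (\<forall>i. bounded (U i)) \<and>
      (\<Sum>i. ennreal (diameter (U i) powr s)) < ennreal \<eta>" by blast
  qed
qed

text \<open>The mass distribution principle: integrate the coverage against \<open>M\<close>.\<close>

lemma weighted_content_ge_measure: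
  assumes C: "0 < C" "\<And>q. emeasure M (dyadic_square q \<inter> A) \<le> ennreal C * dyadic_weight t q"
    and M: "A \<in> sets M" "\<And>q. dyadic_square q \<inter> A \<in> sets M"
    and v: "ennreal (C * v) \<le> emeasure M A"
  shows "ennreal v \<le> weighted_content t A"
proof (rule ccontr)
  assume "\<not> ennreal v \<le> weighted_content t A"
  then obtain c where c1: "\<forall>z\<in>A. 1 \<le> coverage c z" and c: "cover_cost t c < ennreal v"
    unfolding not_le weighted_content_less_iff by blast
  have "emeasure M A = (\<integral>\<^sup>+z. indicator A z \<partial>M)" using M by simp
  also have "\<dots> \<le> (\<integral>\<^sup>+z. \<integral>\<^sup>+q. c q * indicator (dyadic_square q \<inter> A) z \<partial>count_space UNIV \<partial>M)"
  proof (rule nn_integral_mono)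
    fix z
    show "indicator A z \<le> (\<integral>\<^sup>+q. c q * indicator (dyadic_square q \<inter> A) z \<partial>count_space UNIV)"
      using c1 by (cases "z \<in> A") (auto simp: coverage_def indicator_inter_arith)
  qed
  also have "\<dots> = (\<integral>\<^sup>+q. \<integral>\<^sup>+z. c q * indicator (dyadic_square q \<inter> A) z \<partial>M \<partial>count_space UNIV)"
    using M by (intro nn_integral_count_space_nn_integral) auto
  also have "\<dots> = (\<integral>\<^sup>+q. c q * emeasure M (dyadic_square q \<inter> A) \<partial>count_space UNIV)"
    using M by (intro nn_integral_cong nn_integral_cmult_indicator) auto
  also have "\<dots> \<le> (\<integral>\<^sup>+q. ennreal C * (c q * dyadic_weight t q) \<partial>count_space UNIV)"
  proof (rule nn_integral_mono)
    fix q
    have "c q * emeasure M (dyadic_square q \<inter> A) \<le> c q * (ennreal C * dyadic_weight t q)" using C by (intro mult_left_mono) auto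
    then show "c q * emeasure M (dyadic_square q \<inter> A) \<le> ennreal C * (c q * dyadic_weight t q)" by (simp add: mult.left_commute)
  qed
  also have "\<dots> = ennreal C * cover_cost t c" unfolding cover_cost_def by (simp add: nn_integral_cmult)
  also have "\<dots> < ennreal C * ennreal v" using c C by (intro ennreal_mult_strict_left_mono) auto
  also have "\<dots> = ennreal (C * v)" using C by (simp add: ennreal_mult'[symmetric])
  finally show False using v by simp
qed

section \<open>Removing strips from compact null sets\<close>

lemma compact_decreasing_subset_open:
  fixes K :: "nat \<Rightarrow> 'a::heine_borel set"
  assumes K: "\<And>n. compact (K n)" "\<And>n. K (Suc n) \<subseteq> K n" and V: "open V" "(\<Inter>n. K n) \<subseteq> V"
  shows "\<exists>n. K n \<subseteq> V"
proof (rule ccontr)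
  assume "\<not> ?thesis"
  then have "\<And>n. K n - V \<noteq> {}" by blast
  moreover have "\<And>n. compact (K n - V)" using K V by (simp add: compact_diff)
  moreover have "K n \<subseteq> K m" if "m \<le> n" for m n using lift_Suc_antimono_le[of K] K(2) that by blast
  then have "K n - V \<subseteq> K m - V" if "m \<le> n" for m n using that by blast
  ultimately have "\<Inter>(range (\<lambda>n. K n - V)) \<noteq> {}" by (intro compact_nest) auto
  then show False using V by blast
qed

lemma emeasure_open_square: "0 < L \<Longrightarrow> emeasure lborel (box (Complex x y) (Complex (x + L) (y + L))) = ennreal (L\<^sup>2)"
  by (subst emeasure_lborel_box) (auto simp: Basis_complex_def inner_complex_def power2_eq_square)

text \<open>The interiors of the cells are disjoint.\<close>

lemma card_cells_times_area:
  assumes L: "0 < L" and F: "finite F" "\<And>q. q \<in> F \<Longrightarrow> grid_cell a L q \<subseteq> V" and V: "V \<in> sets borel"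
  shows "ennreal (real (card F) * L\<^sup>2) \<le> emeasure lborel V"
proof -
  define b where "b q = box (Complex (a + of_int (fst q) * L) (a + of_int (snd q) * L))
     (Complex (a + of_int (fst q) * L + L) (a + of_int (snd q) * L + L))" for q :: "int \<times> int"
  have bg: "b q \<subseteq> grid_cell a L q" for q
    by (auto simp: b_def in_box_complex_iff grid_cell_iff algebra_simps)
  have uniq: "i = \<lfloor>(x - a) / L\<rfloor>" if "a + of_int i * L < x" "x < a + of_int i * L + L" for i x
  proof -
    have "of_int i \<le> (x - a) / L" "(x - a) / L < of_int i + 1" using that L by (simp_all add: field_simps)
    then show ?thesis by linarith
  qed
  have disj: "disjoint_family_on b F"
    unfolding disjoint_family_on_def
  proof (intro ballI impI, rule ccontr)
    fix p q assume "p \<noteq> q" "b p \<inter> b q \<noteq> {}"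
    then obtain z where z: "z \<in> b p" "z \<in> b q" by blast
    have "fst r = \<lfloor>(Re z - a) / L\<rfloor> \<and> snd r = \<lfloor>(Im z - a) / L\<rfloor>" if "z \<in> b r" for r
      using that uniq[of "fst r" "Re z"] uniq[of "snd r" "Im z"] by (auto simp: b_def in_box_complex_iff)
    from this[OF z(1)] this[OF z(2)] \<open>p \<noteq> q\<close> show False by (simp add: prod_eq_iff)
  qed
  have "ennreal (real (card F) * L\<^sup>2) = (\<Sum>q\<in>F. ennreal (L\<^sup>2))"
    by (simp add: ennreal_of_nat_eq_real_of_nat ennreal_mult')
  also have "\<dots> = (\<Sum>q\<in>F. emeasure lborel (b q))"
    using L by (intro sum.cong refl) (simp add: b_def emeasure_open_square)
  also have "\<dots> = emeasure lborel (\<Union>q\<in>F. b q)"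
    by (rule sum_emeasure[OF _ disj F(1)]) (auto simp: b_def)
  also have "\<dots> \<le> emeasure lborel V" 
    by (rule emeasure_mono[OF UN_least]) (use V order_trans[OF bg F(2)] in auto)
  finally show ?thesis .
qed

text \<open>The cells that meet \<open>E\<close> lie in a prescribed neighbourhood of
  \<open>E\<close> when the mesh is small, and the area of the neighbourhood is as small as desired.
  The bound does not depend on the position of the grid.\<close>

lemma few_cells_meet_null_set:
  assumes E: "compact E" "emeasure lborel E = 0" and \<eta>: "0 < \<eta>"
  shows "\<exists>\<delta>>0. \<forall>L a. 0 < L \<longrightarrow> L < \<delta> \<longrightarrow> finite {q. grid_cell a L q \<inter> E \<noteq> {}} \<and>
     real (card {q. grid_cell a L q \<inter> E \<noteq> {}}) * L\<^sup>2 \<le> \<eta>"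
proof -
  have Eb: "E \<in> sets borel" using E by (simp add: borel_compact)
  then obtain V where V: "open V" "E \<subseteq> V" "emeasure lebesgue (V - E) < ennreal \<eta>"
    using sets_lebesgue_outer_open[of E \<eta>] \<eta> by (auto intro: sets_completionI_sets)
  have "emeasure lborel (V - E) < ennreal \<eta>"
    using V(1,3) Eb by (simp add: emeasure_completion)
  moreover have "emeasure lborel V = emeasure lborel E + emeasure lborel (V - E)"
    using V Eb by (subst plus_emeasure) (auto simp: Un_absorb1)
  ultimately have mV: "emeasure lborel V < ennreal \<eta>" using E by simp
  obtain d where d: "d > 0" "(\<Union>x\<in>E. ball x d) \<subseteq> V"
    using compact_subset_open_imp_ball_epsilon_subset[OF E(1) V(1,2)] by blast
  have "finite {q. grid_cell a L q \<inter> E \<noteq> {}} \<and> real (card {q. grid_cell a L q \<inter> E \<noteq> {}}) * L\<^sup>2 \<le> \<eta>"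
    if L: "0 < L" "L < d / 2" for L a
  proof -
    define J where "J = {q. grid_cell a L q \<inter> E \<noteq> {}}"
    have JV: "grid_cell a L q \<subseteq> V" if q: "q \<in> J" for q
    proof
      fix w assume w: "w \<in> grid_cell a L q"
      obtain z where z: "z \<in> grid_cell a L q" "z \<in> E" using q by (auto simp: J_def)
      have "\<bar>Re (z - w)\<bar> \<le> L" "\<bar>Im (z - w)\<bar> \<le> L" using z(1) w by (auto simp: grid_cell_iff algebra_simps)
      then have "dist z w < d" using cmod_le[of "z - w"] L by (simp add: dist_norm)
      then have "w \<in> (\<Union>x\<in>E. ball x d)" using z by auto
      then show "w \<in> V" using d by blast
    qed
    have F: "real (card F) * L\<^sup>2 \<le> \<eta>" if "F \<subseteq> J" "finite F" for F
    proof -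
      have "ennreal (real (card F) * L\<^sup>2) \<le> emeasure lborel V"
        using JV that V by (intro card_cells_times_area[OF L(1) that(2)]) auto
      then have "ennreal (real (card F) * L\<^sup>2) < ennreal \<eta>" using mV by (rule le_less_trans)
      then show ?thesis by (simp add: ennreal_less_iff)
    qed
    have "card F \<le> nat \<lceil>\<eta> / L\<^sup>2\<rceil>" if "F \<subseteq> J" "finite F" for F
    proof -
      have "real (card F) \<le> \<eta> / L\<^sup>2" using F[OF that] L by (simp add: pos_le_divide_eq)
      then show ?thesis by linarith
    qed
    then have "finite J" using finite_if_finite_subsets_card_bdd by blast
    then show ?thesis using F[of J] unfolding J_def by blast
  qed
  then show ?thesis using d by (intro exI[of _ "d / 2"]) auto
qed

definition strips :: "real \<Rightarrow> real \<Rightarrow> real \<Rightarrow> complex set" where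
  "strips a L e = {z. \<exists>i::int. \<bar>Re z - (a + of_int i * L)\<bar> < e \<or> \<bar>Im z - (a + of_int i * L)\<bar> < e}"

lemma open_strips: "open (strips a L e)"
proof -
  have "strips a L e = (\<Union>i::int. {z. \<bar>Re z - (a + of_int i * L)\<bar> < e} \<union> {z. \<bar>Im z - (a + of_int i * L)\<bar> < e})"
    by (auto simp: strips_def)
  then show ?thesis by (simp only:) (intro open_UN ballI open_Un open_Collect_less continuous_intros)
qed

lemma avoids_grid_diff_strips: "avoids_grid (A - strips a L e) a L e"
  by (auto simp: avoids_grid_def strips_def not_less)

lemma avoids_grid_subset: "avoids_grid A a L e \<Longrightarrow> B \<subseteq> A \<Longrightarrow> avoids_grid B a L e"
  by (auto simp: avoids_grid_def)

text \<open>For different \<open>k\<close> the vertical strips are disjoint, and so are the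
  horizontal ones. A point thus lies in at most one system of each kind.\<close>

lemma card_shifted_strips_containing:
  assumes L: "0 < L" and m: "0 < m"
  shows "card {k. k < m \<and> z \<in> strips (real k * L / real m) L (L / (2 * real m))} \<le> 2"
proof -
  define H where "H x = {k. k < m \<and> (\<exists>i::int. \<bar>x - (real k * L / real m + of_int i * L)\<bar> < L / (2 * real m))}" for x
  have H: "card (H x) \<le> 1" "finite (H x)" for x
  proof -
    show fin: "finite (H x)" by (rule finite_subset[of _ "{..<m}"]) (auto simp: H_def)
    have "k = l" if kl: "k \<in> H x" "l \<in> H x" for k l
    proof -
      obtain i j :: int where ij: "\<bar>x - (real k * L / real m + of_int i * L)\<bar> < L / (2 * real m)"
        "\<bar>x - (real l * L / real m + of_int j * L)\<bar> < L / (2 * real m)"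
        using kl unfolding H_def by blast
      define D where "D = (int k - int l) + int m * (i - j)"
      have "of_int D * (L / real m) = (real k * L / real m + of_int i * L) - (real l * L / real m + of_int j * L)"
        using m by (simp add: D_def field_simps)
      then have "\<bar>of_int D * (L / real m)\<bar> < L / (2 * real m) + L / (2 * real m)"
      proof -
        have "\<bar>A - B\<bar> < e + e" if "\<bar>x - A\<bar> < e" "\<bar>x - B\<bar> < e" for A B e :: real
          using that by linarith
        from this[OF ij] show ?thesis using \<open>of_int D * (L / real m) = _\<close> by simp
      qed
      then have "\<bar>of_int D\<bar> * (L / real m) < 1 * (L / real m)" using L m by (simp add: abs_mult)
      then have "\<bar>of_int D :: real\<bar> < 1" using L m by (subst (asm) mult_less_cancel_right) auto
      then have "D = 0" by linarith
      then have e: "int k = int l + int m * (j - i)" by (simp add: D_def algebra_simps)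
      then have "int k mod int m = int l mod int m" by simp
      then show "k = l" using kl by (simp add: H_def)
    qed
    then show "card (H x) \<le> 1" using fin by (simp add: card_le_Suc0_iff_eq)
  qed
  have "{k. k < m \<and> z \<in> strips (real k * L / real m) L (L / (2 * real m))} \<subseteq> H (Re z) \<union> H (Im z)"
    by (auto simp: strips_def H_def)
  then have "card {k. k < m \<and> z \<in> strips (real k * L / real m) L (L / (2 * real m))} \<le> card (H (Re z) \<union> H (Im z))"
    using H by (intro card_mono) auto
  also have "\<dots> \<le> 2" using card_Un_le[of "H (Re z)" "H (Im z)"] H(1)[of "Re z"] H(1)[of "Im z"] by linarith
  finally show ?thesis .
qed

text \<open>At stage \<open>n\<close> the number of strip systems is \<open>m = 2 ^ (n + 4)\<close>,
  so removing the best one costs at most the proportion \<open>4 / m = 2 ^ - (n + 2)\<close> of the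
  content. These losses are summable, and the content stays above \<open>(1 / 2 + 2 ^ - (n + 1)) *
  v\<close>. The mesh is chosen after \<open>m\<close>, hence after the relative width of the
  strips.\<close>

lemma grid_thin_subset_of_null_set:
  assumes E: "compact E" "emeasure lborel E = 0" and v: "0 < v" "ennreal v \<le> weighted_content t E"
  shows "\<exists>K\<subseteq>E. compact K \<and> grid_thin K \<and> ennreal (v / 2) \<le> weighted_content t K"
proof -
  define P where "P n K \<longleftrightarrow> compact K \<and> K \<subseteq> E \<and> ennreal ((1 / 2 + (1 / 2) ^ Suc n) * v) \<le> weighted_content t K" for n :: nat and K
  define N where "N a L = {q. grid_cell a L q \<inter> E \<noteq> {}}" for a L
  define Q where "Q n K K' \<longleftrightarrow> K' \<subseteq> K \<and> (\<exists>L \<epsilon> a. 0 < L \<and> L < 1 / real (Suc n) \<and> 0 < \<epsilon> \<and> \<epsilon> \<le> 1 / 2 \<and>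
      avoids_grid K' a L (\<epsilon> * L) \<and> finite (N a L) \<and> real (card (N a L)) * L\<^sup>2 \<le> 1 / real (Suc n) * \<epsilon>\<^sup>2)"
      for n :: nat and K K' :: "complex set"
  have step: "\<exists>K'. P (Suc n) K' \<and> Q n K K'" if K: "P n K" for K n
  proof -
    define m :: nat where "m = 2 ^ (n + 4)"
    have "(2::nat) ^ 4 \<le> m" unfolding m_def by (rule power_increasing) auto
    then have m: "4 < m" by simp
    define \<epsilon> where "\<epsilon> = 1 / (2 * real m)"
    have \<epsilon>: "0 < \<epsilon>" "\<epsilon> \<le> 1 / 2" using m by (auto simp: \<epsilon>_def field_simps)
    obtain \<delta> where \<delta>: "\<delta> > 0" "\<And>L a. 0 < L \<Longrightarrow> L < \<delta> \<Longrightarrow> finite (N a L) \<and> real (card (N a L)) * L\<^sup>2 \<le> 1 / real (Suc n) * \<epsilon>\<^sup>2"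
      using few_cells_meet_null_set[OF E, of "1 / real (Suc n) * \<epsilon>\<^sup>2"] \<epsilon> unfolding N_def by auto
    define L where "L = min \<delta> (1 / real (Suc n)) / 2"
    define r where "r = 1 / real (Suc n)"
    have "0 < r" by (simp add: r_def)
    then have L: "0 < L" "L < \<delta>" "L < r" using \<delta>(1) unfolding L_def r_def[symmetric] by linarith+
    note L = this[unfolded r_def]
    define S where "S k = strips (real k * L / real m) L (\<epsilon> * L)" for k :: nat
    define u where "u = (1 / 2 + (1 / 2) ^ Suc n) * v"
    have u: "0 < u" using v by (simp add: u_def add_pos_pos)
    have eL: "\<epsilon> * L = L / (2 * real m)" by (simp add: \<epsilon>_def)
    have "\<exists>k<m. ennreal ((1 - 4 / real m) * u) \<le> weighted_content t (K - S k)"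
    proof (rule weighted_content_average[OF m u])
      show "ennreal u \<le> weighted_content t K" using K by (simp add: P_def u_def)
      show "card {k. k < m \<and> z \<in> S k} \<le> 2" for z
        using card_shifted_strips_containing[OF L(1), of m z] m unfolding S_def eL by simp
    qed
    then obtain k where k: "ennreal ((1 - 4 / real m) * u) \<le> weighted_content t (K - S k)" by blast
    have "(1 / 2 + (1 / 2) ^ Suc (Suc n)) * v \<le> (1 - 4 / real m) * u"
    proof -
      define x :: real where "x = (1 / 2) ^ Suc (Suc n)"
      have "4 / real m = x" by (simp add: m_def x_def power_add power_divide)
      moreover have "(1 / 2) ^ Suc n = 2 * x" by (simp add: x_def)
      moreover have x: "0 \<le> x" "x \<le> 1 / 4"
      proof -
        have "x = (1 / 4) * (1 / 2) ^ n" by (simp add: x_def)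
        moreover have "(1 / 2 :: real) ^ n \<le> 1" by (intro power_le_one) auto
        ultimately show "x \<le> 1 / 4" by simp
      qed (simp add: x_def)
      moreover have "1 / 2 + x \<le> (1 - x) * (1 / 2 + 2 * x)"
      proof -
        have "x * x \<le> x * (1 / 4)" using x by (intro mult_left_mono) auto
        moreover have "(1 - x) * (1 / 2 + 2 * x) = 1 / 2 + 3 / 2 * x - 2 * (x * x)"
          by (simp add: field_simps)
        ultimately show ?thesis by linarith
      qed
      ultimately show ?thesis using v unfolding u_def x_def[symmetric]
        by (simp add: mult_right_mono mult.assoc[symmetric])
    qed
    then have "ennreal ((1 / 2 + (1 / 2) ^ Suc (Suc n)) * v) \<le> weighted_content t (K - S k)"
      using k ennreal_leI order_trans by blast
    moreover have "compact (K - S k)" using K by (simp add: P_def S_def compact_diff open_strips)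
    ultimately have "P (Suc n) (K - S k)" using K by (auto simp: P_def)
    moreover have "Q n K (K - S k)"
      unfolding Q_def using L \<epsilon> \<delta>(2)[OF L(1,2)] avoids_grid_diff_strips unfolding S_def by blast
    ultimately show ?thesis by blast
  qed
  have "P 0 E" using E v by (simp add: P_def)
  then obtain K where K: "\<And>n. P n (K n)" "\<And>n. Q n (K n) (K (Suc n))"
    using dependent_nat_choice[of P Q] step by metis
  define K' where "K' = (\<Inter>n. K n)"
  have cK: "\<And>n. compact (K n)" "\<And>n. K (Suc n) \<subseteq> K n" using K by (auto simp: P_def Q_def)
  have "compact K'" unfolding K'_def using cK by (intro compact_Inter) auto
  moreover have "K' \<subseteq> E" using K(1)[of 0] by (auto simp: P_def K'_def)
  moreover have "ennreal (v / 2) \<le> weighted_content t K'"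
  proof (rule weighted_content_outer_regular)
    fix V assume "open V" "K' \<subseteq> V"
    then obtain n where n: "K n \<subseteq> V"
      using compact_decreasing_subset_open[of K V] cK unfolding K'_def by blast
    have "v / 2 \<le> (1 / 2 + (1 / 2) ^ Suc n) * v" using v by (simp add: distrib_right)
    then have "ennreal (v / 2) \<le> ennreal ((1 / 2 + (1 / 2) ^ Suc n) * v)" by (rule ennreal_leI)
    also have "\<dots> \<le> weighted_content t (K n)" using K(1)[of n] by (simp add: P_def)
    also have "\<dots> \<le> weighted_content t V" using n by (rule weighted_content_mono)
    finally show "ennreal (v / 2) \<le> weighted_content t V" .
  qed
  moreover have "grid_thin K'"
    unfolding grid_thin_def
  proof (intro allI impI)
    fix \<eta> \<delta> :: real assume "0 < \<eta>" "0 < \<delta>"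
    then obtain n where n: "1 / real (Suc n) < min \<eta> \<delta>"
      using nat_approx_posE[of "min \<eta> \<delta>"] by (metis min_less_iff_conj)
    obtain L \<epsilon> a where L: "0 < L" "L < 1 / real (Suc n)" "0 < \<epsilon>" "\<epsilon> \<le> 1 / 2"
      "avoids_grid (K (Suc n)) a L (\<epsilon> * L)" "finite (N a L)" "real (card (N a L)) * L\<^sup>2 \<le> 1 / real (Suc n) * \<epsilon>\<^sup>2"
      using K(2)[of n] unfolding Q_def by blast
    have sub: "{q. grid_cell a L q \<inter> K' \<noteq> {}} \<subseteq> N a L" using \<open>K' \<subseteq> E\<close> by (auto simp: N_def)
    have "real (card {q. grid_cell a L q \<inter> K' \<noteq> {}}) * L\<^sup>2 \<le> real (card (N a L)) * L\<^sup>2"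
      using card_mono[OF L(6) sub] by (intro mult_right_mono) auto
    also have "\<dots> \<le> 1 / real (Suc n) * \<epsilon>\<^sup>2" by (fact L(7))
    also have "\<dots> \<le> \<eta> * \<epsilon>\<^sup>2" using n by (intro mult_right_mono) auto
    finally have "real (card {q. grid_cell a L q \<inter> K' \<noteq> {}}) * L\<^sup>2 \<le> \<eta> * \<epsilon>\<^sup>2" .
    moreover have "avoids_grid K' a L (\<epsilon> * L)" using L(5) by (rule avoids_grid_subset) (auto simp: K'_def)
    moreover have "finite {q. grid_cell a L q \<inter> K' \<noteq> {}}" using finite_subset[OF sub L(6)] .
    moreover have "L < \<delta>" using L(2) n by simp
    ultimately show "\<exists>L \<epsilon> a. 0 < L \<and> L < \<delta> \<and> 0 < \<epsilon> \<and> \<epsilon> \<le> 1 / 2 \<and> avoids_grid K' a L (\<epsilon> * L) \<and>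
      finite {q. grid_cell a L q \<inter> K' \<noteq> {}} \<and> real (card {q. grid_cell a L q \<inter> K' \<noteq> {}}) * L\<^sup>2 \<le> \<eta> * \<epsilon>\<^sup>2"
      using L by blast
  qed
  ultimately show ?thesis by blast
qed

section \<open>Null subsets of sets of positive area\<close>

lemma emeasure_affine_preimage:
  fixes A :: "complex set"
  assumes c: "c \<noteq> 0" and A: "A \<in> sets borel"
  shows "emeasure lborel A = ennreal (c\<^sup>2) * emeasure lborel {z. t + c *\<^sub>R z \<in> A}"
proof -
  have "emeasure lborel A = emeasure (density (distr lborel borel (\<lambda>x. t + c *\<^sub>R x)) (\<lambda>_. ennreal (\<bar>c\<bar> ^ DIM(complex)))) A"
    using lborel_affine[OF c, of t] by simp
  also have "\<dots> = ennreal (c\<^sup>2) * emeasure (distr lborel borel (\<lambda>x. t + c *\<^sub>R x)) A"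
    using A by (simp add: emeasure_density nn_integral_cmult_indicator)
  also have "emeasure (distr lborel borel (\<lambda>x. t + c *\<^sub>R x)) A = emeasure lborel {z. t + c *\<^sub>R z \<in> A}"
    using A by (simp add: emeasure_distr vimage_def)
  finally show ?thesis .
qed

text \<open>The reals whose first digit after the point in base \<open>b\<close> is not \<open>b -
  1\<close>, up to the endpoints of the digit intervals; open intervals are removed so that the set
  is closed.\<close>

definition low_digit :: "nat \<Rightarrow> real set" where
  "low_digit b = - (\<Union>k::int. {of_int k - 1 / real b<..<of_int k})"

text \<open>The points for both coordinates of which the first \<open>n\<close> digits after the
  point avoid \<open>b - 1\<close>. The sets are periodic with respect to the integer lattice.\<close>

fun digit_set :: "nat \<Rightarrow> nat \<Rightarrow> complex set" where
  "digit_set b 0 = UNIV"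
| "digit_set b (Suc n) = {z. Re z \<in> low_digit b \<and> Im z \<in> low_digit b \<and> real b *\<^sub>R z \<in> digit_set b n}"

lemma closed_low_digit: "closed (low_digit b)"
  unfolding low_digit_def closed_def by auto

lemma low_digit_unit_interval:
  assumes b: "0 < b" and x: "0 \<le> x" "x < 1"
  shows "x \<in> low_digit b \<longleftrightarrow> x \<le> 1 - 1 / real b"
proof
  show "x \<le> 1 - 1 / real b" if "x \<in> low_digit b"
  proof (rule ccontr)
    assume "\<not> x \<le> 1 - 1 / real b"
    then have "x \<in> {of_int 1 - 1 / real b<..<of_int 1}" using x by simp
    then show False using that unfolding low_digit_def by blast
  qed
  assume le: "x \<le> 1 - 1 / real b"
  have "\<not> (of_int k - 1 / real b < x \<and> x < of_int k)" for k :: int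
  proof
    assume k: "of_int k - 1 / real b < x \<and> x < of_int k"
    then have "of_int k < (1::real)" using le by linarith
    then have "k \<le> 0" by simp
    then have "of_int k \<le> (0::real)" by simp
    then show False using k x by linarith
  qed
  then show "x \<in> low_digit b" by (auto simp: low_digit_def)
qed

lemma closed_digit_set: "2 \<le> b \<Longrightarrow> closed (digit_set b n)"
proof (induction n)
  case (Suc n)
  have "closed ((\<lambda>z. real b *\<^sub>R z :: complex) -` digit_set b n)"
    using Suc by (intro closed_vimage continuous_intros) auto
  moreover have "closed (Re -` low_digit b)" "closed (Im -` low_digit b)"
    using closed_low_digit by (auto intro!: closed_vimage continuous_intros)
  ultimately have "closed (Re -` low_digit b \<inter> Im -` low_digit b \<inter> (\<lambda>z. real b *\<^sub>R z) -` digit_set b n)"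
    by (intro closed_Int)
  then show ?case by (simp add: vimage_def Int_def conj_assoc)
qed simp

lemma digit_set_antimono: "m \<le> n \<Longrightarrow> digit_set b n \<subseteq> digit_set b m"
proof -
  have "digit_set b (Suc n) \<subseteq> digit_set b n" for n by (induction n) auto
  then show "m \<le> n \<Longrightarrow> digit_set b n \<subseteq> digit_set b m" by (rule lift_Suc_antimono_le)
qed

lemma low_digit_periodic: "x + of_int k \<in> low_digit b \<longleftrightarrow> x \<in> low_digit b"
proof -
  have *: "x + of_int k \<notin> low_digit b" if x: "x \<notin> low_digit b" for x k
  proof -
    obtain l :: int where "of_int l - 1 / real b < x" "x < of_int l" using x by (auto simp: low_digit_def)
    then have "x + of_int k \<in> {of_int (l + k) - 1 / real b<..<of_int (l + k)}" by simp
    then show ?thesis unfolding low_digit_def by blast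
  qed
  show ?thesis using *[of x k] *[of "x + of_int k" "- k"] by auto
qed

lemma digit_set_periodic:
  "z + Complex (of_int p) (of_int q) \<in> digit_set b n \<longleftrightarrow> z \<in> digit_set b n"
proof (induction n arbitrary: z p q)
  case (Suc n)
  have "real b *\<^sub>R (z + Complex (of_int p) (of_int q)) =
      real b *\<^sub>R z + Complex (of_int (int b * p)) (of_int (int b * q))"
    by (simp add: complex_eq_iff algebra_simps)
  then show ?case
    using Suc.IH[of "real b *\<^sub>R z" "int b * p" "int b * q"]
    by (simp add: low_digit_periodic del: scaleR_add_right)
qed simp

text \<open>Half-open, so that the cells partition the plane.\<close>

definition unit_cell :: "int \<times> int \<Rightarrow> complex set" where
  "unit_cell g = {z. \<lfloor>Re z\<rfloor> = fst g \<and> \<lfloor>Im z\<rfloor> = snd g}"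

lemma sets_digit_set [measurable]: "2 \<le> b \<Longrightarrow> digit_set b n \<in> sets borel"
  by (simp add: closed_digit_set borel_closed)

lemma sets_unit_cell [measurable]: "unit_cell g \<in> sets borel"
  unfolding unit_cell_def by measurable

lemma emeasure_unit_cell_shift:
  assumes b: "2 \<le> b"
  shows "emeasure lborel (digit_set b n \<inter> unit_cell g) = emeasure lborel (digit_set b n \<inter> unit_cell (0, 0))"
proof -
  define t where "t = Complex (of_int (fst g)) (of_int (snd g))"
  have "emeasure lborel (digit_set b n \<inter> unit_cell g) =
      ennreal (1\<^sup>2) * emeasure lborel {z. t + 1 *\<^sub>R z \<in> digit_set b n \<inter> unit_cell g}"
    using b by (intro emeasure_affine_preimage) auto
  also have "{z. t + 1 *\<^sub>R z \<in> digit_set b n \<inter> unit_cell g} = digit_set b n \<inter> unit_cell (0, 0)"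
  proof (intro set_eqI)
    fix z
    have "t + z \<in> digit_set b n \<longleftrightarrow> z \<in> digit_set b n"
      using digit_set_periodic[of z "fst g" "snd g" b n] by (simp add: t_def add.commute)
    moreover have "t + z \<in> unit_cell g \<longleftrightarrow> z \<in> unit_cell (0, 0)" by (auto simp: unit_cell_def t_def)
    ultimately show "z \<in> {z. t + 1 *\<^sub>R z \<in> digit_set b n \<inter> unit_cell g} \<longleftrightarrow> z \<in> digit_set b n \<inter> unit_cell (0, 0)"
      by simp
  qed
  finally show ?thesis by simp
qed

lemma null_lines: "emeasure lborel {z. Re z = x} = 0" "emeasure lborel {z. Im z = x} = 0"
proof -
  have "{z. Re z = x} = {z. z \<bullet> 1 = x}" "{z. Im z = x} = {z. z \<bullet> \<i> = x}"
    by (auto simp: inner_complex_def)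
  moreover have "negligible {z::complex. z \<bullet> 1 = x}" "negligible {z::complex. z \<bullet> \<i> = x}"
    by (rule negligible_standard_hyperplane, simp add: Basis_complex_def)+
  moreover have "closed {z. Re z = x}" "closed {z. Im z = x}"
    by (rule closed_halfspace_Re_eq closed_halfspace_Im_eq)+
  ultimately show "emeasure lborel {z. Re z = x} = 0" "emeasure lborel {z. Im z = x} = 0"
    by (auto simp: negligible_iff_null_sets null_sets_completion_iff null_sets_def borel_closed)
qed

text \<open>The proportion of the area that survives when one more digit is restricted.\<close>

definition digit_ratio :: "nat \<Rightarrow> real" where
  "digit_ratio b = (1 - 1 / real b)\<^sup>2"

text \<open>Scaling by \<open>b\<close> maps the part of the set in the unit cell onto a square of
  side \<open>b - 1\<close> intersected with the set of the previous stage, which consists of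
  \<open>(b - 1)\<^sup>2\<close> cells up to two segments.\<close>

lemma emeasure_digit_set:
  assumes b: "2 \<le> b"
  shows "emeasure lborel (digit_set b n \<inter> unit_cell g) = ennreal (digit_ratio b ^ n)"
proof (induction n arbitrary: g)
  case 0
  have "emeasure lborel (digit_set b 0 \<inter> unit_cell g) = emeasure lborel (unit_cell (0, 0))"
    using emeasure_unit_cell_shift[OF b, of 0 g] by simp
  also have "\<dots> = 1"
  proof (rule antisym)
    have "emeasure lborel (unit_cell (0, 0)) \<le> emeasure lborel (cbox 0 (Complex 1 1))"
      by (intro emeasure_mono) (auto simp: unit_cell_def in_cbox_complex_iff floor_eq_iff)
    also have "\<dots> = 1" by (subst emeasure_lborel_cbox) (auto simp: Basis_complex_def inner_complex_def)
    finally show "emeasure lborel (unit_cell (0, 0)) \<le> 1" .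
    have "1 = emeasure lborel (box 0 (Complex 1 1))"
      by (subst emeasure_lborel_box) (auto simp: Basis_complex_def inner_complex_def)
    also have "\<dots> \<le> emeasure lborel (unit_cell (0, 0))"
      by (intro emeasure_mono) (auto simp: unit_cell_def in_box_complex_iff floor_eq_iff)
    finally show "1 \<le> emeasure lborel (unit_cell (0, 0))" .
  qed
  finally show ?case by simp
next
  case (Suc n)
  define A where "A = digit_set b n \<inter> cbox 0 (Complex (real b - 1) (real b - 1))"
  define G where "G = {0..<int b - 1} \<times> {0..<int b - 1}"
  have pre: "digit_set b (Suc n) \<inter> unit_cell (0, 0) = {z. 0 + real b *\<^sub>R z \<in> A}"
  proof -
    have ld: "x \<in> low_digit b \<and> \<lfloor>x\<rfloor> = 0 \<longleftrightarrow> 0 \<le> real b * x \<and> real b * x \<le> real b - 1" for x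
    proof
      assume x: "x \<in> low_digit b \<and> \<lfloor>x\<rfloor> = 0"
      then have "0 \<le> x" "x < 1" by linarith+
      moreover from this have "x \<le> 1 - 1 / real b" using x b low_digit_unit_interval[of b x] by simp
      ultimately have "real b * x \<le> real b * (1 - 1 / real b)" "0 \<le> real b * x" by (auto intro: mult_left_mono)
      then show "0 \<le> real b * x \<and> real b * x \<le> real b - 1" using b by (simp add: right_diff_distrib)
    next
      assume x: "0 \<le> real b * x \<and> real b * x \<le> real b - 1"
      then have "0 \<le> x" using b by (simp add: zero_le_mult_iff)
      moreover have "x \<le> (real b - 1) / real b" using x b by (simp add: pos_le_divide_eq mult.commute)
      then have "x \<le> 1 - 1 / real b" using b by (simp add: diff_divide_distrib)
      moreover have "1 / real b > 0" using b by simp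
      then have "x < 1" using \<open>x \<le> 1 - 1 / real b\<close> by linarith
      ultimately show "x \<in> low_digit b \<and> \<lfloor>x\<rfloor> = 0"
        using b low_digit_unit_interval[of b x] by (simp add: floor_eq_iff)
    qed
    show ?thesis using ld[of "Re _"] ld[of "Im _"]
      by (auto simp: A_def unit_cell_def in_cbox_complex_iff)
  qed
  have sA: "A \<in> sets borel" using b by (simp add: A_def)
  have disj: "disjoint_family_on (\<lambda>g. digit_set b n \<inter> unit_cell g) G"
    by (auto simp: disjoint_family_on_def unit_cell_def prod_eq_iff)
  have inA: "(\<Union>g\<in>G. digit_set b n \<inter> unit_cell g) \<subseteq> A"
    by (auto simp: G_def A_def unit_cell_def in_cbox_complex_iff) linarith+
  have "A - (\<Union>g\<in>G. digit_set b n \<inter> unit_cell g) \<subseteq> {z. Re z = real b - 1} \<union> {z. Im z = real b - 1}"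
  proof
    fix z assume z: "z \<in> A - (\<Union>g\<in>G. digit_set b n \<inter> unit_cell g)"
    then have "(\<lfloor>Re z\<rfloor>, \<lfloor>Im z\<rfloor>) \<notin> G" by (auto simp: A_def unit_cell_def)
    then show "z \<in> {z. Re z = real b - 1} \<union> {z. Im z = real b - 1}"
      using z by (auto simp: A_def G_def in_cbox_complex_iff) linarith+
  qed
  then have "emeasure lborel (A - (\<Union>g\<in>G. digit_set b n \<inter> unit_cell g))
      \<le> emeasure lborel ({z. Re z = real b - 1} \<union> {z. Im z = real b - 1})"
    by (intro emeasure_mono) (auto simp: borel_closed closed_halfspace_Re_eq closed_halfspace_Im_eq)
  also have "\<dots> \<le> emeasure lborel {z. Re z = real b - 1} + emeasure lborel {z. Im z = real b - 1}"
    by (intro emeasure_subadditive) (auto simp: borel_closed closed_halfspace_Re_eq closed_halfspace_Im_eq)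
  also have "\<dots> = 0" by (simp add: null_lines)
  finally have null: "emeasure lborel (A - (\<Union>g\<in>G. digit_set b n \<inter> unit_cell g)) = 0" by simp
  have sU: "(\<Union>g\<in>G. digit_set b n \<inter> unit_cell g) \<in> sets borel" using b by (intro sets.finite_UN) (auto simp: G_def)
  have "emeasure lborel A = emeasure lborel (\<Union>g\<in>G. digit_set b n \<inter> unit_cell g)
     + emeasure lborel (A - (\<Union>g\<in>G. digit_set b n \<inter> unit_cell g))"
    using sA sU inA by (subst plus_emeasure) (auto simp: Un_absorb1)
  also have "\<dots> = (\<Sum>g\<in>G. emeasure lborel (digit_set b n \<inter> unit_cell g))"
    unfolding null using b disj by (subst sum_emeasure[symmetric]) (auto simp: G_def)
  also have "\<dots> = ennreal ((real b - 1)\<^sup>2 * digit_ratio b ^ n)"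
    using b by (simp add: Suc.IH G_def card_cartesian_product ennreal_of_nat_eq_real_of_nat ennreal_mult'[symmetric]
        power2_eq_square of_nat_diff nat_diff_distrib)
  finally have A: "emeasure lborel A = ennreal ((real b - 1)\<^sup>2 * digit_ratio b ^ n)" .
  have "(real b)\<^sup>2 * digit_ratio b = (real b - 1)\<^sup>2"
  proof -
    have "real b * (1 - 1 / real b) = real b - 1" using b by (simp add: right_diff_distrib)
    then show ?thesis by (simp add: digit_ratio_def power_mult_distrib[symmetric])
  qed
  then have "ennreal ((real b)\<^sup>2) * emeasure lborel (digit_set b (Suc n) \<inter> unit_cell (0, 0))
      = ennreal ((real b)\<^sup>2 * digit_ratio b ^ Suc n)"
    using emeasure_affine_preimage[of "real b" A 0] b sA A unfolding pre by (simp add: mult.assoc[symmetric])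
  also have "\<dots> = ennreal ((real b)\<^sup>2) * ennreal (digit_ratio b ^ Suc n)" by (simp add: ennreal_mult')
  finally have "emeasure lborel (digit_set b (Suc n) \<inter> unit_cell (0, 0)) = ennreal (digit_ratio b ^ Suc n)"
    using b by (subst (asm) ennreal_mult_cancel_left) auto
  then show ?case using emeasure_unit_cell_shift[OF b, of "Suc n" g] by simp
qed

text \<open>Scaling by \<open>b\<close> reduces \<open>i\<close> and \<open>n\<close>
  simultaneously. A square of side at most \<open>2\<close> meets at most nine cells, which starts
  the induction. The bound is, up to the factor \<open>digit_ratio b ^ n\<close>, a power of the
  side with the exponent \<open>2 * ln (b - 1) / ln b\<close>.\<close>

lemma emeasure_digit_set_square:
  assumes b: "2 \<le> b" and s: "0 \<le> s" "s \<le> 2 / real b ^ i"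
  shows "emeasure lborel (digit_set b n \<inter> cbox (Complex x y) (Complex (x + s) (y + s)))
    \<le> ennreal (9 * digit_ratio b ^ n / (real b - 1) ^ (2 * i))"
  using s
proof (induction i arbitrary: n x y s)
  case 0
  define G where "G = {\<lfloor>x\<rfloor>..\<lfloor>x\<rfloor> + 2} \<times> {\<lfloor>y\<rfloor>..\<lfloor>y\<rfloor> + 2}"
  have "digit_set b n \<inter> cbox (Complex x y) (Complex (x + s) (y + s)) \<subseteq> (\<Union>g\<in>G. digit_set b n \<inter> unit_cell g)"
  proof
    fix z assume z: "z \<in> digit_set b n \<inter> cbox (Complex x y) (Complex (x + s) (y + s))"
    then have "(\<lfloor>Re z\<rfloor>, \<lfloor>Im z\<rfloor>) \<in> G" using 0 by (auto simp: G_def in_cbox_complex_iff) linarith+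
    then show "z \<in> (\<Union>g\<in>G. digit_set b n \<inter> unit_cell g)"
      using z by (intro UN_I[of "(\<lfloor>Re z\<rfloor>, \<lfloor>Im z\<rfloor>)"]) (auto simp: unit_cell_def)
  qed
  then have "emeasure lborel (digit_set b n \<inter> cbox (Complex x y) (Complex (x + s) (y + s))) \<le>
      emeasure lborel (\<Union>g\<in>G. digit_set b n \<inter> unit_cell g)"
    using b by (intro emeasure_mono) (auto simp: G_def)
  also have "\<dots> \<le> (\<Sum>g\<in>G. emeasure lborel (digit_set b n \<inter> unit_cell g))"
    using b by (intro emeasure_subadditive_finite) (auto simp: G_def)
  also have "\<dots> = ennreal (9 * digit_ratio b ^ n)"
    using b by (simp add: emeasure_digit_set G_def card_cartesian_product ennreal_mult')
  finally show ?case by simp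
next
  case (Suc i)
  have b1: "1 \<le> real b - 1" using b by simp
  show ?case
  proof (cases n)
    case 0
    have "emeasure lborel (digit_set b n \<inter> cbox (Complex x y) (Complex (x + s) (y + s))) = ennreal (s\<^sup>2)"
      using Suc.prems unfolding 0
      by (simp, subst emeasure_lborel_cbox) (auto simp: Basis_complex_def inner_complex_def power2_eq_square)
    also have "\<dots> \<le> ennreal (9 * digit_ratio b ^ n / (real b - 1) ^ (2 * Suc i))"
    proof (rule ennreal_leI)
      have "s\<^sup>2 \<le> (2 / real b ^ Suc i)\<^sup>2" using Suc.prems by (intro power_mono) auto
      also have "\<dots> = 4 / (real b ^ (2 * Suc i))" 
          by (simp only: power_divide power_mult[symmetric] mult.commute[of "Suc i" 2]) simp
      also have "\<dots> \<le> 9 / (real b - 1) ^ (2 * Suc i)"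
        using b b1 by (intro frac_le power_mono) auto
      finally show "s\<^sup>2 \<le> 9 * digit_ratio b ^ n / (real b - 1) ^ (2 * Suc i)" by (simp add: 0)
    qed
    finally show ?thesis .
  next
    case n: (Suc m)
    define Q where "Q = digit_set b m \<inter> cbox (Complex (real b * x) (real b * y)) (Complex (real b * x + real b * s) (real b * y + real b * s))"
    have sub: "digit_set b n \<inter> cbox (Complex x y) (Complex (x + s) (y + s)) \<subseteq> {z. 0 + real b *\<^sub>R z \<in> Q}"
      by (auto simp: n Q_def in_cbox_complex_iff distrib_left[symmetric] mult_left_mono)
    have sQ: "Q \<in> sets borel" using b by (simp add: Q_def)
    have bs: "real b * s \<le> 2 / real b ^ i"
    proof -
      have "real b * s \<le> real b * (2 / real b ^ Suc i)" using Suc.prems by (intro mult_left_mono) auto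
      then show ?thesis using b by simp
    qed
    have "ennreal ((real b)\<^sup>2) * emeasure lborel (digit_set b n \<inter> cbox (Complex x y) (Complex (x + s) (y + s)))
      \<le> ennreal ((real b)\<^sup>2) * emeasure lborel {z. 0 + real b *\<^sub>R z \<in> Q}"
    proof (intro mult_left_mono emeasure_mono sub)
      have "(\<lambda>z. 0 + real b *\<^sub>R z) -` Q \<inter> space lborel \<in> sets lborel"
        using sQ by (intro measurable_sets[where A = borel]) auto
      then show "{z. 0 + real b *\<^sub>R z \<in> Q} \<in> sets lborel" by (simp add: vimage_def)
    qed auto
    also have "\<dots> = emeasure lborel Q" using b sQ by (intro emeasure_affine_preimage[symmetric]) auto
    also have "\<dots> \<le> ennreal (9 * digit_ratio b ^ m / (real b - 1) ^ (2 * i))"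
      unfolding Q_def using Suc.prems by (intro Suc.IH bs) simp
    also have "9 * digit_ratio b ^ m / (real b - 1) ^ (2 * i) =
        (real b)\<^sup>2 * (9 * digit_ratio b ^ n / (real b - 1) ^ (2 * Suc i))"
    proof -
      have "real b * (1 - 1 / real b) = real b - 1" using b by (simp add: right_diff_distrib)
      then have r: "(real b)\<^sup>2 * digit_ratio b = (real b - 1)\<^sup>2" by (simp add: digit_ratio_def power_mult_distrib[symmetric])
      have "(real b)\<^sup>2 * (9 * digit_ratio b ^ n / (real b - 1) ^ (2 * Suc i)) =
        9 * digit_ratio b ^ m * ((real b)\<^sup>2 * digit_ratio b) / ((real b - 1) ^ (2 * i) * (real b - 1)\<^sup>2)"
        by (simp add: n power_add power2_eq_square mult_ac)
      then show ?thesis unfolding r using b1 by simp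
    qed
    also have "ennreal ((real b)\<^sup>2 * (9 * digit_ratio b ^ n / (real b - 1) ^ (2 * Suc i))) =
        ennreal ((real b)\<^sup>2) * ennreal (9 * digit_ratio b ^ n / (real b - 1) ^ (2 * Suc i))"
      by (rule ennreal_mult') simp
    finally have "ennreal ((real b)\<^sup>2) * emeasure lborel (digit_set b n \<inter> cbox (Complex x y) (Complex (x + s) (y + s)))
      \<le> ennreal ((real b)\<^sup>2) * ennreal (9 * digit_ratio b ^ n / (real b - 1) ^ (2 * Suc i))" .
    then show ?thesis using b by (subst (asm) ennreal_mult_le_mult_iff) auto
  qed
qed

lemma digit_ratio_pos: "2 \<le> b \<Longrightarrow> 0 < digit_ratio b"
  by (simp add: digit_ratio_def)

text \<open>In every unit cell the area is at most \<open>digit_ratio b ^ n\<close> for all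
  \<open>n\<close>, and \<open>digit_ratio b < 1\<close>.\<close>

lemma null_digit_limit:
  assumes b: "2 \<le> b"
  shows "emeasure lborel (\<Inter>n. digit_set b n) = 0"
proof -
  define D where "D = (\<Inter>n. digit_set b n)"
  have sD: "D \<in> sets borel" unfolding D_def using b by (intro sets.countable_INT) auto
  have r: "0 \<le> digit_ratio b" "digit_ratio b < 1"
  proof -
    have "0 < 1 / real b" "1 / real b \<le> 1" using b by auto
    then have "0 \<le> 1 - 1 / real b" "1 - 1 / real b < 1" by linarith+
    then show "digit_ratio b < 1" by (simp add: digit_ratio_def power_less_one_iff)
  qed (simp add: digit_ratio_def)
  have cell: "emeasure lborel (D \<inter> unit_cell g) = 0" for g
  proof -
    have "emeasure lborel (D \<inter> unit_cell g) \<le> ennreal (digit_ratio b ^ n)" for n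
    proof -
      have "emeasure lborel (D \<inter> unit_cell g) \<le> emeasure lborel (digit_set b n \<inter> unit_cell g)"
        using b by (intro emeasure_mono) (auto simp: D_def)
      then show ?thesis using b by (simp add: emeasure_digit_set)
    qed
    moreover have "(\<lambda>n. ennreal (digit_ratio b ^ n)) \<longlonglongrightarrow> ennreal 0"
      using r by (intro tendsto_ennrealI LIMSEQ_power_zero) auto
    ultimately have "emeasure lborel (D \<inter> unit_cell g) \<le> ennreal 0" by (meson LIMSEQ_le_const)
    then show ?thesis by simp
  qed
  have "D = (\<Union>g. D \<inter> unit_cell g)" by (auto simp: unit_cell_def)
  moreover have "(\<Union>g. D \<inter> unit_cell g) \<in> null_sets lborel"
    using cell sD by (intro null_sets_UN') (auto simp: null_sets_def)
  ultimately show ?thesis unfolding D_def by (simp add: null_sets_def)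
qed

text \<open>By Fubini's theorem the integral over \<open>x\<close> of the area of the intersection
  is the integral over \<open>z \<in> E\<close> of the area of the set of admissible shifts, and
  these sets have area at least \<open>digit_ratio b ^ n\<close>. The shifts range over a square of
  area \<open>4\<close>; the bound claimed for some shift is half of the average that this gives.\<close>

lemma exists_shift_with_large_intersection:
  assumes b: "2 \<le> b" and E: "compact E" and v: "0 < v" "emeasure lborel E = ennreal v"
  shows "\<exists>x\<in>cbox (Complex (-1) (-1)) (Complex 1 1).
    ennreal (digit_ratio b ^ n * v / 8) \<le> emeasure lborel (E \<inter> {z. z - x \<in> digit_set b n})"
proof (rule ccontr)
  define X where "X = cbox (Complex (-1) (-1)) (Complex 1 1)"
  define r where "r = digit_ratio b ^ n"
  have r: "0 < r" using digit_ratio_pos[OF b] by (simp add: r_def)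
  assume "\<not> ?thesis"
  then have small: "emeasure lborel (E \<inter> {z. z - x \<in> digit_set b n}) \<le> ennreal (r * v / 8)" if "x \<in> X" for x
    using that unfolding X_def r_def by (meson not_le less_imp_le)
  \<comment> \<open>Pairs of a shift and a point of the shifted intersection, to which Fubini's theorem is applied.\<close>
  define S where "S = {p. fst p \<in> X \<and> snd p \<in> E \<and> snd p - fst p \<in> digit_set b n}"
  have "closed S"
  proof -
    have "closed (fst -` X :: (complex \<times> complex) set)" "closed (snd -` E :: (complex \<times> complex) set)"
      using E by (auto intro!: closed_vimage continuous_intros simp: X_def compact_imp_closed)
    moreover have "closed ((\<lambda>p. snd p - fst p) -` digit_set b n :: (complex \<times> complex) set)"
      using b by (intro closed_vimage continuous_intros closed_digit_set)
    ultimately have "closed (fst -` X \<inter> snd -` E \<inter> (\<lambda>p. snd p - fst p) -` digit_set b n)" by (intro closed_Int)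
    then show ?thesis by (simp add: S_def vimage_def Int_def conj_assoc)
  qed
  then have "S \<in> sets borel" by (rule borel_closed)
  then have S: "S \<in> sets (lborel \<Otimes>\<^sub>M lborel)" unfolding lborel_prod by simp
  have "(\<integral>\<^sup>+x. emeasure lborel (Pair x -` S) \<partial>lborel) \<le> (\<integral>\<^sup>+x. ennreal (r * v / 8) * indicator X x \<partial>lborel)"
  proof (rule nn_integral_mono)
    fix x
    show "emeasure lborel (Pair x -` S) \<le> ennreal (r * v / 8) * indicator X x"
    proof (cases "x \<in> X")
      case True
      then have "Pair x -` S = E \<inter> {z. z - x \<in> digit_set b n}" by (auto simp: S_def)
      then show ?thesis using small[OF True] True by simp
    next
      case False
      then have "Pair x -` S = {}" by (auto simp: S_def)
      then show ?thesis by simp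
    qed
  qed
  also have "\<dots> = ennreal (r * v / 8) * emeasure lborel X" by (simp add: X_def nn_integral_cmult_indicator)
  also have "emeasure lborel X = ennreal 4" unfolding X_def
    by (subst emeasure_lborel_cbox) (auto simp: Basis_complex_def inner_complex_def)
  also have "ennreal (r * v / 8) * ennreal 4 = ennreal (r * v / 2)"
    using r v by (simp add: ennreal_mult'[symmetric] del: ennreal_numeral)
  finally have up: "(\<integral>\<^sup>+x. emeasure lborel (Pair x -` S) \<partial>lborel) \<le> ennreal (r * v / 2)" .
  have "ennreal (r * v) = ennreal r * emeasure lborel E" using r v by (simp add: ennreal_mult')
  also have "\<dots> = (\<integral>\<^sup>+z. ennreal r * indicator E z \<partial>lborel)"
    using E by (simp add: nn_integral_cmult_indicator borel_compact)
  also have "\<dots> \<le> (\<integral>\<^sup>+z. emeasure lborel ((\<lambda>x. (x, z)) -` S) \<partial>lborel)"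
  proof (rule nn_integral_mono)
    fix z
    show "ennreal r * indicator E z \<le> emeasure lborel ((\<lambda>x. (x, z)) -` S)"
    proof (cases "z \<in> E")
      case True
      define g where "g = (\<lfloor>Re z\<rfloor>, \<lfloor>Im z\<rfloor>)"
      \<comment> \<open>The cell of \<open>z\<close> lies in \<open>z - X\<close>, because \<open>X\<close> contains all shifts with coordinates of modulus at most \<open>1\<close>.\<close>
      define A where "A = digit_set b n \<inter> unit_cell g"
      have A: "A \<in> sets borel" using b by (simp add: A_def)
      have "ennreal r = emeasure lborel A" using b by (simp add: A_def r_def emeasure_digit_set)
      also have "\<dots> = ennreal ((-1)\<^sup>2) * emeasure lborel {x. z + (-1) *\<^sub>R x \<in> A}"
        by (rule emeasure_affine_preimage[OF _ A]) simp
      also have "\<dots> = emeasure lborel {x. z + (-1) *\<^sub>R x \<in> A}" by simp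
      also have "\<dots> \<le> emeasure lborel ((\<lambda>x. (x, z)) -` S)"
      proof (rule emeasure_mono)
        show "{x. z + (-1) *\<^sub>R x \<in> A} \<subseteq> (\<lambda>x. (x, z)) -` S"
        proof
          fix x assume "x \<in> {x. z + (-1) *\<^sub>R x \<in> A}"
          then have x: "z - x \<in> digit_set b n" "\<lfloor>Re (z - x)\<rfloor> = \<lfloor>Re z\<rfloor>" "\<lfloor>Im (z - x)\<rfloor> = \<lfloor>Im z\<rfloor>"
            by (auto simp: A_def unit_cell_def g_def)
          then have "- 1 \<le> Re x" "Re x \<le> 1" "- 1 \<le> Im x" "Im x \<le> 1" by simp_all linarith+
          then show "x \<in> (\<lambda>x. (x, z)) -` S" using x True by (simp add: S_def X_def in_cbox_complex_iff)
        qed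
        show "(\<lambda>x. (x, z)) -` S \<in> sets lborel" using S by (rule sets_Pair2)
      qed
      finally show ?thesis using True by simp
    qed simp
  qed
  also have "\<dots> = emeasure (lborel \<Otimes>\<^sub>M lborel) S" by (rule lborel_pair.emeasure_pair_measure_alt2[OF S, symmetric])
  also have "\<dots> = (\<integral>\<^sup>+x. emeasure lborel (Pair x -` S) \<partial>lborel)" by (rule lborel.emeasure_pair_measure_alt[OF S])
  also note up
  finally have "r * v \<le> r * v / 2" using r v by (subst (asm) ennreal_le_iff) auto
  moreover have "0 < r * v" using r v by simp
  ultimately show False by linarith
qed

text \<open>With base \<open>b = 2 ^ p\<close> the dimension of the limit set is \<open>2 * ln (b -
  1) / ln b\<close>, which tends to \<open>2\<close>; the inequality says that it is at least
  \<open>t\<close>.\<close>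

lemma dyadic_base:
  assumes t: "0 < t" "t < 2"
  shows "\<exists>p::nat. 0 < p \<and> 2 powr (real p * t) \<le> (real (2 ^ p) - 1)\<^sup>2"
proof -
  obtain p0 :: nat where p0: "1 / (2 - t) \<le> real p0" using real_arch_simple by blast
  define p where "p = max 2 p0"
  have "1 / (2 - t) \<le> real p" using p0 by (simp add: p_def)
  then have pt: "1 \<le> real p * (2 - t)" using t by (simp add: pos_divide_le_eq)
  have "(2::nat) ^ 2 \<le> 2 ^ p" by (rule power_increasing) (auto simp: p_def)
  then have "real 4 \<le> real (2 ^ p)" by (simp only: of_nat_le_iff) simp
  then have b4: "4 \<le> (2::real) ^ p" by simp
  have "2 powr (real p * t) \<le> 2 powr (2 * real p - 1)"
    using pt by (intro powr_mono) (auto simp: algebra_simps)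
  also have "\<dots> = 2 powr real (p * 2) / 2" by (simp add: powr_diff mult.commute)
  also have "2 powr real (p * 2) = (2::real) ^ (p * 2)" by (rule powr_realpow) simp
  also have "(2::real) ^ (p * 2) = (2 ^ p)\<^sup>2" by (rule power_mult)
  also have "(2 ^ p)\<^sup>2 / 2 \<le> ((2::real) ^ p - 1)\<^sup>2"
  proof -
    have "4 * (2::real) ^ p \<le> 2 ^ p * 2 ^ p" using b4 by (intro mult_right_mono) auto
    moreover have "((2::real) ^ p - 1)\<^sup>2 = 2 ^ p * 2 ^ p - 2 * 2 ^ p + 1" by (simp add: power2_eq_square algebra_simps)
    moreover have "((2::real) ^ p)\<^sup>2 = 2 ^ p * 2 ^ p" by (simp add: power2_eq_square)
    ultimately show ?thesis by linarith
  qed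
  finally show ?thesis by (intro exI[of _ p]) (simp add: p_def)
qed

text \<open>A dyadic square of generation \<open>j\<close> has side at most \<open>2 / b ^ i\<close>
  for \<open>i = j div p\<close>. Rounding \<open>j / p\<close> down costs the factor \<open>2 powr
  (p * t)\<close>.\<close>

lemma digit_set_dyadic_square_bound:
  assumes t: "0 < t" and p: "0 < p" "2 powr (real p * t) \<le> (real (2 ^ p) - 1)\<^sup>2"
  defines "b \<equiv> 2 ^ p"
  shows "emeasure lborel (dyadic_square q \<inter> {z. z - x \<in> digit_set b n}) \<le>
    ennreal (9 * 2 powr (real p * t) * digit_ratio b ^ n) * dyadic_weight t q"
proof -
  have "(2::nat) ^ 1 \<le> 2 ^ p" using p by (intro power_increasing) auto
  then have b: "2 \<le> b" by (simp add: b_def)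
  define j where "j = fst q"
  define i where "i = j div p"
  define h :: real where "h = 1 / 2 ^ j"
  define u v where "u = (of_int (fst (snd q)) - 1) * h - Re x" and "v = (of_int (snd (snd q)) - 1) * h - Im x"
  have h: "h > 0" by (simp add: h_def)
  have side: "2 * h \<le> 2 / real b ^ i"
  proof -
    have "real b ^ i = 2 ^ (p * i)" by (simp add: b_def power_mult)
    also have "\<dots> \<le> 2 ^ j" by (intro power_increasing) (auto simp: i_def)
    finally have "2 / 2 ^ j \<le> 2 / real b ^ i" using b by (intro divide_left_mono) auto
    then show ?thesis by (simp add: h_def)
  qed
  define Q where "Q = digit_set b n \<inter> cbox (Complex u v) (Complex (u + 2 * h) (v + 2 * h))"
  have Qs: "Q \<in> sets borel" using b by (simp add: Q_def)
  have sub: "dyadic_square q \<inter> {z. z - x \<in> digit_set b n} \<subseteq> {z. - x + 1 *\<^sub>R z \<in> Q}"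
  proof
    fix z assume z: "z \<in> dyadic_square q \<inter> {z. z - x \<in> digit_set b n}"
    have near: "(of_int a - 1) * h \<le> s \<and> s \<le> (of_int a - 1) * h + 2 * h" if "\<bar>s * 2 ^ j - of_int a\<bar> < 1" for s and a :: int
    proof -
      have "of_int a - 1 \<le> s * 2 ^ j" "s * 2 ^ j \<le> of_int a + 1" using that by auto
      then have "(of_int a - 1) * h \<le> s * 2 ^ j * h" "s * 2 ^ j * h \<le> (of_int a + 1) * h"
        using h by (auto intro: mult_right_mono)
      moreover have "s * 2 ^ j * h = s" by (simp add: h_def)
      moreover have "(of_int a + 1) * h = (of_int a - 1) * h + 2 * h" by (simp add: algebra_simps)
      ultimately show ?thesis by simp
    qed
    have "\<bar>Re z * 2 ^ j - of_int (fst (snd q))\<bar> < 1" "\<bar>Im z * 2 ^ j - of_int (snd (snd q))\<bar> < 1"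
      using z by (auto simp: dyadic_square_def j_def)
    then have "z - x \<in> cbox (Complex u v) (Complex (u + 2 * h) (v + 2 * h))"
      using near[of "Re z" "fst (snd q)"] near[of "Im z" "snd (snd q)"]
      by (auto simp: in_cbox_complex_iff u_def v_def)
    then show "z \<in> {z. - x + 1 *\<^sub>R z \<in> Q}" using z by (simp add: Q_def)
  qed
  have "emeasure lborel (dyadic_square q \<inter> {z. z - x \<in> digit_set b n}) \<le> emeasure lborel {z. - x + 1 *\<^sub>R z \<in> Q}"
  proof (rule emeasure_mono[OF sub])
    have "(\<lambda>z. - x + 1 *\<^sub>R z) -` Q \<inter> space lborel \<in> sets lborel"
      using Qs by (intro measurable_sets[where A = borel]) auto
    then show "{z. - x + 1 *\<^sub>R z \<in> Q} \<in> sets lborel" by (simp add: vimage_def)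
  qed
  also have "\<dots> = emeasure lborel Q" using emeasure_affine_preimage[of 1 Q "- x"] Qs by simp
  also have "\<dots> \<le> ennreal (9 * digit_ratio b ^ n / (real b - 1) ^ (2 * i))"
    unfolding Q_def using b h side by (intro emeasure_digit_set_square) auto
  also have "\<dots> \<le> ennreal (9 * 2 powr (real p * t) * digit_ratio b ^ n * h powr t)"
  proof (rule ennreal_leI)
    have "2 powr (real j * t) \<le> 2 powr (real p * t) * 2 powr (real (p * i) * t)"
    proof -
      have "j mod p < p" using p by simp
      moreover have "j = p * i + j mod p" by (simp add: i_def)
      ultimately have "j \<le> p + p * i" by linarith
      then have "real j \<le> real p + real (p * i)" by (simp only: of_nat_add[symmetric] of_nat_le_iff)
      then have "real j * t \<le> (real p + real (p * i)) * t" using t by (intro mult_right_mono) auto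
      then show ?thesis by (simp add: powr_add[symmetric] distrib_right)
    qed
    also have "2 powr (real (p * i) * t) = (2 powr (real p * t)) ^ i" by (simp add: powr_power mult_ac)
    also have "\<dots> \<le> ((real b - 1)\<^sup>2) ^ i" using p by (intro power_mono) (auto simp: b_def)
    also have "\<dots> = (real b - 1) ^ (2 * i)" by (simp add: power_mult)
    finally have *: "2 powr (real j * t) \<le> 2 powr (real p * t) * (real b - 1) ^ (2 * i)" by simp
    have ht: "h powr t = 1 / 2 powr (real j * t)"
      by (simp add: h_def powr_divide powr_realpow[symmetric] powr_powr)
    have pos: "0 < (real b - 1) ^ (2 * i)" using b by simp
    have "1 / (real b - 1) ^ (2 * i) \<le> 2 powr (real p * t) * h powr t"
      unfolding ht using * pos by (simp add: field_simps)
    then have "9 * digit_ratio b ^ n * (1 / (real b - 1) ^ (2 * i)) \<le> 9 * digit_ratio b ^ n * (2 powr (real p * t) * h powr t)"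
      by (intro mult_left_mono) (auto simp: digit_ratio_def)
    then show "9 * digit_ratio b ^ n / (real b - 1) ^ (2 * i) \<le> 9 * 2 powr (real p * t) * digit_ratio b ^ n * h powr t"
      by (simp add: mult_ac)
  qed
  also have "\<dots> = ennreal (9 * 2 powr (real p * t) * digit_ratio b ^ n) * dyadic_weight t q"
    by (simp add: ennreal_mult'' dyadic_weight_def h_def j_def)
  finally show ?thesis .
qed

text \<open>For every \<open>n\<close> a translate of \<open>digit_set b n\<close> meets
  \<open>E\<close> in a set whose area, divided by \<open>digit_ratio b ^ n\<close>, is bounded
  below; by the mass distribution principle its content is bounded below independently of
  \<open>n\<close>. The translations lie in a compact set. Along a convergent subsequence the
  intersections eventually enter every neighbourhood of the limit set \<open>K\<close>, which
  therefore has content.\<close>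

lemma null_subset_of_positive_content:
  assumes E: "compact E" "emeasure lborel E \<noteq> 0" and t: "0 < t" "t < 2"
  shows "\<exists>K\<subseteq>E. compact K \<and> emeasure lborel K = 0 \<and> weighted_content t K \<noteq> 0"
proof -
  obtain p :: nat where p: "0 < p" "2 powr (real p * t) \<le> (real (2 ^ p) - 1)\<^sup>2" using dyadic_base[OF t] by blast
  define b :: nat where "b = 2 ^ p"
  have "(2::nat) ^ 1 \<le> 2 ^ p" using p by (intro power_increasing) auto
  then have b: "2 \<le> b" by (simp add: b_def)
  have "emeasure lborel E < \<infinity>" using E(1) by (rule emeasure_compact_finite)
  then obtain v where v: "0 < v" "emeasure lborel E = ennreal v"
    using E(2) by (cases "emeasure lborel E") (auto simp: less_le)
  define X where "X = cbox (Complex (-1) (-1)) (Complex 1 1)"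
  obtain x where x: "\<And>n. x n \<in> X"
    "\<And>n. ennreal (digit_ratio b ^ n * v / 8) \<le> emeasure lborel (E \<inter> {z. z - x n \<in> digit_set b n})"
    using exists_shift_with_large_intersection[OF b E(1) v] unfolding X_def by metis
  define A where "A n = E \<inter> {z. z - x n \<in> digit_set b n}" for n
  have cl: "closed {z. z - y \<in> digit_set b n}" for y n
  proof -
    have "closed ((\<lambda>z. z - y) -` digit_set b n)" using b by (intro closed_vimage continuous_intros closed_digit_set)
    then show ?thesis by (simp add: vimage_def)
  qed
  have r: "0 < digit_ratio b" using b by (rule digit_ratio_pos)
  define v' where "v' = v / (8 * (9 * 2 powr (real p * t)))"
  have v': "v' > 0" using v by (simp add: v'_def)
  have WA: "ennreal v' \<le> weighted_content t (A n)" for n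
  proof (rule weighted_content_ge_measure)
    show "0 < 9 * 2 powr (real p * t) * digit_ratio b ^ n" using r by simp
    have "closed (A n)" unfolding A_def using cl compact_imp_closed[OF E(1)] by (intro closed_Int)
    then show A: "A n \<in> sets lborel" by (simp add: borel_closed)
    then show dA: "dyadic_square q \<inter> A n \<in> sets lborel" for q using open_dyadic_square by simp
    show "emeasure lborel (dyadic_square q \<inter> A n) \<le> ennreal (9 * 2 powr (real p * t) * digit_ratio b ^ n) * dyadic_weight t q" for q
    proof -
      have "emeasure lborel (dyadic_square q \<inter> A n) \<le> emeasure lborel (dyadic_square q \<inter> {z. z - x n \<in> digit_set b n})"
        using cl open_dyadic_square by (intro emeasure_mono) (auto simp: A_def borel_closed)
      also have "\<dots> \<le> ennreal (9 * 2 powr (real p * t) * digit_ratio b ^ n) * dyadic_weight t q"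
        unfolding b_def by (rule digit_set_dyadic_square_bound[OF t(1) p])
      finally show ?thesis .
    qed
    have "9 * 2 powr (real p * t) * digit_ratio b ^ n * v' = digit_ratio b ^ n * v / 8" by (simp add: v'_def)
    then show "ennreal (9 * 2 powr (real p * t) * digit_ratio b ^ n * v') \<le> emeasure lborel (A n)"
      unfolding A_def using x(2)[of n] by (simp only:)
  qed
  obtain y s where y: "y \<in> X" and s: "strict_mono s" "(x \<circ> s) \<longlonglongrightarrow> y"
    using x(1) compact_cbox[of "Complex (-1) (-1)" "Complex 1 1"] unfolding X_def compact_def by meson
  define D where "D = (\<Inter>n. digit_set b n)"
  define K where "K = E \<inter> (\<Inter>n. {z. z - y \<in> digit_set b n})"
  have "compact K" unfolding K_def using E cl by (intro compact_Int_closed closed_INT) auto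
  moreover have "emeasure lborel K = 0"
  proof -
    have sD: "D \<in> sets borel" unfolding D_def using b by (intro sets.countable_INT) auto
    have "emeasure lborel {z. - y + 1 *\<^sub>R z \<in> D} = 0"
      using emeasure_affine_preimage[of 1 D "- y"] sD null_digit_limit[OF b] by (simp add: D_def)
    moreover have "{z. - y + 1 *\<^sub>R z \<in> D} \<in> sets lborel"
    proof -
      have "(\<lambda>z. - y + 1 *\<^sub>R z) -` D \<inter> space lborel \<in> sets lborel"
        using sD by (intro measurable_sets[where A = borel]) auto
      then show ?thesis by (simp add: vimage_def)
    qed
    ultimately have "emeasure lborel K \<le> 0"
      using emeasure_mono[of K "{z. - y + 1 *\<^sub>R z \<in> D}" lborel] by (auto simp: K_def D_def)
    then show ?thesis by simp
  qed
  moreover have "ennreal v' \<le> weighted_content t K"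
  proof (rule weighted_content_outer_regular)
    fix V assume V: "open V" "K \<subseteq> V"
    have "\<exists>n. A n \<subseteq> V"
    proof (rule ccontr)
      assume "\<not> ?thesis"
      then have "\<forall>n. \<exists>z. z \<in> A n \<and> z \<notin> V" by blast
      then obtain z where z: "\<And>n. z n \<in> A n" "\<And>n. z n \<notin> V" by metis
      have "compact (E - V)" using E V by (simp add: compact_diff)
      moreover have "\<forall>n. (z \<circ> s) n \<in> E - V" using z by (auto simp: A_def)
      ultimately obtain w r where w: "w \<in> E - V" and r: "strict_mono r" "((z \<circ> s) \<circ> r) \<longlonglongrightarrow> w"
        unfolding compact_def by meson
      have "w - y \<in> digit_set b k" for k
      proof (rule closed_sequentially[OF closed_digit_set[OF b]])
        define f where "f n = z (s (r (n + k))) - x (s (r (n + k)))" for n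
        have "((x \<circ> s) \<circ> r) \<longlonglongrightarrow> y" by (rule LIMSEQ_subseq_LIMSEQ[OF s(2) r(1)])
        then have "(\<lambda>n. z (s (r n)) - x (s (r n))) \<longlonglongrightarrow> w - y"
          using r(2) by (intro tendsto_diff) (simp_all add: o_def)
        then show "f \<longlonglongrightarrow> w - y" unfolding f_def by (rule LIMSEQ_ignore_initial_segment)
        show "f n \<in> digit_set b k" for n
        proof -
          have "k \<le> n + k" by simp
          also have "n + k \<le> r (n + k)" using r(1) by (rule strict_mono_imp_increasing)
          also have "\<dots> \<le> s (r (n + k))" using s(1) by (rule strict_mono_imp_increasing)
          finally have "digit_set b (s (r (n + k))) \<subseteq> digit_set b k" by (rule digit_set_antimono)
          then show ?thesis using z(1)[of "s (r (n + k))"] by (auto simp: f_def A_def)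
        qed
      qed
      then have "w \<in> K" using w by (simp add: K_def)
      then show False using V w by blast
    qed
    then obtain n where "A n \<subseteq> V" by blast
    then show "ennreal v' \<le> weighted_content t V" using WA[of n] weighted_content_mono[of "A n" V t] by (meson order_trans)
  qed
  then have "weighted_content t K \<noteq> 0" using v' by auto
  ultimately show ?thesis unfolding K_def by blast
qed

section \<open>Removable subsets of planar compact sets\<close>

text \<open>A bounded set is covered by \<open>O(4 ^ j)\<close> dyadic squares of generation
  \<open>j\<close>.\<close>

lemma hausdorff_null_above_2:
  assumes E: "bounded (E :: complex set)" and s: "2 < s"
  shows "hausdorff_measure s E = 0"
proof -
  define u where "u = (2 + s) / 2"
  have u: "2 < u" "u < s" using s by (auto simp: u_def)
  obtain N0 where N0: "\<And>z. z \<in> E \<Longrightarrow> cmod z \<le> N0" using E by (auto simp: bounded_iff)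
  obtain N :: nat where "N0 \<le> real N" using real_arch_simple by blast
  then have N: "cmod z \<le> real N" if "z \<in> E" for z using N0[OF that] by simp
  define C where "C = (2 * real N + 3)\<^sup>2"
  have bound: "weighted_content u E \<le> ennreal (C * (1 / 2 powr (u - 2)) ^ j)" for j :: nat
  proof -
    define I where "I = {- int (N * 2 ^ j) - 1..int (N * 2 ^ j) + 1}"
    define J where "J = {j} \<times> (I \<times> I)"
    define c :: "dindex \<Rightarrow> ennreal" where "c = indicator J"
    have "weighted_content u E \<le> cover_cost u c"
    proof (rule weighted_content_le)
      fix z assume z: "z \<in> E"
      define q where "q = (j, \<lfloor>Re z * 2 ^ j\<rfloor>, \<lfloor>Im z * 2 ^ j\<rfloor>)"
      have fl: "\<lfloor>x * 2 ^ j\<rfloor> \<in> I" if "\<bar>x\<bar> \<le> real N" for x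
      proof -
        have "\<bar>x * 2 ^ j\<bar> \<le> real (N * 2 ^ j)" using that by (simp add: abs_mult mult_right_mono)
        moreover have "\<lfloor>y\<rfloor> \<in> {- int m - 1..int m + 1}" if "\<bar>y\<bar> \<le> real m" for y :: real and m
        proof -
          have "- int m - 1 \<le> \<lfloor>y\<rfloor>" "\<lfloor>y\<rfloor> \<le> int m + 1" using that by linarith+
          then show ?thesis by simp
        qed
        ultimately show ?thesis unfolding I_def by blast
      qed
      have "\<bar>Re z\<bar> \<le> real N" "\<bar>Im z\<bar> \<le> real N"
        using N[OF z] abs_Re_le_cmod[of z] abs_Im_le_cmod[of z] by linarith+
      then have qJ: "q \<in> J" by (simp add: q_def J_def fl)
      have "z \<in> dyadic_square q" by (simp add: dyadic_square_def q_def) linarith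
      then have "1 = (\<integral>\<^sup>+p. indicator {q} p \<partial>count_space UNIV)" by simp
      also have "\<dots> \<le> coverage c z" unfolding coverage_def
        using qJ \<open>z \<in> dyadic_square q\<close> by (intro nn_integral_mono) (auto simp: c_def split: split_indicator)
      finally show "1 \<le> coverage c z" .
    qed
    also have "cover_cost u c = (\<integral>\<^sup>+q. ennreal ((1 / 2 ^ j) powr u) * indicator J q \<partial>count_space UNIV)"
      unfolding cover_cost_def
      by (intro nn_integral_cong) (auto simp: c_def dyadic_weight_def J_def split: split_indicator)
    also have "\<dots> = ennreal ((1 / 2 ^ j) powr u) * of_nat (card J)"
      by (simp add: nn_integral_cmult_indicator J_def I_def)
    also have "\<dots> = ennreal ((1 / 2 ^ j) powr u * real (card J))"
      by (simp add: ennreal_mult'' ennreal_of_nat_eq_real_of_nat)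
    also have "\<dots> \<le> ennreal (C * (1 / 2 powr (u - 2)) ^ j)"
    proof (rule ennreal_leI)
      have "real (card J) = (2 * (real N * 2 ^ j) + 3)\<^sup>2"
        by (simp add: J_def I_def card_cartesian_product power2_eq_square algebra_simps)
      also have "\<dots> \<le> ((2 * real N + 3) * 2 ^ j)\<^sup>2"
        by (intro power_mono) (simp_all add: distrib_right)
      also have "\<dots> = C * (2 ^ j)\<^sup>2" by (simp add: C_def power_mult_distrib)
      finally have J: "real (card J) \<le> C * (2 ^ j)\<^sup>2" .
      have pj: "(2::real) ^ j = 2 powr real j" by (simp add: powr_realpow)
      have "(1 / 2 ^ j) powr u * (2 ^ j)\<^sup>2 = (1 / 2 powr (u - 2)) ^ j"
      proof -
        have "(1 / 2 ^ j) powr u = 2 powr (- (real j * u))"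
          unfolding pj by (simp add: powr_divide powr_powr powr_minus_divide)
        moreover have "((2::real) ^ j)\<^sup>2 = 2 powr (2 * real j)"
        proof -
          have "((2::real) ^ j)\<^sup>2 = 2 ^ (j * 2)" by (rule power_mult[symmetric])
          also have "\<dots> = 2 powr real (j * 2)" by (rule powr_realpow[symmetric]) simp
          finally show ?thesis by (simp add: mult.commute)
        qed
        moreover have "(1 / 2 powr (u - 2)) ^ j = 2 powr (- (u - 2) * real j)"
          by (simp only: powr_minus_divide[symmetric] powr_power mult.commute[of "real j"])
        moreover have "- (real j * u) + 2 * real j = - (u - 2) * real j" by (simp add: algebra_simps)
        ultimately show ?thesis by (simp only: powr_add[symmetric])
      qed
      then have "(1 / 2 ^ j) powr u * (C * (2 ^ j)\<^sup>2) = C * (1 / 2 powr (u - 2)) ^ j" by (metis mult.left_commute)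
      moreover have "(1 / 2 ^ j) powr u * real (card J) \<le> (1 / 2 ^ j) powr u * (C * (2 ^ j)\<^sup>2)"
        using J by (intro mult_left_mono) auto
      ultimately show "(1 / 2 ^ j) powr u * real (card J) \<le> C * (1 / 2 powr (u - 2)) ^ j" by (simp only:)
    qed
    finally show ?thesis .
  qed
  have "1 < 2 powr (u - 2)" using u by (intro gr_one_powr) auto
  then have "(\<lambda>j. ennreal (C * (1 / 2 powr (u - 2)) ^ j)) \<longlonglongrightarrow> ennreal (C * 0)"
    by (intro tendsto_ennrealI tendsto_intros LIMSEQ_power_zero) auto
  then have "weighted_content u E \<le> ennreal (C * 0)" using bound by (meson LIMSEQ_le_const)
  then have "weighted_content u E = 0" by simp
  then show ?thesis using u by (intro hausdorff_null_if_weighted_content_zero[of u]) auto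
qed

text \<open>Passing from measure to weighted content costs some exponent, hence \<open>t <
  s\<close>. The way back, after the strips are removed, costs none.\<close>

lemma removable_subset_of_nonnull:
  assumes E: "compact E" and t: "0 < t" "t < s" and H: "hausdorff_measure s E \<noteq> 0"
  shows "\<exists>K\<subseteq>E. compact K \<and> loc_removable K \<and> hausdorff_measure t K \<noteq> 0"
proof -
  have "\<exists>E0\<subseteq>E. compact E0 \<and> emeasure lborel E0 = 0 \<and> weighted_content t E0 \<noteq> 0"
  proof (cases "emeasure lborel E = 0")
    case True
    then show ?thesis using E H hausdorff_null_if_weighted_content_zero[OF t] by blast
  next
    case False
    have "s \<le> 2" using H hausdorff_null_above_2[OF compact_imp_bounded[OF E], of s] by linarith
    then show ?thesis using null_subset_of_positive_content[OF E False] t by auto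
  qed
  then obtain E0 where E0: "E0 \<subseteq> E" "compact E0" "emeasure lborel E0 = 0" "weighted_content t E0 \<noteq> 0" by blast
  obtain v where v: "0 < v" "ennreal v \<le> weighted_content t E0"
  proof (cases "weighted_content t E0")
    case (real r)
    then show ?thesis using that[of r] E0(4) by (auto simp: less_le)
  next
    case top
    then show ?thesis using that[of 1] by simp
  qed
  obtain K where K: "K \<subseteq> E0" "compact K" "grid_thin K" "ennreal (v / 2) \<le> weighted_content t K"
    using grid_thin_subset_of_null_set[OF E0(2,3) v] by blast
  have "hausdorff_measure t K \<noteq> 0"
    using weighted_content_zero_if_hausdorff_null[OF t(1), of K] K(4) v by auto
  then show ?thesis
    using K E0 loc_removable_if_grid_thin[OF compact_imp_closed[OF K(2)] K(3)] by blast
qed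

lemma loc_removable_empty [simp]: "loc_removable {}"
  by (simp add: loc_removable_def)

text \<open>Remove the singularities along \<open>L\<close> first, in the open set \<open>U -
  K\<close>.\<close>

lemma loc_removable_Un:
  assumes "closed K" "loc_removable K" "loc_removable L"
  shows "loc_removable (K \<union> L)"
  unfolding loc_removable_def
proof (intro allI impI)
  fix U f assume U: "open U" "continuous_on U f" "inj_on f U" "f holomorphic_on U - (K \<union> L)"
  have "U - (K \<union> L) = (U - K) - L" by blast
  then have "f holomorphic_on (U - K) - L" using U(4) by simp
  moreover have "open (U - K)" "continuous_on (U - K) f" "inj_on f (U - K)"
    using U assms(1) by (auto intro: continuous_on_subset inj_on_subset)
  ultimately have "f holomorphic_on U - K" using assms(3) unfolding loc_removable_def by blast
  then show "f holomorphic_on U" using assms(2) U unfolding loc_removable_def by blast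
qed

lemma loc_removable_UN:
  assumes "finite I" "\<And>i. i \<in> I \<Longrightarrow> closed (K i)" "\<And>i. i \<in> I \<Longrightarrow> loc_removable (K i)"
  shows "loc_removable (\<Union>i\<in>I. K i)"
  using assms by (induction I) (auto intro: loc_removable_Un)

lemma shrinking_union_locally_finite:
  assumes K: "\<And>k::nat. K k \<subseteq> cball p (1 / 2 ^ k)" and z: "z \<noteq> p"
  shows "\<exists>N. ball z (dist z p / 2) \<inter> insert p (\<Union>k. K k) \<subseteq> (\<Union>k<N. K k)"
proof -
  define r where "r = dist z p / 2"
  have r: "r > 0" using z by (simp add: r_def)
  obtain N where N: "(1 / 2) ^ N < r" using real_arch_pow_inv[of r "1/2"] r by auto
  have "w \<in> (\<Union>k<N. K k)" if w: "w \<in> ball z r" "w \<in> insert p (\<Union>k. K k)" for w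
  proof -
    have d: "r < dist w p"
      using w(1) dist_triangle[of z p w] by (simp add: r_def dist_commute)
    then have "w \<noteq> p" using r by auto
    then obtain k where k: "w \<in> K k" using w by blast
    have "k < N"
    proof (rule ccontr)
      assume "\<not> k < N"
      then have "(1 / 2) ^ k \<le> (1 / 2 :: real) ^ N" by (intro power_decreasing) auto
      moreover have "dist w p \<le> (1 / 2) ^ k" using subsetD[OF K k] by (simp add: dist_commute power_divide)
      ultimately show False using d N by linarith
    qed
    then show ?thesis using k by blast
  qed
  then show ?thesis unfolding r_def by blast
qed

lemma compact_shrinking_union:
  fixes K :: "nat \<Rightarrow> complex set"
  assumes K: "\<And>k. K k \<subseteq> cball p (1 / 2 ^ k)" "\<And>k. compact (K k)"
  shows "compact (insert p (\<Union>k. K k))"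
proof -
  have "insert p (\<Union>k. K k) \<subseteq> cball p 1"
  proof -
    have "cball p (1 / 2 ^ k) \<subseteq> cball p 1" for k by (intro subset_cball) simp
    then show ?thesis using K(1) by auto
  qed
  then have "bounded (insert p (\<Union>k. K k))" using bounded_cball bounded_subset by blast
  moreover have "open (- insert p (\<Union>k. K k))"
  proof (subst open_subopen, intro ballI)
    fix z assume z: "z \<in> - insert p (\<Union>k. K k)"
    then have zp: "z \<noteq> p" by auto
    obtain N where N: "ball z (dist z p / 2) \<inter> insert p (\<Union>k. K k) \<subseteq> (\<Union>k<N. K k)"
      using shrinking_union_locally_finite[OF K(1) zp] by blast
    have "closed (\<Union>k<N. K k)" using K(2) by (intro closed_UN) (auto simp: compact_imp_closed)
    then have "open (ball z (dist z p / 2) - (\<Union>k<N. K k))" by (simp add: open_Diff)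
    moreover have "z \<in> ball z (dist z p / 2) - (\<Union>k<N. K k)" using z zp by auto
    moreover have "ball z (dist z p / 2) - (\<Union>k<N. K k) \<subseteq> - insert p (\<Union>k. K k)" using N by blast
    ultimately show "\<exists>T. open T \<and> z \<in> T \<and> T \<subseteq> - insert p (\<Union>k. K k)" by blast
  qed
  ultimately show ?thesis by (simp add: compact_eq_bounded_closed closed_def)
qed

text \<open>Away from \<open>p\<close> the union is locally finite, and the continuous function
  \<open>f\<close> has no isolated singularity at \<open>p\<close>.\<close>

lemma loc_removable_shrinking_union:
  fixes K :: "nat \<Rightarrow> complex set"
  assumes K: "\<And>k. K k \<subseteq> cball p (1 / 2 ^ k)" "\<And>k. compact (K k)" "\<And>k. loc_removable (K k)"
  shows "loc_removable (insert p (\<Union>k. K k))"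
  unfolding loc_removable_def
proof (intro allI impI)
  fix U f assume U: "open U" "continuous_on U f" "inj_on f U" "f holomorphic_on U - insert p (\<Union>k. K k)"
  have "f holomorphic_on U - {p}"
  proof -
    have "f field_differentiable at z" if z: "z \<in> U" "z \<noteq> p" for z
    proof -
      define V where "V = U \<inter> ball z (dist z p / 2)"
      obtain N where N: "ball z (dist z p / 2) \<inter> insert p (\<Union>k. K k) \<subseteq> (\<Union>k<N. K k)"
        using shrinking_union_locally_finite[OF K(1) z(2)] by blast
      have "loc_removable (\<Union>k<N. K k)" using K by (intro loc_removable_UN) (auto simp: compact_imp_closed)
      moreover have "open V" "continuous_on V f" "inj_on f V"
        using U by (auto simp: V_def intro: continuous_on_subset inj_on_subset)
      moreover have "V - (\<Union>k<N. K k) \<subseteq> U - insert p (\<Union>k. K k)" using N unfolding V_def by blast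
      then have "f holomorphic_on V - (\<Union>k<N. K k)" using U(4) holomorphic_on_subset by blast
      ultimately have "f holomorphic_on V" unfolding loc_removable_def by blast
      moreover have "z \<in> V" using z by (simp add: V_def)
      ultimately show ?thesis using \<open>open V\<close> holomorphic_on_imp_differentiable_at by blast
    qed
    moreover have "open (U - {p})" using U(1) by (simp add: open_Diff)
    ultimately show ?thesis by (simp add: holomorphic_on_open field_differentiable_def)
  qed
  then show "f holomorphic_on U" using U no_isolated_singularity[of U f "{p}"] by simp
qed

text \<open>Otherwise finitely many balls cover \<open>E\<close> in each of which \<open>E\<close>
  is null for some exponent below the dimension of \<open>E\<close>; then \<open>E\<close> is null
  for the largest of these exponents.\<close>

lemma point_of_full_dimension:
  fixes E :: "'a::metric_space set"
  assumes E: "compact E" "E \<noteq> {}"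
  shows "\<exists>p\<in>E. \<forall>r>0. \<forall>t>0. (\<exists>s>t. hausdorff_measure s E \<noteq> 0) \<longrightarrow> hausdorff_measure t (E \<inter> cball p r) \<noteq> 0"
proof (rule ccontr)
  assume "\<not> ?thesis"
  then have "\<forall>p\<in>E. \<exists>r t. 0 < r \<and> 0 < t \<and> (\<exists>s>t. hausdorff_measure s E \<noteq> 0) \<and> hausdorff_measure t (E \<inter> cball p r) = 0" by blast
  then obtain r t where rt: "\<And>p. p \<in> E \<Longrightarrow> 0 < r p" "\<And>p. p \<in> E \<Longrightarrow> 0 < t p"
    "\<And>p. p \<in> E \<Longrightarrow> \<exists>s>t p. hausdorff_measure s E \<noteq> 0"
    "\<And>p. p \<in> E \<Longrightarrow> hausdorff_measure (t p) (E \<inter> cball p (r p)) = (0::ennreal)" by metis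
  have "E \<subseteq> (\<Union>p\<in>E. ball p (r p))" using rt(1) by force
  then obtain D where D: "D \<subseteq> E" "finite D" "E \<subseteq> (\<Union>p\<in>D. ball p (r p))"
    using compactE_image[OF E(1), of E "\<lambda>p. ball p (r p)"] by (metis open_ball)
  have D0: "D \<noteq> {}" using D E by auto
  define u where "u = Max (t ` D)"
  have uin: "u \<in> t ` D" unfolding u_def using D D0 by (intro Max_in) auto
  have ule: "t p \<le> u" if "p \<in> D" for p unfolding u_def using D that by (intro Max_ge) auto
  have u0: "0 < u" using uin rt(2) D by auto
  have "hausdorff_measure u (\<Union>((\<lambda>p. E \<inter> cball p (r p)) ` D)) = 0"
  proof (rule hausdorff_null_countable_Union[OF u0])
    show "countable ((\<lambda>p. E \<inter> cball p (r p)) ` D)" using D by (simp add: countable_finite)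
    fix B assume "B \<in> (\<lambda>p. E \<inter> cball p (r p)) ` D"
    then obtain p where p: "p \<in> D" "B = E \<inter> cball p (r p)" by blast
    then show "hausdorff_measure u B = 0"
      using rt(2)[of p] rt(4)[of p] ule[of p] D hausdorff_null_exponent[of "t p" u] by auto
  qed
  moreover have "E \<subseteq> \<Union>((\<lambda>p. E \<inter> cball p (r p)) ` D)" using D(3) by force
  ultimately have "hausdorff_measure u E = 0" using hausdorff_null_subset u0 by blast
  moreover obtain x where "x \<in> E" "u = t x" using uin D(1) by blast
  then obtain s where "s > u" "hausdorff_measure s E \<noteq> 0" using rt(3) by blast
  ultimately show False using hausdorff_null_exponent[of u s E] u0 by auto
qed

text \<open>The \<open>k\<close>-th disc around the point of full dimension is used for the
  \<open>k\<close>-th rational exponent. Every exponent below the dimension of \<open>E\<close> is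
  smaller than some such rational, and one set of nonzero measure suffices.\<close>

lemma planar_removable_subset_of_full_dimension:
  assumes E: "compact (E :: complex set)"
  shows "\<exists>K\<subseteq>E. compact K \<and> loc_removable K \<and>
    (\<forall>t s. 0 < t \<longrightarrow> t < s \<longrightarrow> hausdorff_measure s E \<noteq> 0 \<longrightarrow> hausdorff_measure t K \<noteq> 0)"
proof (cases "E = {}")
  case True
  then show ?thesis by (intro exI[of _ "{}"]) auto
next
  case False
  obtain p where p: "p \<in> E" "\<And>r t s. 0 < r \<Longrightarrow> 0 < t \<Longrightarrow> t < s \<Longrightarrow> hausdorff_measure s E \<noteq> 0 \<Longrightarrow>
      hausdorff_measure t (E \<inter> cball p r) \<noteq> 0"
    using point_of_full_dimension[OF E False] by metis
  define R where "R k = E \<inter> cball p (1 / 2 ^ k)" for k :: nat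
  have cR: "compact (R k)" for k unfolding R_def using E by (intro compact_Int) auto
  define q :: "nat \<Rightarrow> real" where "q = from_nat_into \<rat>"
  define good where "good k K \<longleftrightarrow> K \<subseteq> R k \<and> compact K \<and> loc_removable K \<and>
     ((\<exists>s>q k. 0 < q k \<and> hausdorff_measure s (R k) \<noteq> 0) \<longrightarrow> hausdorff_measure (q k) K \<noteq> 0)" for k K
  have "\<exists>K. good k K" for k
  proof (cases "\<exists>s>q k. 0 < q k \<and> hausdorff_measure s (R k) \<noteq> 0")
    case True
    then show ?thesis using removable_subset_of_nonnull[OF cR] unfolding good_def by blast
  next
    case False
    then show ?thesis unfolding good_def by (intro exI[of _ "{}"]) auto
  qed
  then obtain K where K: "\<And>k. good k (K k)" by metis
  have KR: "K k \<subseteq> cball p (1 / 2 ^ k)" "compact (K k)" "loc_removable (K k)" "K k \<subseteq> E" for k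
    using K[of k] by (auto simp: good_def R_def)
  define L where "L = insert p (\<Union>k. K k)"
  have "compact L" unfolding L_def by (rule compact_shrinking_union[OF KR(1,2)])
  moreover have "loc_removable L" unfolding L_def by (rule loc_removable_shrinking_union[OF KR(1,2,3)])
  moreover have "L \<subseteq> E" using KR(4) p(1) by (auto simp: L_def)
  moreover have "hausdorff_measure t L \<noteq> 0" if t: "0 < t" "t < s" and H: "hausdorff_measure s E \<noteq> 0" for t s
  proof -
    obtain x where x: "x \<in> \<rat>" "t < x" "x < s" using Rats_dense_in_real[OF t(2)] by blast
    have "range q = \<rat>" unfolding q_def using Rats_0 by (intro range_from_nat_into) (auto intro: countable_rat)
    then obtain k where k: "q k = x" using x(1) by (metis imageE)
    define y where "y = (x + s) / 2"
    have y: "x < y" "y < s" "0 < y" using x t by (auto simp: y_def)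
    have "hausdorff_measure y (R k) \<noteq> 0" unfolding R_def using p(2) y H by simp
    then have "hausdorff_measure x (K k) \<noteq> 0"
      using K[of k] y(1) x(2) t(1) k unfolding good_def by auto
    then have "hausdorff_measure t (K k) \<noteq> 0" using hausdorff_null_exponent[of t x "K k"] t x by auto
    then show ?thesis using hausdorff_null_subset[of t L "K k"] t by (auto simp: L_def)
  qed
  ultimately show ?thesis by blast
qed

section \<open>Charts of the Riemann sphere\<close>

text \<open>Both points lie on the unit sphere, so the squared chordal distance is \<open>2\<close>
  minus twice their inner product.\<close>

lemma dist_Fin: "(dist (Fin z) (Fin w))\<^sup>2 = 4 * (dist z w)\<^sup>2 / (((cmod z)\<^sup>2 + 1) * ((cmod w)\<^sup>2 + 1))"
proof -
  have pos: "(cmod z)\<^sup>2 + 1 > 0" for z using zero_le_power2[of "cmod z"] by linarith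
  have n: "(norm (stereo p))\<^sup>2 = 1" for p
  proof -
    have "stereo p \<in> sphere 0 1" using range_stereo by blast
    then show ?thesis by simp
  qed
  have "(dist (Fin z) (Fin w))\<^sup>2 = (norm (stereo (Fin z)))\<^sup>2 + (norm (stereo (Fin w)))\<^sup>2 - 2 * inner (stereo (Fin z)) (stereo (Fin w))"
    by (simp add: dist_riemann_sphere_def dist_norm power2_norm_eq_inner inner_diff_left inner_diff_right inner_commute del: stereo.simps)
  also have "\<dots> = 2 - 2 * inner (stereo (Fin z)) (stereo (Fin w))" by (simp only: n)
  also have "inner (stereo (Fin z)) (stereo (Fin w)) =
     (4 * inner z w + ((cmod z)\<^sup>2 - 1) * ((cmod w)\<^sup>2 - 1)) / (((cmod z)\<^sup>2 + 1) * ((cmod w)\<^sup>2 + 1))"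
    using pos[of z] pos[of w] by (simp add: inner_prod_def add_divide_distrib)
  also have "2 - 2 * \<dots> = 4 * ((cmod z)\<^sup>2 + (cmod w)\<^sup>2 - 2 * inner z w) / (((cmod z)\<^sup>2 + 1) * ((cmod w)\<^sup>2 + 1))"
  proof -
    have "((cmod z)\<^sup>2 + 1) * ((cmod w)\<^sup>2 + 1) \<noteq> 0" using pos[of z] pos[of w] by simp
    then show ?thesis by (simp add: field_simps)
  qed
  also have "(cmod z)\<^sup>2 + (cmod w)\<^sup>2 - 2 * inner z w = (dist z w)\<^sup>2"
    by (simp add: dist_norm power2_norm_eq_inner inner_diff_left inner_diff_right inner_commute)
  finally show ?thesis .
qed

lemma dist_Fin_le: "dist (Fin z) (Fin w) \<le> 2 * dist z w"
proof (rule power2_le_imp_le)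
  have "1 * 1 \<le> ((cmod z)\<^sup>2 + 1) * ((cmod w)\<^sup>2 + 1)" by (intro mult_mono) auto
  then have "4 * (dist z w)\<^sup>2 / (((cmod z)\<^sup>2 + 1) * ((cmod w)\<^sup>2 + 1)) \<le> 4 * (dist z w)\<^sup>2 / 1"
    by (intro divide_left_mono) auto
  then show "(dist (Fin z) (Fin w))\<^sup>2 \<le> (2 * dist z w)\<^sup>2" by (simp add: dist_Fin power_mult_distrib)
qed simp

lemma dist_Fin_ge:
  assumes "cmod z \<le> 1" "cmod w \<le> 1" shows "dist z w \<le> dist (Fin z) (Fin w)"
proof (rule power2_le_imp_le)
  have "(cmod z)\<^sup>2 \<le> 1" "(cmod w)\<^sup>2 \<le> 1" using assms by (auto intro: power_le_one)
  then have "((cmod z)\<^sup>2 + 1) * ((cmod w)\<^sup>2 + 1) \<le> 2 * 2" by (intro mult_mono) auto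
  moreover have "0 < ((cmod z)\<^sup>2 + 1) * ((cmod w)\<^sup>2 + 1)"
    by (intro mult_pos_pos add_nonneg_pos) auto
  ultimately have "4 * (dist z w)\<^sup>2 / 4 \<le> 4 * (dist z w)\<^sup>2 / (((cmod z)\<^sup>2 + 1) * ((cmod w)\<^sup>2 + 1))"
    by (intro divide_left_mono) auto
  then show "(dist z w)\<^sup>2 \<le> (dist (Fin z) (Fin w))\<^sup>2" by (simp add: dist_Fin)
qed simp

text \<open>In stereographic coordinates \<open>rs_inv\<close> is a half-turn of the sphere.\<close>

lemma stereo_rs_inv: "stereo (rs_inv p) = (cnj (fst (stereo p)), - snd (stereo p))"
proof (cases p)
  case (Fin z)
  show ?thesis
  proof (cases "z = 0")
    case False
    define a where "a = (cmod z)\<^sup>2"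
    have a: "a > 0" using False by (simp add: a_def)
    have z1: "1 / z = (1 / a) *\<^sub>R cnj z"
    proof -
      have "z * cnj z = of_real a" unfolding a_def by (rule complex_norm_square[symmetric])
      then have "1 / z = cnj z / of_real a" using False by (metis complex_cnj_zero_iff nonzero_divide_mult_cancel_right)
      then show ?thesis by (simp add: scaleR_conv_of_real)
    qed
    have m: "(cmod (1 / z))\<^sup>2 = 1 / a" by (simp add: a_def norm_divide power_divide)
    have "(2 / ((cmod (1 / z))\<^sup>2 + 1)) *\<^sub>R (1 / z) = (2 / (a + 1)) *\<^sub>R cnj z"
    proof -
      have "2 / (1 / a + 1) * (1 / a) = 2 / (a + 1)" using a by (simp add: field_simps)
      then show ?thesis unfolding m unfolding z1 scaleR_scaleR by (simp only:)
    qed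
    moreover have "((cmod (1 / z))\<^sup>2 - 1) / ((cmod (1 / z))\<^sup>2 + 1) = - ((a - 1) / (a + 1))"
    proof -
      have "1 / a - 1 = (1 - a) / a" "1 / a + 1 = (1 + a) / a" using a by (simp_all add: field_simps)
      then have "(1 / a - 1) / (1 / a + 1) = (1 - a) / (1 + a)" using a by simp
      then show ?thesis unfolding m by (simp add: minus_divide_left add.commute)
    qed
    ultimately show ?thesis using False Fin by (simp add: a_def)
  qed (simp add: Fin)
qed simp

lemma dist_rs_inv [simp]: "dist (rs_inv p) (rs_inv q) = dist p q"
proof -
  have d1: "dist (cnj a) (cnj b) = dist a b" for a b
    by (metis complex_cnj_diff complex_mod_cnj dist_norm)
  have d2: "dist (- x) (- y) = dist x y" for x y :: real
    unfolding dist_real_def by linarith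
  show ?thesis
    by (simp only: dist_riemann_sphere_def stereo_rs_inv dist_prod_def fst_conv snd_conv d1 d2)
qed

lemma rs_inv_rs_inv [simp]: "rs_inv (rs_inv p) = p"
  by (cases p) auto

lemma continuous_on_Fin: "continuous_on S Fin"
proof -
  have "continuous_on UNIV Fin"
    unfolding continuous_on_iff
  proof (intro ballI allI impI)
    fix z :: complex and e :: real assume e: "0 < e"
    show "\<exists>d>0. \<forall>w\<in>UNIV. dist w z < d \<longrightarrow> dist (Fin w) (Fin z) < e"
    proof (intro exI[of _ "e / 2"] conjI ballI impI)
      fix w assume "dist w z < e / 2"
      then show "dist (Fin w) (Fin z) < e" using dist_Fin_le[of w z] by simp
    qed (use e in simp)
  qed
  then show ?thesis by (rule continuous_on_subset) simp
qed

lemma continuous_on_rs_inv: "continuous_on S rs_inv"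
  unfolding continuous_on_iff by auto

lemma continuous_on_rs_coord: "continuous_on (- {Infty}) rs_coord"
proof -
  have st: "continuous_on S stereo" for S
    unfolding continuous_on_iff by (auto simp: dist_riemann_sphere_def)
  have n1: "snd (stereo p) \<noteq> 1" if "p \<noteq> Infty" for p
    using that inj_stereo
    by (cases p) (auto simp: stereo_Fin_snd add_nonneg_eq_0_iff simp del: stereo.simps(1))
  have eq: "rs_coord p = (1 / (1 - snd (stereo p))) *\<^sub>R fst (stereo p)" if pI: "p \<noteq> Infty" for p
  proof -
    obtain z where z: "p = Fin z" using pI by (cases p) auto
    define a where "a = (cmod z)\<^sup>2 + 1"
    have a: "a > 0" unfolding a_def using zero_le_power2[of "cmod z"] by linarith
    have st: "fst (stereo p) = (2 / a) *\<^sub>R z" "1 - snd (stereo p) = 2 / a"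
      unfolding z stereo_Fin_snd by (simp_all add: a_def)
    have "rs_coord p = z" by (simp add: z)
    then show ?thesis unfolding st using a by simp
  qed
  have "continuous_on (- {Infty}) (\<lambda>p. (1 / (1 - snd (stereo p))) *\<^sub>R fst (stereo p))"
    by (intro continuous_intros st) (use n1 in auto)
  then show ?thesis by (rule continuous_on_cong[THEN iffD1, rotated -1]) (auto simp: eq)
qed

lemma inverse_set_closed:
  assumes K: "compact K" shows "closed {z. z \<noteq> 0 \<and> inverse z \<in> (K :: complex set)}"
proof -
  obtain r where r: "\<And>w. w \<in> K \<Longrightarrow> cmod w \<le> r" using compact_imp_bounded[OF K] by (auto simp: bounded_iff)
  define T where "T = {z. 1 \<le> r * cmod z}"
  have T: "closed T" unfolding T_def by (intro closed_Collect_le continuous_intros)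
  have "0 \<notin> T" by (simp add: T_def)
  then have "continuous_on T inverse" by (intro continuous_intros) auto
  then have "closed (T \<inter> inverse -` K)"
    using T compact_imp_closed[OF K] by (rule continuous_closed_preimage)
  moreover have "T \<inter> inverse -` K = {z. z \<noteq> 0 \<and> inverse z \<in> K}"
  proof (intro set_eqI iffI)
    fix z assume z: "z \<in> {z. z \<noteq> 0 \<and> inverse z \<in> K}"
    then have "inverse (cmod z) \<le> r" using r[of "inverse z"] by (simp add: norm_inverse)
    then have "1 \<le> r * cmod z" using z by (simp add: field_simps)
    then show "z \<in> T \<inter> inverse -` K" using z by (simp add: T_def)
  qed (use \<open>0 \<notin> T\<close> in auto)
  ultimately show ?thesis by simp
qed

text \<open>Away from \<open>0\<close> the inversion reduces the claim to \<open>K\<close>. Since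
  \<open>K\<close> is bounded, the inverted set keeps a distance from \<open>0\<close>, where
  \<open>f\<close> is holomorphic by assumption.\<close>

lemma loc_removable_inverse:
  assumes K: "compact K" "loc_removable K"
  shows "loc_removable {z. z \<noteq> 0 \<and> inverse z \<in> K}"
  unfolding loc_removable_def
proof (intro allI impI)
  define S where "S = {z. z \<noteq> 0 \<and> inverse z \<in> K}"
  fix U f assume U: "open U" "continuous_on U f" "inj_on f U" "f holomorphic_on U - {z. z \<noteq> 0 \<and> inverse z \<in> K}"
  note hol = U(4)[folded S_def]
  have oU: "open (U - {0})" using U by (simp add: open_Diff)
  define W where "W = {w. w \<noteq> 0 \<and> inverse w \<in> U}"
  have "W = inverse ` (U - {0})"
  proof (intro set_eqI iffI)
    fix w assume "w \<in> W"
    then show "w \<in> inverse ` (U - {0})" by (intro image_eqI[of _ _ "inverse w"]) (auto simp: W_def)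
  qed (auto simp: W_def)
  have oW: "open W"
  proof -
    have "open ((- {0}) \<inter> inverse -` U)"
      using U(1) by (intro continuous_open_preimage continuous_intros) auto
    moreover have "(- {0}) \<inter> inverse -` U = W" by (auto simp: W_def)
    ultimately show ?thesis by simp
  qed
  define g where "g = f \<circ> inverse"
  have invW: "inverse ` W \<subseteq> U" by (auto simp: W_def)
  have "continuous_on W g" unfolding g_def
    by (rule continuous_on_compose) (auto simp: W_def intro!: continuous_intros continuous_on_subset[OF U(2)])
  moreover have "inj_on g W" unfolding g_def
    by (rule comp_inj_on) (use U(3) invW in \<open>auto simp: inj_on_def subset_iff\<close>)
  moreover have "g holomorphic_on W - K" unfolding g_def
  proof (rule holomorphic_on_compose_gen[of _ _ _ "U - S"])
    show "inverse holomorphic_on W - K" by (auto intro!: holomorphic_intros simp: W_def)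
    show "inverse ` (W - K) \<subseteq> U - S" by (auto simp: W_def S_def)
  qed (rule hol)
  ultimately have gW: "g holomorphic_on W" using K(2) oW unfolding loc_removable_def by blast
  have "g \<circ> inverse holomorphic_on U - {0}"
  proof (rule holomorphic_on_compose_gen[OF _ gW])
    show "inverse holomorphic_on U - {0}" by (auto intro!: holomorphic_intros)
    show "inverse ` (U - {0}) \<subseteq> W" by (auto simp: W_def)
  qed
  moreover have "g \<circ> inverse = f" by (simp add: g_def fun_eq_iff)
  ultimately have "f holomorphic_on U - {0}" by simp
  moreover have "open (U - S)" using U(1) inverse_set_closed[OF K(1)] by (simp add: open_Diff S_def)
  ultimately have "f holomorphic_on (U - {0}) \<union> (U - S)"
    using hol oU by (intro holomorphic_on_Un) auto
  moreover have "(U - {0}) \<union> (U - S) = U" by (auto simp: S_def)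
  ultimately show "f holomorphic_on U" by simp
qed

text \<open>Each coordinate expression of \<open>f\<close> is continuous and injective where it is
  defined, and holomorphic off the preimage of \<open>A\<close> in the source chart.\<close>

lemma homeomorphism_conformal_if_chart_removable:
  assumes f: "homeomorphism UNIV UNIV f g" "rs_conformal_on f (- A)"
    and A: "\<And>\<alpha>. \<alpha> \<in> {id, rs_inv} \<Longrightarrow> loc_removable {z. \<alpha> (Fin z) \<in> A}"
  shows "rs_conformal_on f UNIV"
proof -
  have cf: "continuous_on UNIV f" and inj: "inj f"
    using f(1) by (auto simp: homeomorphism_def intro: inj_on_inverseI)
  have "(\<lambda>z. rs_coord (\<beta> (f (\<alpha> (Fin z))))) holomorphic_on {z. \<alpha> (Fin z) \<in> UNIV \<and> \<beta> (f (\<alpha> (Fin z))) \<noteq> Infty}"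
    if ab: "\<alpha> \<in> {id, rs_inv}" "\<beta> \<in> {id, rs_inv}" for \<alpha> \<beta>
  proof -
    define F where "F z = \<beta> (f (\<alpha> (Fin z)))" for z
    define V where "V = {z. F z \<noteq> Infty}"
    have ca: "continuous_on S \<gamma>" "inj \<gamma>" if "\<gamma> \<in> {id, rs_inv}" for \<gamma> S
    proof -
      have "\<gamma> = id \<or> \<gamma> = rs_inv" using that by blast
      then show "continuous_on S \<gamma>" by (auto simp: continuous_on_rs_inv id_def)
      have "inj rs_inv" by (rule inj_on_inverseI[of _ rs_inv]) simp
      then show "inj \<gamma>" using \<open>\<gamma> = id \<or> \<gamma> = rs_inv\<close> by auto
    qed
    have c1: "continuous_on UNIV (\<lambda>z. \<alpha> (Fin z))"
      by (rule continuous_on_compose2[OF ca(1)[OF ab(1)] continuous_on_Fin]) (rule subset_UNIV)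
    have "continuous_on UNIV (\<lambda>z. f (\<alpha> (Fin z)))"
      by (rule continuous_on_compose2[OF cf c1]) (rule subset_UNIV)
    then have cF: "continuous_on UNIV F"
      unfolding F_def[abs_def] by (rule continuous_on_compose2[OF ca(1)[OF ab(2)]]) (rule subset_UNIV)
    have injF: "inj F"
    proof (rule injI)
      fix z w assume "F z = F w"
      then have "f (\<alpha> (Fin z)) = f (\<alpha> (Fin w))" unfolding F_def by (rule injD[OF ca(2)[OF ab(2)]])
      then have "\<alpha> (Fin z) = \<alpha> (Fin w)" by (rule injD[OF inj])
      then have "Fin z = Fin w" by (rule injD[OF ca(2)[OF ab(1)]])
      then show "z = w" by simp
    qed
    have "open (F -` (- {Infty}))" using cF by (intro open_vimage) auto
    then have oV: "open V" by (simp add: V_def vimage_def Compl_eq)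
    define h where "h z = rs_coord (F z)" for z
    have "continuous_on V (rs_coord \<circ> F)"
    proof (rule continuous_on_compose)
      show "continuous_on V F" using cF continuous_on_subset by blast
      show "continuous_on (F ` V) rs_coord"
        by (rule continuous_on_subset[OF continuous_on_rs_coord]) (auto simp: V_def)
    qed
    then have ch: "continuous_on V h" by (simp add: h_def[abs_def] o_def)
    have "inj_on h V"
    proof (rule inj_onI)
      fix z w assume zw: "z \<in> V" "w \<in> V" "h z = h w"
      then have "F z = F w" unfolding V_def h_def by (cases "F z"; cases "F w") auto
      then show "z = w" using injF by (auto dest: injD)
    qed
    moreover have "h holomorphic_on V - {z. \<alpha> (Fin z) \<in> A}"
    proof -
      have "h holomorphic_on {z. \<alpha> (Fin z) \<in> - A \<and> \<beta> (f (\<alpha> (Fin z))) \<noteq> Infty}"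
        using f(2) ab unfolding rs_conformal_on_def rs_holomorphic_on_def h_def[abs_def] F_def by blast
      moreover have "{z. \<alpha> (Fin z) \<in> - A \<and> \<beta> (f (\<alpha> (Fin z))) \<noteq> Infty} = V - {z. \<alpha> (Fin z) \<in> A}"
        by (auto simp: V_def F_def)
      ultimately show ?thesis by simp
    qed
    ultimately have "h holomorphic_on V" using A[OF ab(1)] oV ch unfolding loc_removable_def by blast
    then show ?thesis by (simp add: h_def[abs_def] V_def F_def)
  qed
  then show ?thesis using cf inj unfolding rs_conformal_on_def rs_holomorphic_on_def by blast
qed

section \<open>Removable subsets of full dimension on the sphere\<close>

lemma covered_by_two_discs: "\<exists>z\<in>cball 0 1. p = Fin z \<or> p = rs_inv (Fin z)"
proof (cases p)
  case (Fin w)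
  show ?thesis
  proof (cases "cmod w \<le> 1")
    case False
    then have w: "w \<noteq> 0" by auto
    then have "p = rs_inv (Fin (1 / w))" using Fin by simp
    moreover have "1 / w \<in> cball 0 1" using False by (simp add: norm_divide divide_simps)
    ultimately show ?thesis by blast
  qed (use Fin in auto)
next
  case Infty
  then have "p = rs_inv (Fin 0)" by simp
  then show ?thesis by force
qed

text \<open>On the closed unit disc, \<open>Fin\<close> increases distances at most by the factor
  \<open>2\<close> and does not decrease them.\<close>

lemma hausdorff_null_chart_iff:
  assumes t: "0 < t" and K: "K \<subseteq> cball 0 1" and \<gamma>: "\<gamma> \<in> {id, rs_inv}"
  shows "hausdorff_measure t ((\<lambda>z. \<gamma> (Fin z)) ` K) = 0 \<longleftrightarrow> hausdorff_measure t K = 0"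
proof
  have iso: "dist (\<gamma> p) (\<gamma> q) = dist p q" and inv: "\<gamma> (\<gamma> p) = p" for p q using \<gamma> by auto
  show "hausdorff_measure t ((\<lambda>z. \<gamma> (Fin z)) ` K) = 0" if "hausdorff_measure t K = 0"
    by (rule hausdorff_null_lipschitz_image[OF t _ _ that, of 2]) (simp_all add: iso dist_Fin_le)
  assume null: "hausdorff_measure t ((\<lambda>z. \<gamma> (Fin z)) ` K) = 0"
  have "hausdorff_measure t ((\<lambda>p. rs_coord (\<gamma> p)) ` (\<lambda>z. \<gamma> (Fin z)) ` K) = 0"
  proof (rule hausdorff_null_lipschitz_image[OF t _ _ null, of 1])
    fix p q assume "p \<in> (\<lambda>z. \<gamma> (Fin z)) ` K" "q \<in> (\<lambda>z. \<gamma> (Fin z)) ` K"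
    then obtain z w where zw: "z \<in> K" "w \<in> K" "p = \<gamma> (Fin z)" "q = \<gamma> (Fin w)" by blast
    then have "cmod z \<le> 1" "cmod w \<le> 1" using K by auto
    then show "dist (rs_coord (\<gamma> p)) (rs_coord (\<gamma> q)) \<le> 1 * dist p q"
      by (simp add: zw inv iso dist_Fin_ge)
  qed simp
  then show "hausdorff_measure t K = 0" by (simp add: image_image inv)
qed

theorem theorem1p2:
  fixes E :: "riemann_sphere set"
  assumes "compact E"
  shows "\<exists>E'. compact E' \<and> E' \<subseteq> E \<and> conformally_removable E' \<and>
           hausdorff_dim E' = hausdorff_dim E"
proof -
  have closedE: "closed E" using assms by (rule compact_imp_closed)
  define F where "F \<gamma> = cball 0 1 \<inter> (\<lambda>z. \<gamma> (Fin z)) -` E" for \<gamma> :: "riemann_sphere \<Rightarrow> riemann_sphere"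
  have cont: "continuous_on S (\<lambda>z. \<gamma> (Fin z))" if "\<gamma> \<in> {id, rs_inv}" for \<gamma> S
  proof -
    have "\<gamma> = id \<or> \<gamma> = rs_inv" using that by blast
    then show ?thesis
      using continuous_on_Fin[of S] continuous_on_compose2[OF continuous_on_rs_inv[of UNIV] continuous_on_Fin[of S]] by auto
  qed
  have compactF: "compact (F \<gamma>)" if "\<gamma> \<in> {id, rs_inv}" for \<gamma>
    unfolding F_def by (rule compact_Int_closed[OF compact_cball closed_vimage[OF closedE cont[OF that]]])
  obtain K where K: "\<And>\<gamma>. \<gamma> \<in> {id, rs_inv} \<Longrightarrow> K \<gamma> \<subseteq> F \<gamma> \<and> compact (K \<gamma>) \<and> loc_removable (K \<gamma>) \<and>
      (\<forall>t s. 0 < t \<longrightarrow> t < s \<longrightarrow> hausdorff_measure s (F \<gamma>) \<noteq> 0 \<longrightarrow> hausdorff_measure t (K \<gamma>) \<noteq> 0)"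
    using planar_removable_subset_of_full_dimension[OF compactF] by metis
  note K1 = K[of id, simplified] and K2 = K[of rs_inv, simplified]
  define I where "I \<gamma> = (\<lambda>z. \<gamma> (Fin z)) ` K \<gamma>" for \<gamma>
  define E' where "E' = I id \<union> I rs_inv"
  have "compact (I \<gamma>)" if "\<gamma> \<in> {id, rs_inv}" for \<gamma>
    unfolding I_def using K[OF that] by (intro compact_continuous_image[OF cont[OF that]]) blast
  then have "compact E'" unfolding E'_def by (intro compact_Un) auto
  moreover have sub: "E' \<subseteq> E" using K1 K2 by (auto simp: E'_def I_def F_def)
  moreover have "conformally_removable E'"
    unfolding conformally_removable_def
  proof (intro allI impI)
    fix f g assume f: "homeomorphism UNIV UNIV f g" "rs_conformal_on f (- E')"
    \<comment> \<open>In each chart \<open>E'\<close> consists of one of the two planar sets and the inversion of the other.\<close>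
    have chart: "{z. \<alpha> (Fin z) \<in> E'} = K \<alpha> \<union> {z. z \<noteq> 0 \<and> inverse z \<in> K \<beta>}"
      if ab: "\<alpha> = id \<and> \<beta> = rs_inv \<or> \<alpha> = rs_inv \<and> \<beta> = id" for \<alpha> \<beta>
    proof -
      have inv_eq: "rs_inv p = q \<longleftrightarrow> p = rs_inv q" for p q by (metis rs_inv_rs_inv)
      have fin: "Fin z = rs_inv (Fin w) \<longleftrightarrow> z \<noteq> 0 \<and> w = inverse z" for z w
        by (auto simp: inverse_eq_divide)
      have fin': "rs_inv (Fin z) = Fin w \<longleftrightarrow> z \<noteq> 0 \<and> w = inverse z" for z w
        by (auto simp: inverse_eq_divide)
      have "rs_inv (Fin z) = rs_inv (Fin w) \<longleftrightarrow> z = w" for z w by (metis inv_eq rs_inv_rs_inv riemann_sphere.inject)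
      then show ?thesis using ab by (auto simp: E'_def I_def image_iff fin fin' simp del: rs_inv.simps)
    qed
    show "rs_conformal_on f UNIV"
    proof (rule homeomorphism_conformal_if_chart_removable[OF f])
      fix \<alpha> assume "\<alpha> \<in> {id, rs_inv}"
      then obtain \<beta> where ab: "\<alpha> = id \<and> \<beta> = rs_inv \<or> \<alpha> = rs_inv \<and> \<beta> = id" by blast
      then have "compact (K \<alpha>)" "loc_removable (K \<alpha>)" "compact (K \<beta>)" "loc_removable (K \<beta>)" using K1 K2 by auto
      then show "loc_removable {z. \<alpha> (Fin z) \<in> E'}"
        unfolding chart[OF ab] by (intro loc_removable_Un loc_removable_inverse) (auto simp: compact_imp_closed)
    qed
  qed
  moreover have "hausdorff_dim E' = hausdorff_dim E"
  proof (rule antisym)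
    show "hausdorff_dim E' \<le> hausdorff_dim E" using sub by (rule hausdorff_dim_mono)
    show "hausdorff_dim E \<le> hausdorff_dim E'"
    proof (rule hausdorff_dim_le_if_nonnull)
      fix s t :: real assume t: "0 < t" "t < s" and H: "hausdorff_measure s E \<noteq> 0"
      have s: "0 < s" using t by simp
      have "E \<subseteq> (\<lambda>z. id (Fin z)) ` F id \<union> (\<lambda>z. rs_inv (Fin z)) ` F rs_inv"
      proof
        fix p assume "p \<in> E"
        then show "p \<in> (\<lambda>z. id (Fin z)) ` F id \<union> (\<lambda>z. rs_inv (Fin z)) ` F rs_inv"
          using covered_by_two_discs[of p] by (auto simp: F_def simp del: rs_inv.simps)
      qed
      then have "\<exists>\<gamma>\<in>{id, rs_inv}. hausdorff_measure s ((\<lambda>z. \<gamma> (Fin z)) ` F \<gamma>) \<noteq> 0"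
        using H hausdorff_null_subset[OF s] hausdorff_null_Un[OF s] by blast
      then obtain \<gamma> where \<gamma>: "\<gamma> \<in> {id, rs_inv}" "hausdorff_measure s ((\<lambda>z. \<gamma> (Fin z)) ` F \<gamma>) \<noteq> 0" by blast
      have "F \<gamma> \<subseteq> cball 0 1" by (simp add: F_def)
      then have "hausdorff_measure s (F \<gamma>) \<noteq> 0" using \<gamma> hausdorff_null_chart_iff[OF s] by blast
      then have "hausdorff_measure t (K \<gamma>) \<noteq> 0" using K[OF \<gamma>(1)] t by blast
      moreover have "K \<gamma> \<subseteq> cball 0 1" using K[OF \<gamma>(1)] by (auto simp: F_def)
      ultimately have "hausdorff_measure t (I \<gamma>) \<noteq> 0"
        unfolding I_def using \<gamma>(1) hausdorff_null_chart_iff[OF t(1)] by blast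
      moreover have "I \<gamma> \<subseteq> E'" using \<gamma>(1) by (auto simp: E'_def)
      ultimately show "hausdorff_measure t E' \<noteq> 0" using hausdorff_null_subset[OF t(1)] by blast
    qed
  qed
  ultimately show ?thesis by blast
qed

end
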